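(* Let $\Omega$ be a Riemannian manifold and let $\Sigma$ be a closed set that is a proper subset of a connected, $C^1$-embedded, $m$-dimensional submanifold $M$ of $\Omega$. Suppose that $M_i$ is a sequence of $m$-dimensional varieties (or, more generally, varifolds) in $\Omega$ such that the boundary measures of the $M_i$ are uniformly bounded on compact sets (that is, $\limsup_i|\partial M_i|(K)<\infty$ for every compact $K\subset\Omega$) and such that the mean curvatures of the $M_i$ are uniformly bounded. If the areas of the $M_i$ are uniformly bounded on compact subsets of $\Omega\setminus\Sigma$ (that is, $\limsup_i|M_i|(K)<\infty$ for every compact $K\subset\Omega\setminus\Sigma$), then they are also uniformly bounded on compact subsets of $\Omega$.
   Context: A variety here is a properly embedded $m$-dimensional submanifold-with-boundary $M$ of $\Omega$; $|M|(U)$ is the $m$-dimensional area of $M\cap U$ and $|\partial M|(U)$ is the $(m-1)$-dimensional area of $(\partial M)\cap U$. More generally $M$ may be an $m$-dimensional varifold of locally bounded first variation; then $|M|$ is its mass (weight) measure, its mean curvature $H$ is defined by the condition that the part of the first variation $\delta M$ absolutely continuous with respect to $|M|$ is $-H\,|M|$, and $|\partial M|$ is the generalized boundary measure, i.e. the part of the total variation measure of $\delta M$ that is singular with respect to $|M|$. The submanifold $M$ containing $\Sigma$ has no boundary. *)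

theory Defs
  imports "HOL-Analysis.Analysis"
begin

section \<open>Smooth manifolds\<close>

text \<open>
  The manifold is the whole type \<open>'a\<close> (Hausdorff and second countable wherever it is used), with
  charts in a Euclidean space \<open>'e\<close>.  A chart is a pair of its domain and its coordinate map; the
  values of the coordinate map outside the domain are irrelevant.
\<close>

type_synonym ('a, 'e) chart = "'a set \<times> ('a \<Rightarrow> 'e)"

abbreviation chart_inv :: "('a, 'e) chart \<Rightarrow> 'e \<Rightarrow> 'a" where
  "chart_inv c \<equiv> inv_into (fst c) (snd c)"

abbreviation chart_image :: "('a, 'e) chart \<Rightarrow> 'e set" where
  "chart_image c \<equiv> snd c ` fst c"

text \<open>\<open>Ck_on k S f\<close>: \<open>f\<close> is of class \<open>C\<^sup>k\<close> on the open set \<open>S\<close>.\<close>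

primrec Ck_on ::
  "nat \<Rightarrow> 'x::real_normed_vector set \<Rightarrow> ('x \<Rightarrow> 'y::real_normed_vector) \<Rightarrow> bool" where
  "Ck_on 0 S f \<longleftrightarrow> continuous_on S f"
| "Ck_on (Suc k) S f \<longleftrightarrow> (\<forall>x\<in>S. f differentiable (at x)) \<and>
     (\<forall>v. Ck_on k S (\<lambda>x. frechet_derivative f (at x) v))"

definition smooth_on :: "'x::real_normed_vector set \<Rightarrow> ('x \<Rightarrow> 'y::real_normed_vector) \<Rightarrow> bool" where
  "smooth_on S f \<longleftrightarrow> (\<forall>k. Ck_on k S f)"

definition smooth_atlas ::
  "('a::topological_space, 'e::euclidean_space) chart set \<Rightarrow> bool" where
  "smooth_atlas A \<longleftrightarrow>
     (\<Union>c\<in>A. fst c) = UNIV \<and>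
     (\<forall>c\<in>A. open (fst c) \<and> open (chart_image c) \<and>
        homeomorphism (fst c) (chart_image c) (snd c) (chart_inv c)) \<and>
     (\<forall>c\<in>A. \<forall>d\<in>A. smooth_on (snd c ` (fst c \<inter> fst d)) (snd d \<circ> chart_inv c))"

text \<open>
  The tangent space at \<open>p\<close> is \<open>'e\<close>, read in the coordinates of an arbitrarily selected chart
  \<open>chart_at A p\<close> around \<open>p\<close>.  Since that selection need not depend on \<open>p\<close> in any regular way,
  regularity of vector fields, metrics and plane fields is always expressed in the charts of the
  atlas, after applying \<open>chart_deriv\<close> or \<open>chart_inv_deriv\<close>; nothing below depends on the selection.
\<close>

definition chart_at :: "('a, 'e) chart set \<Rightarrow> 'a \<Rightarrow> ('a, 'e) chart" where
  "chart_at A p = (SOME c. c \<in> A \<and> p \<in> fst c)"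

definition coord_change ::
  "('a, 'e::euclidean_space) chart \<Rightarrow> ('a, 'e) chart \<Rightarrow> 'a \<Rightarrow> 'e \<Rightarrow> 'e" where
  "coord_change c d p = frechet_derivative (snd d \<circ> chart_inv c) (at (snd c p))"

text \<open>The differential at \<open>p\<close> of the chart \<open>c\<close>, and its inverse.\<close>

definition chart_deriv ::
  "('a, 'e::euclidean_space) chart set \<Rightarrow> ('a, 'e) chart \<Rightarrow> 'a \<Rightarrow> 'e \<Rightarrow> 'e" where
  "chart_deriv A c p = coord_change (chart_at A p) c p"

definition chart_inv_deriv ::
  "('a, 'e::euclidean_space) chart set \<Rightarrow> ('a, 'e) chart \<Rightarrow> 'a \<Rightarrow> 'e \<Rightarrow> 'e" where
  "chart_inv_deriv A c p = coord_change c (chart_at A p) p"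

definition C1_submanifold ::
  "('a::topological_space, 'e::euclidean_space) chart set \<Rightarrow> nat \<Rightarrow> 'a set \<Rightarrow> bool" where
  "C1_submanifold A m M \<longleftrightarrow>
     (\<forall>p\<in>M. \<exists>c\<in>A. p \<in> fst c \<and>
        (\<exists>W (F :: 'e \<Rightarrow> 'e) F' L.
           open W \<and> snd c p \<in> W \<and> W \<subseteq> chart_image c \<and>
           open (F ` W) \<and> homeomorphism W (F ` W) F F' \<and> Ck_on 1 W F \<and> Ck_on 1 (F ` W) F' \<and>
           subspace L \<and> dim L = m \<and>
           F ` (W \<inter> snd c ` (M \<inter> fst c)) = F ` W \<inter> L))"


section \<open>Riemannian metrics and the Levi-Civita connection\<close>

definition metric_rep ::
  "('a, 'e::euclidean_space) chart set \<Rightarrow> ('a \<Rightarrow> 'e \<Rightarrow> 'e \<Rightarrow> real) \<Rightarrow>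
   ('a, 'e) chart \<Rightarrow> 'e \<Rightarrow> 'e \<Rightarrow> 'e \<Rightarrow> real" where
  "metric_rep A g c y u v =
     (let p = chart_inv c y in g p (chart_inv_deriv A c p u) (chart_inv_deriv A c p v))"

definition riemannian_metric ::
  "('a, 'e::euclidean_space) chart set \<Rightarrow> ('a \<Rightarrow> 'e \<Rightarrow> 'e \<Rightarrow> real) \<Rightarrow> bool" where
  "riemannian_metric A g \<longleftrightarrow>
     (\<forall>p. bilinear (g p) \<and> (\<forall>u v. g p u v = g p v u) \<and> (\<forall>u. u \<noteq> 0 \<longrightarrow> 0 < g p u u)) \<and>
     (\<forall>c\<in>A. \<forall>u v. smooth_on (chart_image c) (\<lambda>y. metric_rep A g c y u v))"

definition riemannian_manifold ::
  "('a::topological_space, 'e::euclidean_space) chart set \<Rightarrow> ('a \<Rightarrow> 'e \<Rightarrow> 'e \<Rightarrow> real) \<Rightarrow> bool" where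
  "riemannian_manifold A g \<longleftrightarrow> smooth_atlas A \<and> riemannian_metric A g"

definition field_rep ::
  "('a, 'e::euclidean_space) chart set \<Rightarrow> ('a, 'e) chart \<Rightarrow> ('a \<Rightarrow> 'e) \<Rightarrow> 'a \<Rightarrow> 'e" where
  "field_rep A c X p = chart_deriv A c p (X p)"

definition C1_field ::
  "('a, 'e::euclidean_space) chart set \<Rightarrow> ('a \<Rightarrow> 'e) \<Rightarrow> bool" where
  "C1_field A X \<longleftrightarrow> (\<forall>c\<in>A. Ck_on 1 (chart_image c) (field_rep A c X \<circ> chart_inv c))"

definition borel_field ::
  "('a::topological_space, 'e::euclidean_space) chart set \<Rightarrow> ('a \<Rightarrow> 'e) \<Rightarrow> bool" where
  "borel_field A X \<longleftrightarrow>
     (\<forall>c\<in>A. field_rep A c X \<in> borel_measurable (restrict_space borel (fst c)))"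

text \<open>
  Christoffel symbols of the first kind in the chart \<open>c\<close>: the inner product with \<open>w\<close> of the
  covariant derivative, in direction \<open>u\<close>, of the field with constant coordinates \<open>v\<close>.
\<close>

definition christoffel ::
  "('a, 'e::euclidean_space) chart set \<Rightarrow> ('a \<Rightarrow> 'e \<Rightarrow> 'e \<Rightarrow> real) \<Rightarrow>
   ('a, 'e) chart \<Rightarrow> 'e \<Rightarrow> 'e \<Rightarrow> 'e \<Rightarrow> 'e \<Rightarrow> real" where
  "christoffel A g c y u v w =
     (frechet_derivative (\<lambda>z. metric_rep A g c z v w) (at y) u
    + frechet_derivative (\<lambda>z. metric_rep A g c z u w) (at y) v
    - frechet_derivative (\<lambda>z. metric_rep A g c z u v) (at y) w) / 2"

definition cov_deriv ::
  "('a, 'e::euclidean_space) chart set \<Rightarrow> ('a \<Rightarrow> 'e \<Rightarrow> 'e \<Rightarrow> real) \<Rightarrow>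
   ('a \<Rightarrow> 'e) \<Rightarrow> 'a \<Rightarrow> 'e \<Rightarrow> 'e" where
  "cov_deriv A g X p u =
     (let c = chart_at A p; y = snd c p in
      THE z. \<forall>w. g p z w =
        g p (frechet_derivative (field_rep A c X \<circ> chart_inv c) (at y) u) w
        + christoffel A g c y u (X p) w)"

definition orthonormal_basis_of ::
  "('e::real_vector \<Rightarrow> 'e \<Rightarrow> real) \<Rightarrow> 'e set \<Rightarrow> 'e set \<Rightarrow> bool" where
  "orthonormal_basis_of b S B \<longleftrightarrow>
     B \<subseteq> S \<and> span B = S \<and> (\<forall>u\<in>B. \<forall>v\<in>B. b u v = (if u = v then 1 else 0))"

text \<open>The divergence of \<open>X\<close> at \<open>p\<close> along the plane \<open>S\<close> in the tangent space at \<open>p\<close>.\<close>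

definition plane_div ::
  "('a, 'e::euclidean_space) chart set \<Rightarrow> ('a \<Rightarrow> 'e \<Rightarrow> 'e \<Rightarrow> real) \<Rightarrow>
   ('a \<Rightarrow> 'e) \<Rightarrow> 'a \<Rightarrow> 'e set \<Rightarrow> real" where
  "plane_div A g X p S =
     (let B = (SOME B. orthonormal_basis_of (g p) S B)
      in \<Sum>e\<in>B. g p (cov_deriv A g X p e) e)"


section \<open>Varifolds\<close>

definition grassmann_bundle :: "nat \<Rightarrow> ('a \<times> 'e::euclidean_space set) set" where
  "grassmann_bundle m = {(p, S). subspace S \<and> dim S = m}"

text \<open>
  A plane is topologized through the orthogonal projection onto it (with respect to the inner
  product of the model space), and the bundle through its local trivializations.
\<close>

definition plane_proj :: "'e::euclidean_space set \<Rightarrow> 'e \<Rightarrow>\<^sub>L 'e" where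
  "plane_proj S = Blinfun (closest_point S)"

definition grassmann_topology ::
  "('a, 'e::euclidean_space) chart set \<Rightarrow> nat \<Rightarrow> ('a \<times> 'e set) topology" where
  "grassmann_topology A m = topology_generated_by
     {{(p, S) \<in> grassmann_bundle m. p \<in> fst c \<and> (snd c p, plane_proj (chart_deriv A c p ` S)) \<in> Q}
      | c Q. c \<in> A \<and> open Q}"

definition varifold ::
  "('a, 'e::euclidean_space) chart set \<Rightarrow> nat \<Rightarrow> ('a \<times> 'e set) measure \<Rightarrow> bool" where
  "varifold A m V \<longleftrightarrow>
     space V = grassmann_bundle m \<and>
     sets V = sigma_sets (grassmann_bundle m) {Q. openin (grassmann_topology A m) Q} \<and>
     (\<forall>C. compactin (grassmann_topology A m) C \<longrightarrow> emeasure V C < \<infinity>)"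

definition weight :: "('a::topological_space \<times> 'e set) measure \<Rightarrow> 'a measure" where
  "weight V = distr V borel fst"

definition field_support :: "('a::topological_space \<Rightarrow> 'e::zero) \<Rightarrow> 'a set" where
  "field_support X = closure {p. X p \<noteq> 0}"

definition test_field ::
  "('a::topological_space, 'e::euclidean_space) chart set \<Rightarrow> ('a \<Rightarrow> 'e) \<Rightarrow> bool" where
  "test_field A X \<longleftrightarrow> C1_field A X \<and> compact (field_support X)"

definition first_variation ::
  "('a, 'e::euclidean_space) chart set \<Rightarrow> ('a \<Rightarrow> 'e \<Rightarrow> 'e \<Rightarrow> real) \<Rightarrow>
   ('a \<times> 'e set) measure \<Rightarrow> ('a \<Rightarrow> 'e) \<Rightarrow> real" where
  "first_variation A g V X = (LINT (p, S)|V. plane_div A g X p S)"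

definition locally_bounded_first_variation ::
  "('a::topological_space, 'e::euclidean_space) chart set \<Rightarrow> ('a \<Rightarrow> 'e \<Rightarrow> 'e \<Rightarrow> real) \<Rightarrow>
   ('a \<times> 'e set) measure \<Rightarrow> bool" where
  "locally_bounded_first_variation A g V \<longleftrightarrow>
     (\<forall>K. compact K \<longrightarrow> (\<exists>C. \<forall>X. test_field A X \<and> field_support X \<subseteq> K \<and>
        (\<forall>p. g p (X p) (X p) \<le> 1) \<longrightarrow> \<bar>first_variation A g V X\<bar> \<le> C))"

definition radon_measure :: "'a::topological_space measure \<Rightarrow> bool" where
  "radon_measure \<mu> \<longleftrightarrow> sets \<mu> = sets borel \<and> (\<forall>K. compact K \<longrightarrow> emeasure \<mu> K < \<infinity>)"

text \<open>
  \<open>\<mu>\<close> is the total variation measure of the first variation of \<open>V\<close>, and \<open>\<nu>\<close> is the unit vector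
  field in the Riesz representation of the first variation, i.e. the first variation is the
  vector-valued measure \<open>\<nu> \<mu>\<close>.
\<close>

definition total_variation_polar ::
  "('a::topological_space, 'e::euclidean_space) chart set \<Rightarrow> ('a \<Rightarrow> 'e \<Rightarrow> 'e \<Rightarrow> real) \<Rightarrow>
   ('a \<times> 'e set) measure \<Rightarrow> 'a measure \<Rightarrow> ('a \<Rightarrow> 'e) \<Rightarrow> bool" where
  "total_variation_polar A g V \<mu> \<nu> \<longleftrightarrow>
     radon_measure \<mu> \<and>
     (\<forall>U. open U \<longrightarrow> emeasure \<mu> U =
        (SUP X \<in> {X. test_field A X \<and> field_support X \<subseteq> U \<and> (\<forall>p. g p (X p) (X p) \<le> 1)}.
           ennreal (first_variation A g V X))) \<and>
     borel_field A \<nu> \<and> (AE p in \<mu>. g p (\<nu> p) (\<nu> p) = 1) \<and>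
     (\<forall>X. test_field A X \<longrightarrow> first_variation A g V X = (LINT p|\<mu>. g p (X p) (\<nu> p)))"

definition mutually_singular :: "'a::topological_space measure \<Rightarrow> 'a measure \<Rightarrow> bool" where
  "mutually_singular \<mu> \<beta> \<longleftrightarrow> (\<exists>N\<in>sets borel. emeasure \<mu> N = 0 \<and> emeasure \<beta> (- N) = 0)"

text \<open>
  With the first variation written as \<open>\<nu> \<mu>\<close> and the Lebesgue decomposition
  \<open>\<mu> = \<rho> (weight V) + \<beta>\<close> of its total variation, \<open>\<beta>\<close> is the generalized boundary measure and the
  mean curvature \<open>H\<close> is given by \<open>- H (weight V) = \<nu> \<rho> (weight V)\<close>.  The pair \<open>(H, \<beta>)\<close> is determined
  by \<open>V\<close>, up to null sets of the weight in the case of \<open>H\<close>; by the theorems of Riesz and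
  Radon-Nikodym it exists whenever \<open>V\<close> has locally bounded first variation.
\<close>

definition mean_curvature_and_boundary ::
  "('a::topological_space, 'e::euclidean_space) chart set \<Rightarrow> ('a \<Rightarrow> 'e \<Rightarrow> 'e \<Rightarrow> real) \<Rightarrow>
   ('a \<times> 'e set) measure \<Rightarrow> ('a \<Rightarrow> 'e) \<Rightarrow> 'a measure \<Rightarrow> bool" where
  "mean_curvature_and_boundary A g V H \<beta> \<longleftrightarrow>
     (\<exists>\<mu> \<nu> \<rho>. total_variation_polar A g V \<mu> \<nu> \<and>
        radon_measure \<beta> \<and> mutually_singular (weight V) \<beta> \<and>
        \<rho> \<in> borel_measurable borel \<and> (\<forall>p. (0::real) \<le> \<rho> p) \<and>
        (\<forall>B\<in>sets borel. emeasure \<mu> B =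
           emeasure (density (weight V) (\<lambda>p. ennreal (\<rho> p))) B + emeasure \<beta> B) \<and>
        borel_field A H \<and> (AE p in weight V. - H p = \<rho> p *\<^sub>R \<nu> p))"

end

theory Submission
  imports Defs
begin

text \<open>
  Let \<open>Z\<close> be the set of points near which the areas blow up; it is closed and contained in \<open>\<Sigma>\<close>.  If \<open>Z\<close>
  were nonempty, then by connectedness some \<open>q\<close> in \<open>Z\<close> would be a limit of points of \<open>M - Z\<close>.  Work in a
  chart at \<open>q\<close>, take \<open>a\<close> in \<open>M - Z\<close> close to \<open>q\<close>, and let \<open>\<rho>\<close> be the distance from \<open>a\<close> to \<open>Z\<close> measured
  along the tangent plane of \<open>M\<close> at \<open>q\<close>.  In coordinates around \<open>a\<close> scaled by \<open>\<rho>\<close>, let \<open>t\<close> and \<open>n\<close> be the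
  squared lengths of the tangential and normal components, put \<open>v = - t + C n - C\<^sup>2 n\<^sup>2\<close> and consider the
  vector field \<open>w = max 0 (v + 3/2) ^ k * grad v\<close>.  Because \<open>C\<^sup>1\<close> regularity keeps \<open>n\<close> small and the
  choice of \<open>\<rho>\<close> gives \<open>t \<ge> 1\<close> on \<open>Z\<close>, for large \<open>k\<close> and \<open>C\<close> and small \<open>\<rho>\<close> the divergence of \<open>w\<close> along
  every \<open>m\<close>-plane is at least \<open>h |w|\<close> near \<open>Z\<close>, strictly so at a point of \<open>Z\<close> with \<open>t = 1\<close>.
  Inserting \<open>w\<close> into the first variation bounds the area near that point by the boundary measure and
  by areas away from \<open>Z\<close>, which are bounded: a contradiction.  This merges the maximum principle for
  area blow-up sets with the constancy theorem.
\<close>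

text \<open>A \<open>C1\<close> submanifold offers no second-order data for a comparison; what
  survives at scale \<open>\<rho>\<close> is that \<open>M\<close> lies in a thin cone about a
  plane. The planes carried by the varifolds need not be related to \<open>M\<close>, so the
  divergence has to be bounded below along every \<open>m\<close>-plane. Along the plane itself the
  Hessian of \<open>v\<close> has trace \<open>- 2 m\<close>, hence \<open>v\<close> is far from
  convex enough; the derivative of the power in front of the gradient adds \<open>k\<close> times
  the squared tangential gradient, which repairs this wherever \<open>t\<close> stays away from
  \<open>0\<close>. That is why the contact point is the point of \<open>Z\<close> nearest to
  \<open>a\<close> and not \<open>q\<close>: minimality keeps \<open>Z\<close> away from the axis
  \<open>t = 0\<close>, where the gradient of \<open>t\<close> vanishes.

  Scaling also disposes of curvature: derivatives of the metric and the bound \<open>h\<close> enter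
  with the factor \<open>1 / \<rho>\<close>, the barrier with its square. As \<open>h |w|\<close> is
  part of the pointwise inequality, the mean curvature term of the first variation is absorbed
  without loss, and only the boundary term and a compact set disjoint from \<open>Z\<close> remain
  on the other side.\<close>

section \<open>Maps of class C1\<close>

text \<open>Otherwise \<open>Ck_on 1\<close> is rewritten to the unfolded \<open>Ck_on (Suc 0)\<close> and no lemma below applies.\<close>

declare Ck_on.simps [simp del] One_nat_def [simp del]

lemma Ck1_iff:
  "Ck_on 1 S f \<longleftrightarrow> (\<forall>x\<in>S. f differentiable (at x)) \<and>
     (\<forall>v. continuous_on S (\<lambda>x. frechet_derivative f (at x) v))"
  by (simp add: One_nat_def Ck_on.simps)

lemma Ck1_has_derivative:
  "Ck_on 1 S f \<Longrightarrow> x \<in> S \<Longrightarrow> (f has_derivative frechet_derivative f (at x)) (at x)"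
  by (simp add: Ck1_iff frechet_derivative_works)

lemma Ck1_continuous_derivative:
  "Ck_on 1 S f \<Longrightarrow> continuous_on S (\<lambda>x. frechet_derivative f (at x) v)"
  by (simp add: Ck1_iff)

lemma Ck1I:
  assumes "\<And>x. x \<in> S \<Longrightarrow> (f has_derivative f' x) (at x)" "\<And>v. continuous_on S (\<lambda>x. f' x v)"
  shows "Ck_on 1 S f"
  unfolding Ck1_iff
proof (intro conjI ballI allI)
  show "f differentiable at x" if "x \<in> S" for x
    using assms(1) that differentiable_def by blast
  show "continuous_on S (\<lambda>x. frechet_derivative f (at x) v)" for v
  proof (rule continuous_on_eq[OF assms(2)])
    show "f' x v = frechet_derivative f (at x) v" if "x \<in> S" for x
      using frechet_derivative_at[OF assms(1)[OF that]] by simp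
  qed
qed

lemma Ck1_continuous: "Ck_on 1 S f \<Longrightarrow> continuous_on S f"
  by (meson Ck1_iff continuous_at_imp_continuous_on differentiable_imp_continuous_within)

lemma Ck1_local:
  assumes "\<And>x. x \<in> S \<Longrightarrow> \<exists>U. open U \<and> x \<in> U \<and> Ck_on 1 U f"
  shows "Ck_on 1 S f"
  unfolding Ck1_iff
proof (intro conjI ballI allI)
  show "f differentiable at x" if "x \<in> S" for x
    using assms[OF that] by (auto simp: Ck1_iff)
  show "continuous_on S (\<lambda>x. frechet_derivative f (at x) v)" for v
  proof (rule continuous_at_imp_continuous_on, rule ballI)
    fix x assume "x \<in> S"
    then obtain U where "open U" "x \<in> U" "Ck_on 1 U f" using assms by blast
    then show "isCont (\<lambda>x. frechet_derivative f (at x) v) x"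
      using Ck1_continuous_derivative continuous_on_eq_continuous_at by blast
  qed
qed

lemma Ck1_subset: "Ck_on 1 S f \<Longrightarrow> T \<subseteq> S \<Longrightarrow> Ck_on 1 T f"
  by (auto simp: Ck1_iff intro: continuous_on_subset)

lemma frechet_derivative_cong_open:
  assumes "open S" "x \<in> S" "\<And>y. y \<in> S \<Longrightarrow> f y = g y"
  shows "frechet_derivative f (at x) = frechet_derivative g (at x)"
proof -
  have "(f has_derivative D) (at x) \<longleftrightarrow> (g has_derivative D) (at x)" for D
    using has_derivative_transform_within_open[OF _ assms(1,2)] assms(3) by metis
  then show ?thesis by (simp add: frechet_derivative_def)
qed

lemma Ck1_cong:
  assumes "open S" "\<And>x. x \<in> S \<Longrightarrow> f x = g x" "Ck_on 1 S f"
  shows "Ck_on 1 S g"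
proof (rule Ck1I)
  show "(g has_derivative frechet_derivative f (at x)) (at x)" if "x \<in> S" for x
    using has_derivative_transform_within_open[OF Ck1_has_derivative[OF assms(3) that] assms(1) that] assms(2)
    by blast
  show "continuous_on S (\<lambda>x. frechet_derivative f (at x) v)" for v
    using assms(3) by (rule Ck1_continuous_derivative)
qed

lemma Ck1_const: "Ck_on 1 S (\<lambda>x. c)"
  by (rule Ck1I[where f' = "\<lambda>x v. 0"]) auto

lemma Ck1_bounded_linear:
  assumes "bounded_linear L" "Ck_on 1 S f"
  shows "Ck_on 1 S (\<lambda>x. L (f x))"
proof (rule Ck1I)
  show "((\<lambda>x. L (f x)) has_derivative (\<lambda>v. L (frechet_derivative f (at x) v))) (at x)" if "x \<in> S" for x
    using bounded_linear.has_derivative[OF assms(1) Ck1_has_derivative[OF assms(2) that]] .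
  show "continuous_on S (\<lambda>x. L (frechet_derivative f (at x) v))" for v
    using bounded_linear.continuous_on[OF assms(1) Ck1_continuous_derivative[OF assms(2)]] .
qed

lemma Ck1_add:
  assumes "Ck_on 1 S f" "Ck_on 1 S g"
  shows "Ck_on 1 S (\<lambda>x. f x + g x)"
proof (rule Ck1I)
  show "((\<lambda>x. f x + g x) has_derivative
      (\<lambda>v. frechet_derivative f (at x) v + frechet_derivative g (at x) v)) (at x)" if "x \<in> S" for x
    using has_derivative_add[OF Ck1_has_derivative[OF assms(1) that] Ck1_has_derivative[OF assms(2) that]] .
  show "continuous_on S (\<lambda>x. frechet_derivative f (at x) v + frechet_derivative g (at x) v)" for v
    by (intro continuous_on_add Ck1_continuous_derivative assms)
qed

lemma Ck1_sum:
  assumes "\<And>i. i \<in> I \<Longrightarrow> Ck_on 1 S (f i)"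
  shows "Ck_on 1 S (\<lambda>x. \<Sum>i\<in>I. f i x)"
  using assms by (induction I rule: infinite_finite_induct) (auto intro: Ck1_const Ck1_add)

lemma Ck1_bilinear:
  assumes "bounded_bilinear p" "Ck_on 1 S f" "Ck_on 1 S g"
  shows "Ck_on 1 S (\<lambda>x. p (f x) (g x))"
proof (rule Ck1I)
  show "((\<lambda>x. p (f x) (g x)) has_derivative (\<lambda>v. p (f x) (frechet_derivative g (at x) v)
      + p (frechet_derivative f (at x) v) (g x))) (at x)" if "x \<in> S" for x
    using bounded_bilinear.FDERIV[OF assms(1) Ck1_has_derivative[OF assms(2) that] Ck1_has_derivative[OF assms(3) that]] .
  show "continuous_on S (\<lambda>x. p (f x) (frechet_derivative g (at x) v)
      + p (frechet_derivative f (at x) v) (g x))" for v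
    by (intro continuous_on_add bounded_bilinear.continuous_on[OF assms(1)] Ck1_continuous_derivative
        Ck1_continuous assms(2,3))
qed

text \<open>Expansion in a basis reduces the family to finitely many coefficient maps, so
  derivatives for each fixed \<open>v\<close> already give the product rule. This spares a detour
  through operator-valued maps.\<close>

lemma has_derivative_linear_family:
  fixes T :: "'a::real_normed_vector \<Rightarrow> 'b::euclidean_space \<Rightarrow> 'c::real_normed_vector"
  assumes S: "open S" "z \<in> S" and lin: "\<And>y. y \<in> S \<Longrightarrow> linear (T y)"
    and T: "\<And>v. ((\<lambda>y. T y v) has_derivative D v) (at z)"
    and r: "(r has_derivative r') (at z)"
  shows "((\<lambda>y. T y (r y)) has_derivative (\<lambda>h. D (r z) h + T z (r' h))) (at z)"
proof -
  have ex: "T y v = (\<Sum>b\<in>Basis. (v \<bullet> b) *\<^sub>R T y b)" if "y \<in> S" for y v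
    using linear_sum[OF lin[OF that], of "\<lambda>b. (v \<bullet> b) *\<^sub>R b" Basis] lin[OF that]
    by (simp add: euclidean_representation linear_cmul)
  \<comment> \<open>Linearity of \<open>D v\<close> in \<open>v\<close> comes out of uniqueness of
    the derivative.\<close>
  have D: "D v = (\<lambda>h. \<Sum>b\<in>Basis. (v \<bullet> b) *\<^sub>R D b h)" for v
  proof (rule has_derivative_unique[OF T])
    have "((\<lambda>y. \<Sum>b\<in>Basis. (v \<bullet> b) *\<^sub>R T y b) has_derivative (\<lambda>h. \<Sum>b\<in>Basis. (v \<bullet> b) *\<^sub>R D b h)) (at z)"
      by (intro has_derivative_sum has_derivative_scaleR_right T)
    then show "((\<lambda>y. T y v) has_derivative (\<lambda>h. \<Sum>b\<in>Basis. (v \<bullet> b) *\<^sub>R D b h)) (at z)"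
      by (rule has_derivative_transform_within_open[OF _ S]) (simp add: ex[symmetric])
  qed
  have "((\<lambda>y. \<Sum>b\<in>Basis. (r y \<bullet> b) *\<^sub>R T y b) has_derivative
      (\<lambda>h. \<Sum>b\<in>Basis. (r z \<bullet> b) *\<^sub>R D b h + (r' h \<bullet> b) *\<^sub>R T z b)) (at z)"
    by (intro has_derivative_sum has_derivative_scaleR T has_derivative_inner_left r)
  then have "((\<lambda>y. T y (r y)) has_derivative
      (\<lambda>h. \<Sum>b\<in>Basis. (r z \<bullet> b) *\<^sub>R D b h + (r' h \<bullet> b) *\<^sub>R T z b)) (at z)"
    by (rule has_derivative_transform_within_open[OF _ S]) (simp add: ex[symmetric])
  then show ?thesis
    unfolding ex[OF S(2), of "r' _"] D[of "r z"] by (simp add: sum.distrib)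
qed

lemma continuous_on_linear_family:
  fixes T :: "'a::topological_space \<Rightarrow> 'b::euclidean_space \<Rightarrow> 'c::real_normed_vector"
  assumes lin: "\<And>y. y \<in> S \<Longrightarrow> linear (T y)"
    and T: "\<And>v. continuous_on S (\<lambda>y. T y v)"
    and r: "continuous_on S r"
  shows "continuous_on S (\<lambda>y. T y (r y))"
proof -
  have ex: "(\<Sum>b\<in>Basis. (v \<bullet> b) *\<^sub>R T y b) = T y v" if "y \<in> S" for y v
    using linear_sum[OF lin[OF that], of "\<lambda>b. (v \<bullet> b) *\<^sub>R b" Basis] lin[OF that]
    by (simp add: euclidean_representation linear_cmul)
  have "continuous_on S (\<lambda>y. \<Sum>b\<in>Basis. (r y \<bullet> b) *\<^sub>R T y b)"
    by (intro continuous_intros T r)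
  then show ?thesis
    by (rule continuous_on_eq) (simp add: ex)
qed

text \<open>The differentiated family is again linear in \<open>v\<close>, so the lemmas on linear
  families apply to it in turn.\<close>

lemma Ck1_family_derivative_linear:
  fixes T :: "'a::real_normed_vector \<Rightarrow> 'b::real_vector \<Rightarrow> 'c::real_normed_vector"
  assumes S: "open S" "x \<in> S" and lin: "\<And>y. y \<in> S \<Longrightarrow> linear (T y)"
    and T: "\<And>v. (\<lambda>y. T y v) differentiable (at x)"
  shows "linear (\<lambda>v. frechet_derivative (\<lambda>y. T y v) (at x) h)"
proof (rule linearI)
  have T': "((\<lambda>y. T y v) has_derivative frechet_derivative (\<lambda>y. T y v) (at x)) (at x)" for v
    using T frechet_derivative_works by blast
  fix u v :: 'b and c :: real
  have "((\<lambda>y. T y u + T y v) has_derivative (\<lambda>h. frechet_derivative (\<lambda>y. T y u) (at x) h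
      + frechet_derivative (\<lambda>y. T y v) (at x) h)) (at x)"
    by (intro has_derivative_add T')
  then have "((\<lambda>y. T y (u + v)) has_derivative (\<lambda>h. frechet_derivative (\<lambda>y. T y u) (at x) h
      + frechet_derivative (\<lambda>y. T y v) (at x) h)) (at x)"
    by (rule has_derivative_transform_within_open[OF _ S]) (simp add: lin linear_add)
  from fun_cong[OF frechet_derivative_at[OF this], of h]
  show "frechet_derivative (\<lambda>y. T y (u + v)) (at x) h = frechet_derivative (\<lambda>y. T y u) (at x) h
      + frechet_derivative (\<lambda>y. T y v) (at x) h" by simp
  have "((\<lambda>y. c *\<^sub>R T y u) has_derivative (\<lambda>h. c *\<^sub>R frechet_derivative (\<lambda>y. T y u) (at x) h)) (at x)"
    by (intro has_derivative_scaleR_right T')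
  then have "((\<lambda>y. T y (c *\<^sub>R u)) has_derivative (\<lambda>h. c *\<^sub>R frechet_derivative (\<lambda>y. T y u) (at x) h)) (at x)"
    by (rule has_derivative_transform_within_open[OF _ S]) (simp add: lin linear_cmul)
  from fun_cong[OF frechet_derivative_at[OF this], of h]
  show "frechet_derivative (\<lambda>y. T y (c *\<^sub>R u)) (at x) h = c *\<^sub>R frechet_derivative (\<lambda>y. T y u) (at x) h"
    by simp
qed

lemma Ck1_linear_family:
  fixes T :: "'a::real_normed_vector \<Rightarrow> 'b::euclidean_space \<Rightarrow> 'c::real_normed_vector"
  assumes S: "open S" and lin: "\<And>y. y \<in> S \<Longrightarrow> linear (T y)"
    and T: "\<And>v. Ck_on 1 S (\<lambda>y. T y v)"
    and r: "Ck_on 1 S r"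
  shows "Ck_on 1 S (\<lambda>y. T y (r y))"
proof (rule Ck1I)
  show "((\<lambda>y. T y (r y)) has_derivative (\<lambda>h. frechet_derivative (\<lambda>y. T y (r x)) (at x) h
      + T x (frechet_derivative r (at x) h))) (at x)" if "x \<in> S" for x
    by (rule has_derivative_linear_family[OF S that lin Ck1_has_derivative[OF T that] Ck1_has_derivative[OF r that]])
  show "continuous_on S (\<lambda>x. frechet_derivative (\<lambda>y. T y (r x)) (at x) h
      + T x (frechet_derivative r (at x) h))" for h
  proof (intro continuous_on_add)
    show "continuous_on S (\<lambda>x. frechet_derivative (\<lambda>y. T y (r x)) (at x) h)"
    proof (rule continuous_on_linear_family)
      show "linear (\<lambda>v. frechet_derivative (\<lambda>y. T y v) (at x) h)" if "x \<in> S" for x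
        by (rule Ck1_family_derivative_linear[OF S that lin]) (use T that in \<open>auto simp: Ck1_iff\<close>)
      show "continuous_on S (\<lambda>x. frechet_derivative (\<lambda>y. T y v) (at x) h)" for v
        using T by (rule Ck1_continuous_derivative)
      show "continuous_on S r" using r by (rule Ck1_continuous)
    qed
    show "continuous_on S (\<lambda>x. T x (frechet_derivative r (at x) h))"
      by (rule continuous_on_linear_family[OF lin Ck1_continuous[OF T] Ck1_continuous_derivative[OF r]])
  qed
qed

lemma Ck1_bilinear_family:
  fixes G :: "'a::real_normed_vector \<Rightarrow> 'b::euclidean_space \<Rightarrow> 'c::euclidean_space \<Rightarrow> 'd::real_normed_vector"
  assumes S: "open S" and lin: "\<And>y. y \<in> S \<Longrightarrow> bilinear (G y)"
    and G: "\<And>u v. Ck_on 1 S (\<lambda>y. G y u v)"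
    and r: "Ck_on 1 S r" and s: "Ck_on 1 S s"
  shows "Ck_on 1 S (\<lambda>y. G y (r y) (s y))"
proof (rule Ck1_linear_family[where T = "\<lambda>y v. G y (r y) v", OF S _ _ s])
  show "linear (G y (r y))" if "y \<in> S" for y using lin[OF that] by (simp add: bilinear_def)
  show "Ck_on 1 S (\<lambda>y. G y (r y) v)" for v
  proof (rule Ck1_linear_family[where T = "\<lambda>y u. G y u v", OF S _ G r])
    show "linear (\<lambda>u. G y u v)" if "y \<in> S" for y using lin[OF that] by (simp add: bilinear_def)
  qed
qed

lemma continuous_on_bilinear_family:
  fixes G :: "'a::topological_space \<Rightarrow> 'b::euclidean_space \<Rightarrow> 'c::euclidean_space \<Rightarrow> 'd::real_normed_vector"
  assumes lin: "\<And>y. y \<in> S \<Longrightarrow> bilinear (G y)"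
    and G: "\<And>u v. continuous_on S (\<lambda>y. G y u v)"
    and r: "continuous_on S r" and s: "continuous_on S s"
  shows "continuous_on S (\<lambda>y. G y (r y) (s y))"
proof (rule continuous_on_linear_family[where T = "\<lambda>y v. G y (r y) v", OF _ _ s])
  show "linear (G y (r y))" if "y \<in> S" for y using lin[OF that] by (simp add: bilinear_def)
  show "continuous_on S (\<lambda>y. G y (r y) v)" for v
  proof (rule continuous_on_linear_family[where T = "\<lambda>y u. G y u v", OF _ G r])
    show "linear (\<lambda>u. G y u v)" if "y \<in> S" for y using lin[OF that] by (simp add: bilinear_def)
  qed
qed

lemma Ck1_compose:
  fixes f :: "'a::real_normed_vector \<Rightarrow> 'b::euclidean_space" and h :: "'b \<Rightarrow> 'c::real_normed_vector"
  assumes f: "Ck_on 1 S f" and h: "Ck_on 1 T h" and ST: "f ` S \<subseteq> T"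
  shows "Ck_on 1 S (\<lambda>x. h (f x))"
proof (rule Ck1I)
  have fT: "f x \<in> T" if "x \<in> S" for x using ST that by blast
  show "((\<lambda>x. h (f x)) has_derivative (\<lambda>v. frechet_derivative h (at (f x)) (frechet_derivative f (at x) v))) (at x)"
    if "x \<in> S" for x
    using has_derivative_compose[OF Ck1_has_derivative[OF f that] Ck1_has_derivative[OF h fT[OF that]]] .
  show "continuous_on S (\<lambda>x. frechet_derivative h (at (f x)) (frechet_derivative f (at x) v))" for v
  proof (rule continuous_on_linear_family)
    show "linear (frechet_derivative h (at (f y)))" if "y \<in> S" for y
      using Ck1_has_derivative[OF h fT[OF that]] by (rule has_derivative_linear)
    show "continuous_on S (\<lambda>y. frechet_derivative h (at (f y)) v)" for v
      using continuous_on_compose2[OF Ck1_continuous_derivative[OF h] Ck1_continuous[OF f] ST] .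
    show "continuous_on S (\<lambda>y. frechet_derivative f (at y) v)"
      using f by (rule Ck1_continuous_derivative)
  qed
qed

lemma Ck1_real:
  fixes f :: "real \<Rightarrow> real"
  assumes "\<And>x. x \<in> S \<Longrightarrow> (f has_real_derivative f' x) (at x)" "continuous_on S f'"
  shows "Ck_on 1 S f"
  by (rule Ck1I[where f' = "\<lambda>x v. f' x * v"])
    (use assms in \<open>auto simp: has_field_derivative_def intro!: continuous_intros\<close>)

text \<open>Schwarz's theorem through the second difference over a small parallelogram: two mean
  value steps turn it into \<open>s * s\<close> times a mixed second derivative, while the
  difference itself is symmetric in the two directions.\<close>

lemma second_derivative_symmetric_real:
  fixes f :: "'a::real_normed_vector \<Rightarrow> real"
  assumes S: "open S" "x \<in> S"
    and f: "\<And>y. y \<in> S \<Longrightarrow> (f has_derivative f' y) (at y)"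
    and f2: "\<And>y v. y \<in> S \<Longrightarrow> ((\<lambda>z. f' z v) has_derivative f'' v y) (at y)"
    and cont: "\<And>u v. continuous_on S (\<lambda>y. f'' u y v)"
  shows "f'' u x v = f'' v x u"
proof -
  obtain e where e: "e > 0" "ball x e \<subseteq> S" using S openE by blast
  define \<Delta> where "\<Delta> u v s = f (x + s *\<^sub>R u + s *\<^sub>R v) - f (x + s *\<^sub>R u) - f (x + s *\<^sub>R v) + f x"
    for u v :: 'a and s :: real
  \<comment> \<open>Side length that keeps the parallelogram inside the ball; the summand 1 keeps
    the denominator positive when both directions vanish.\<close>
  define d where "d u v = e / (norm u + norm v + 1)" for u v :: 'a
  have dpos: "d u v > 0" for u v :: 'a
    unfolding d_def using e by (intro divide_pos_pos add_nonneg_pos) auto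
  have inS: "x + a *\<^sub>R u + b *\<^sub>R v \<in> S" if "0 \<le> a" "a < d u v" "0 \<le> b" "b < d u v" for u v :: 'a and a b
  proof -
    have "norm (a *\<^sub>R u + b *\<^sub>R v) \<le> a * norm u + b * norm v"
      using norm_triangle_ineq[of "a *\<^sub>R u" "b *\<^sub>R v"] that by simp
    also have "\<dots> \<le> d u v * norm u + d u v * norm v"
      using that by (intro add_mono mult_right_mono) auto
    also have "\<dots> = d u v * (norm u + norm v)" by (simp add: algebra_simps)
    also have "\<dots> < d u v * (norm u + norm v + 1)" using dpos by simp
    also have "\<dots> = e" unfolding d_def using add_nonneg_pos[of "norm u + norm v" 1] by simp
    finally have "x + a *\<^sub>R u + b *\<^sub>R v \<in> ball x e"
      by (simp only: mem_ball dist_commute[of x]) (simp add: dist_norm add.assoc)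
    then show ?thesis using e by blast
  qed
  have mvt: "\<exists>a b. 0 < a \<and> a < s \<and> 0 < b \<and> b < s \<and> \<Delta> u v s = s * s * f'' u (x + a *\<^sub>R u + b *\<^sub>R v) v"
    if s: "0 < s" "s < d u v" for u v s
  proof -
    define k where "k r = f (x + r *\<^sub>R u + s *\<^sub>R v) - f (x + r *\<^sub>R u)" for r
    have kd: "(k has_derivative (\<lambda>h. f' (x + r *\<^sub>R u + s *\<^sub>R v) (h *\<^sub>R u) - f' (x + r *\<^sub>R u) (h *\<^sub>R u))) (at r)"
      if "0 \<le> r" "r \<le> s" for r
    proof -
      have 1: "x + r *\<^sub>R u + s *\<^sub>R v \<in> S" and 2: "x + r *\<^sub>R u \<in> S"
        using inS[of r u v s] inS[of r u v 0] that s by auto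
      have "((\<lambda>r. x + r *\<^sub>R u + s *\<^sub>R v) has_derivative (\<lambda>h. h *\<^sub>R u)) (at r)"
        and "((\<lambda>r. x + r *\<^sub>R u) has_derivative (\<lambda>h. h *\<^sub>R u)) (at r)"
        by (auto intro!: derivative_eq_intros)
      from has_derivative_diff[OF has_derivative_compose[OF this(1) f[OF 1]] has_derivative_compose[OF this(2) f[OF 2]]]
      show ?thesis unfolding k_def .
    qed
    have "\<exists>r\<in>{0<..<s}. k s - k 0 = (\<lambda>h. f' (x + r *\<^sub>R u + s *\<^sub>R v) (h *\<^sub>R u) - f' (x + r *\<^sub>R u) (h *\<^sub>R u)) (s - 0)"
      by (rule mvt_simple[OF s(1)]) (use kd in \<open>auto intro: has_derivative_at_withinI\<close>)
    then obtain a where a: "0 < a" "a < s"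
      and ka: "k s - k 0 = f' (x + a *\<^sub>R u + s *\<^sub>R v) (s *\<^sub>R u) - f' (x + a *\<^sub>R u) (s *\<^sub>R u)"
      by auto
    have lin: "f' y (s *\<^sub>R u) = s * f' y u" if "y \<in> S" for y
      using linear_cmul[OF has_derivative_linear[OF f[OF that]]] by simp
    have aS: "x + a *\<^sub>R u + r *\<^sub>R v \<in> S" if "0 \<le> r" "r \<le> s" for r
      using inS[of a u v r] a s that by auto
    have ka': "k s - k 0 = s * (f' (x + a *\<^sub>R u + s *\<^sub>R v) u - f' (x + a *\<^sub>R u) u)"
      using ka lin[OF aS[of s]] lin[OF aS[of 0]] s by (simp add: algebra_simps)
    define l where "l r = f' (x + a *\<^sub>R u + r *\<^sub>R v) u" for r
    have ld: "(l has_derivative (\<lambda>h. f'' u (x + a *\<^sub>R u + r *\<^sub>R v) (h *\<^sub>R v))) (at r)"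
      if "0 \<le> r" "r \<le> s" for r
    proof -
      have "((\<lambda>r. x + a *\<^sub>R u + r *\<^sub>R v) has_derivative (\<lambda>h. h *\<^sub>R v)) (at r)"
        by (auto intro!: derivative_eq_intros)
      from has_derivative_compose[OF this f2[OF aS[OF that]]] show ?thesis unfolding l_def .
    qed
    have "\<exists>r\<in>{0<..<s}. l s - l 0 = (\<lambda>h. f'' u (x + a *\<^sub>R u + r *\<^sub>R v) (h *\<^sub>R v)) (s - 0)"
      by (rule mvt_simple[OF s(1)]) (use ld in \<open>auto intro: has_derivative_at_withinI\<close>)
    then obtain b where b: "0 < b" "b < s" and lb: "l s - l 0 = f'' u (x + a *\<^sub>R u + b *\<^sub>R v) (s *\<^sub>R v)"
      by auto
    have "f'' u (x + a *\<^sub>R u + b *\<^sub>R v) (s *\<^sub>R v) = s * f'' u (x + a *\<^sub>R u + b *\<^sub>R v) v"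
      using linear_cmul[OF has_derivative_linear[OF f2[OF aS[of b]]]] b by simp
    moreover have "\<Delta> u v s = k s - k 0" by (simp add: \<Delta>_def k_def)
    ultimately have "\<Delta> u v s = s * s * f'' u (x + a *\<^sub>R u + b *\<^sub>R v) v"
      using ka' lb by (simp add: l_def)
    then show ?thesis using a b by blast
  qed
  have lim: "((\<lambda>s. \<Delta> u v s / (s * s)) \<longlongrightarrow> f'' u x v) (at_right 0)" for u v
  proof (rule tendstoI)
    fix \<epsilon> :: real assume "\<epsilon> > 0"
    have "isCont (\<lambda>y. f'' u y v) x" using cont S by (simp add: continuous_on_eq_continuous_at)
    then obtain \<delta> where \<delta>: "\<delta> > 0" "\<And>y. dist y x < \<delta> \<Longrightarrow> dist (f'' u y v) (f'' u x v) < \<epsilon>"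
      using \<open>\<epsilon> > 0\<close> unfolding continuous_at_eps_delta by (auto simp: dist_norm)
    define t where "t = min (d u v) (\<delta> / (norm u + norm v + 1))"
    have np: "0 < norm u + norm v + 1" by (intro add_nonneg_pos) auto
    have tpos: "t > 0" unfolding t_def using dpos \<delta> np by auto
    show "\<forall>\<^sub>F s in at_right 0. dist (\<Delta> u v s / (s * s)) (f'' u x v) < \<epsilon>"
      unfolding eventually_at_right_field
    proof (intro exI[of _ t] conjI tpos allI impI)
      fix s :: real assume s: "0 < s" "s < t"
      then obtain a b where ab: "0 < a" "a < s" "0 < b" "b < s" "\<Delta> u v s = s * s * f'' u (x + a *\<^sub>R u + b *\<^sub>R v) v"
        using mvt[of s u v] by (auto simp: t_def)
      have "norm (a *\<^sub>R u + b *\<^sub>R v) \<le> a * norm u + b * norm v"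
        using norm_triangle_ineq[of "a *\<^sub>R u" "b *\<^sub>R v"] ab by simp
      also have "\<dots> \<le> s * norm u + s * norm v"
        using ab by (intro add_mono mult_right_mono) auto
      also have "\<dots> < s * (norm u + norm v + 1)" using s by (simp add: algebra_simps)
      also have "\<dots> \<le> \<delta>" using s np by (simp add: t_def pos_less_divide_eq less_imp_le)
      finally have "dist (x + a *\<^sub>R u + b *\<^sub>R v) x < \<delta>" by (simp add: dist_norm add.assoc)
      then show "dist (\<Delta> u v s / (s * s)) (f'' u x v) < \<epsilon>" using ab s \<delta> by simp
    qed
  qed
  have "\<Delta> u v = \<Delta> v u" by (auto simp: \<Delta>_def algebra_simps)
  then show ?thesis using lim[of u v] lim[of v u] tendsto_unique[of "at_right (0::real)"] by auto
qed

lemma second_derivative_symmetric: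
  fixes f :: "'a::real_normed_vector \<Rightarrow> 'b::euclidean_space"
  assumes S: "open S" "x \<in> S"
    and f: "\<And>y. y \<in> S \<Longrightarrow> (f has_derivative f' y) (at y)"
    and f2: "\<And>y v. y \<in> S \<Longrightarrow> ((\<lambda>z. f' z v) has_derivative f'' v y) (at y)"
    and cont: "\<And>u v. continuous_on S (\<lambda>y. f'' u y v)"
  shows "f'' u x v = f'' v x u"
proof (rule euclidean_eqI)
  fix b :: 'b assume "b \<in> Basis"
  show "f'' u x v \<bullet> b = f'' v x u \<bullet> b"
    by (rule second_derivative_symmetric_real[OF S, where f = "\<lambda>x. f x \<bullet> b" and f' = "\<lambda>x v. f' x v \<bullet> b"
          and f'' = "\<lambda>u x v. f'' u x v \<bullet> b"])
      (auto intro!: has_derivative_inner_left f f2 continuous_intros cont)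
qed

lemma smooth_on_derivative: "smooth_on S f \<Longrightarrow> smooth_on S (\<lambda>x. frechet_derivative f (at x) v)"
  unfolding smooth_on_def by (metis Ck_on.simps(2))

lemma smooth_on_Ck1: "smooth_on S f \<Longrightarrow> Ck_on 1 S f"
  unfolding smooth_on_def by blast

section \<open>Charts and the divergence in coordinates\<close>

lemma bilinear_linear1: "bilinear b \<Longrightarrow> linear (\<lambda>u. b u v)"
  by (simp add: bilinear_def)

lemma bilinear_linear2: "bilinear b \<Longrightarrow> linear (b u)"
  by (simp add: bilinear_def)

lemma has_derivative_bilinear_family:
  fixes G :: "'a::real_normed_vector \<Rightarrow> 'b::euclidean_space \<Rightarrow> 'c::euclidean_space \<Rightarrow> 'd::real_normed_vector"
  assumes S: "open S" "z \<in> S" and bil: "\<And>y. y \<in> S \<Longrightarrow> bilinear (G y)"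
    and G: "\<And>u v. ((\<lambda>y. G y u v) has_derivative D u v) (at z)"
    and r: "(r has_derivative r') (at z)" and s: "(s has_derivative s') (at z)"
  shows "((\<lambda>y. G y (r y) (s y)) has_derivative
           (\<lambda>h. D (r z) (s z) h + G z (r' h) (s z) + G z (r z) (s' h))) (at z)"
proof -
  have "((\<lambda>y. G y (r y) v) has_derivative (\<lambda>h. D (r z) v h + G z (r' h) v)) (at z)" for v
    by (rule has_derivative_linear_family[where T = "\<lambda>y u. G y u v" and D = "\<lambda>u. D u v", OF S _ G r])
      (rule bilinear_linear1[OF bil])
  from has_derivative_linear_family[where T = "\<lambda>y v. G y (r y) v", OF S _ this s]
  show ?thesis using bilinear_linear2[OF bil] by blast
qed

text \<open>
  Half the Lie derivative of the metric \<open>G\<close> along \<open>w\<close>, evaluated at \<open>(e, e)\<close>.  It equals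
  \<open>g(\<nabla>\<^sub>e w, e)\<close>, the only part of the covariant derivative that enters a divergence, and its
  transformation law involves no Christoffel symbols.
\<close>

definition lie_form :: "('e \<Rightarrow> 'e \<Rightarrow> 'e \<Rightarrow> real) \<Rightarrow> ('e::euclidean_space \<Rightarrow> 'e) \<Rightarrow> 'e \<Rightarrow> 'e \<Rightarrow> real" where
  "lie_form G w y e = G y (frechet_derivative w (at y) e) e + frechet_derivative (\<lambda>z. G z e e) (at y) (w y) / 2"

text \<open>Differentiating \<open>w \<circ> \<tau>\<close> and differentiating the pulled-back
  metric each produce one second derivative of \<open>\<tau>\<close>, with the arguments
  \<open>u\<close> and \<open>w' z\<close> in opposite roles. Symmetry of second derivatives makes
  the two contributions agree.\<close>

lemma lie_form_change:
  fixes G G' :: "'e::euclidean_space \<Rightarrow> 'e \<Rightarrow> 'e \<Rightarrow> real" and \<tau> w w' :: "'e \<Rightarrow> 'e"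
  assumes S: "open S" "z \<in> S" and U: "open U" "\<tau> ` S \<subseteq> U"
    and \<tau>: "smooth_on S \<tau>"
    and bil: "\<And>y. y \<in> U \<Longrightarrow> bilinear (G y)" and sym: "\<And>y u v. y \<in> U \<Longrightarrow> G y u v = G y v u"
    and dG: "\<And>u v. (\<lambda>y. G y u v) differentiable (at (\<tau> z))"
    and dw: "w differentiable (at (\<tau> z))" and dw': "w' differentiable (at z)"
    and GG: "\<And>x u v. x \<in> S \<Longrightarrow> G' x u v = G (\<tau> x) (frechet_derivative \<tau> (at x) u) (frechet_derivative \<tau> (at x) v)"
    and ww: "\<And>x. x \<in> S \<Longrightarrow> w (\<tau> x) = frechet_derivative \<tau> (at x) (w' x)"
  shows "lie_form G' w' z u = lie_form G w (\<tau> z) (frechet_derivative \<tau> (at z) u)"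
proof -
  define T where "T x = frechet_derivative \<tau> (at x)" for x
  define D2 where "D2 v x = frechet_derivative (\<lambda>x. T x v) (at x)" for v x
  have T: "(\<tau> has_derivative T x) (at x)" if "x \<in> S" for x
    unfolding T_def using Ck1_has_derivative[OF smooth_on_Ck1[OF \<tau>] that] .
  have TC: "Ck_on 1 S (\<lambda>x. T x v)" for v
    unfolding T_def by (intro smooth_on_Ck1 smooth_on_derivative \<tau>)
  have D2: "((\<lambda>x. T x v) has_derivative D2 v x) (at x)" if "x \<in> S" for x v
    unfolding D2_def using Ck1_has_derivative[OF TC that] .
  have sym2: "D2 a z b = D2 b z a" for a b
    by (rule second_derivative_symmetric[OF S T D2]) (auto simp: D2_def intro: Ck1_continuous_derivative[OF TC])
  have linT: "linear (T x)" if "x \<in> S" for x using T[OF that] by (rule has_derivative_linear)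
  define w1 where "w1 = frechet_derivative w' (at z)"
  have w1: "(w' has_derivative w1) (at z)" using dw' frechet_derivative_works by (auto simp: w1_def)
  define wd where "wd = frechet_derivative w (at (\<tau> z))"
  have wd: "(w has_derivative wd) (at (\<tau> z))" using dw frechet_derivative_works by (auto simp: wd_def)
  have "((\<lambda>x. T x (w' x)) has_derivative (\<lambda>h. D2 (w' z) z h + T z (w1 h))) (at z)"
    by (rule has_derivative_linear_family[OF S linT D2[OF S(2)] w1])
  then have "((\<lambda>x. w (\<tau> x)) has_derivative (\<lambda>h. D2 (w' z) z h + T z (w1 h))) (at z)"
    by (rule has_derivative_transform_within_open[OF _ S]) (simp add: ww T_def)
  moreover have "((\<lambda>x. w (\<tau> x)) has_derivative (\<lambda>h. wd (T z h))) (at z)"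
    using has_derivative_compose[OF T[OF S(2)] wd] .
  ultimately have wT: "wd (T z h) = D2 (w' z) z h + T z (w1 h)" for h
    using has_derivative_unique by metis
  define DG where "DG a b = frechet_derivative (\<lambda>y. G y a b) (at (\<tau> z))" for a b
  have DG: "((\<lambda>y. G y a b) has_derivative DG a b) (at (\<tau> z))" for a b
    using dG frechet_derivative_works by (auto simp: DG_def)
  have "((\<lambda>x. G (\<tau> x) (T x u) (T x u)) has_derivative
      (\<lambda>h. DG (T z u) (T z u) (T z h) + G (\<tau> z) (D2 u z h) (T z u) + G (\<tau> z) (T z u) (D2 u z h))) (at z)"
    by (rule has_derivative_bilinear_family[where G = "\<lambda>x. G (\<tau> x)" and D = "\<lambda>a b h. DG a b (T z h)",
          OF S _ has_derivative_compose[OF T[OF S(2)] DG] D2[OF S(2)] D2[OF S(2)]])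
      (use U bil in blast)
  then have "((\<lambda>x. G' x u u) has_derivative
      (\<lambda>h. DG (T z u) (T z u) (T z h) + G (\<tau> z) (D2 u z h) (T z u) + G (\<tau> z) (T z u) (D2 u z h))) (at z)"
    by (rule has_derivative_transform_within_open[OF _ S]) (simp add: GG T_def)
  from frechet_derivative_at[OF this, symmetric]
  have dG': "frechet_derivative (\<lambda>x. G' x u u) (at z) h =
      DG (T z u) (T z u) (T z h) + G (\<tau> z) (D2 u z h) (T z u) + G (\<tau> z) (T z u) (D2 u z h)" for h by simp
  have zU: "\<tau> z \<in> U" using U S by blast
  have "lie_form G' w' z u = G (\<tau> z) (T z (w1 u)) (T z u)
     + (DG (T z u) (T z u) (T z (w' z)) + 2 * G (\<tau> z) (D2 u z (w' z)) (T z u)) / 2"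
    unfolding lie_form_def dG' w1_def[symmetric] using GG[OF S(2)] sym[OF zU, of "T z u"] by (simp add: T_def)
  also have "\<dots> = G (\<tau> z) (D2 (w' z) z u + T z (w1 u)) (T z u) + DG (T z u) (T z u) (T z (w' z)) / 2"
    using sym2[of u "w' z"] bilinear_ladd[OF bil[OF zU]] by simp
  also have "\<dots> = lie_form G w (\<tau> z) (T z u)"
    unfolding lie_form_def wd_def[symmetric] DG_def[symmetric] wT ww[OF S(2)] T_def[symmetric] ..
  finally show ?thesis by (simp add: T_def)
qed

text \<open>This justifies the \<open>THE\<close> in \<open>cov_deriv\<close>.\<close>

lemma pos_def_riesz:
  fixes b :: "'e::euclidean_space \<Rightarrow> 'e \<Rightarrow> real"
  assumes b: "bilinear b" and pos: "\<And>u. u \<noteq> 0 \<Longrightarrow> 0 < b u u" and l: "linear l"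
  shows "\<exists>!z. \<forall>w. b z w = l w"
proof -
  define F where "F z = (\<Sum>i\<in>Basis. b z i *\<^sub>R i)" for z
  have repr: "b z w = F z \<bullet> w" for z w
  proof -
    have "b z w = b z (\<Sum>i\<in>Basis. (w \<bullet> i) *\<^sub>R i)" by (simp add: euclidean_representation)
    also have "\<dots> = (\<Sum>i\<in>Basis. (w \<bullet> i) * b z i)"
      by (simp add: linear_sum[OF bilinear_linear2[OF b]] linear_cmul[OF bilinear_linear2[OF b]])
    also have "\<dots> = F z \<bullet> w" by (simp add: F_def inner_sum_left inner_commute[of w] mult.commute)
    finally show ?thesis .
  qed
  have "linear F" unfolding F_def
    by (rule linearI) (simp_all add: bilinear_ladd[OF b] bilinear_lmul[OF b] scaleR_add_left sum.distrib scaleR_sum_right)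
  moreover have "inj F"
    unfolding linear_injective_0[OF \<open>linear F\<close>] using pos repr by (metis inner_zero_left less_irrefl)
  ultimately have "surj F" using linear_injective_imp_surjective by blast
  define v where "v = (\<Sum>i\<in>Basis. l i *\<^sub>R i)"
  have lv: "l w = v \<bullet> w" for w
  proof -
    have "l w = l (\<Sum>i\<in>Basis. (w \<bullet> i) *\<^sub>R i)" by (simp add: euclidean_representation)
    also have "\<dots> = (\<Sum>i\<in>Basis. (w \<bullet> i) * l i)"
      by (simp add: linear_sum[OF l] linear_cmul[OF l])
    also have "\<dots> = v \<bullet> w" by (simp add: v_def inner_sum_left inner_commute[of w] mult.commute)
    finally show ?thesis .
  qed
  obtain z where z: "F z = v" using \<open>surj F\<close> by (metis surjD)
  show ?thesis
  proof (rule ex1I[of _ z])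
    show "\<forall>w. b z w = l w" by (simp add: repr lv z)
    show "z' = z" if "\<forall>w. b z' w = l w" for z'
    proof -
      have "F z' = v" using that by (intro vector_eq_ldot[THEN iffD1]) (metis inner_commute lv repr)
      then show ?thesis using \<open>inj F\<close> z by (metis injD)
    qed
  qed
qed

section \<open>Manifolds and metrics under change of chart\<close>

locale smooth_manifold =
  fixes A :: "('a::t2_space, 'e::euclidean_space) chart set"
  assumes atlas: "smooth_atlas A"
begin

lemma open_chart: "c \<in> A \<Longrightarrow> open (fst c)" "c \<in> A \<Longrightarrow> open (chart_image c)"
  using atlas by (auto simp: smooth_atlas_def)

lemma chart_homeomorphism: "c \<in> A \<Longrightarrow> homeomorphism (fst c) (chart_image c) (snd c) (chart_inv c)"
  using atlas by (auto simp: smooth_atlas_def)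

lemma chart_inv_chart: "c \<in> A \<Longrightarrow> p \<in> fst c \<Longrightarrow> chart_inv c (snd c p) = p"
  using chart_homeomorphism by (auto simp: homeomorphism_def)

lemma chart_chart_inv: "y \<in> chart_image c \<Longrightarrow> snd c (chart_inv c y) = y"
  by (rule f_inv_into_f)

lemma chart_inv_in: "y \<in> chart_image c \<Longrightarrow> chart_inv c y \<in> fst c"
  by (rule inv_into_into)

lemma continuous_chart: "c \<in> A \<Longrightarrow> continuous_on (fst c) (snd c)"
  and continuous_chart_inv: "c \<in> A \<Longrightarrow> continuous_on (chart_image c) (chart_inv c)"
  using chart_homeomorphism by (auto simp: homeomorphism_def)

lemma chart_image_vimage:
  assumes "c \<in> A" shows "snd c ` (fst c \<inter> U) = chart_image c \<inter> chart_inv c -` U"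
  using assms by (force simp: chart_inv_chart)

lemma open_chart_image:
  assumes "c \<in> A" "open U" shows "open (snd c ` (fst c \<inter> U))"
  unfolding chart_image_vimage[OF assms(1)]
  using continuous_open_preimage[OF continuous_chart_inv[OF assms(1)] open_chart(2)[OF assms(1)] assms(2)] .

lemma open_chart_vimage:
  assumes "c \<in> A" "open U" shows "open (fst c \<inter> snd c -` U)"
  using continuous_open_preimage[OF continuous_chart[OF assms(1)] open_chart(1)[OF assms(1)] assms(2)] .

lemma transition_smooth:
  "c \<in> A \<Longrightarrow> d \<in> A \<Longrightarrow> smooth_on (snd c ` (fst c \<inter> fst d)) (snd d \<circ> chart_inv c)"
  using atlas by (auto simp: smooth_atlas_def)

lemma transition_has_derivative:
  assumes "c \<in> A" "d \<in> A" "p \<in> fst c" "p \<in> fst d"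
  shows "((snd d \<circ> chart_inv c) has_derivative coord_change c d p) (at (snd c p))"
  unfolding coord_change_def
  by (rule Ck1_has_derivative[OF smooth_on_Ck1[OF transition_smooth]]) (use assms in auto)

lemma coord_change_linear:
  "c \<in> A \<Longrightarrow> d \<in> A \<Longrightarrow> p \<in> fst c \<Longrightarrow> p \<in> fst d \<Longrightarrow> linear (coord_change c d p)"
  using transition_has_derivative has_derivative_linear by blast

lemma coord_change_refl:
  assumes "c \<in> A" "p \<in> fst c"
  shows "coord_change c c p v = v"
proof -
  have "((\<lambda>x. x) has_derivative (\<lambda>v. v)) (at (snd c p))" by (rule has_derivative_ident)
  then have "((snd c \<circ> chart_inv c) has_derivative (\<lambda>v. v)) (at (snd c p))"
    by (rule has_derivative_transform_within_open[OF _ open_chart(2)[OF assms(1)]])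
      (use assms in \<open>auto simp: chart_inv_chart\<close>)
  then show ?thesis
    using has_derivative_unique transition_has_derivative[OF assms(1,1,2,2)] by metis
qed

lemma coord_change_trans:
  assumes "c \<in> A" "d \<in> A" "e \<in> A" "p \<in> fst c" "p \<in> fst d" "p \<in> fst e"
  shows "coord_change d e p (coord_change c d p v) = coord_change c e p v"
proof -
  have y: "(snd d \<circ> chart_inv c) (snd c p) = snd d p" using assms by (simp add: chart_inv_chart)
  have "((\<lambda>y. (snd e \<circ> chart_inv d) ((snd d \<circ> chart_inv c) y)) has_derivative
      (\<lambda>v. coord_change d e p (coord_change c d p v))) (at (snd c p))"
    using has_derivative_compose[OF transition_has_derivative[OF assms(1,2,4,5)],
        of "snd e \<circ> chart_inv d", unfolded y, OF transition_has_derivative[OF assms(2,3,5,6)]] .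
  then have "((snd e \<circ> chart_inv c) has_derivative (\<lambda>v. coord_change d e p (coord_change c d p v))) (at (snd c p))"
    by (rule has_derivative_transform_within_open[OF _ open_chart_image[OF assms(1) open_chart(1)[OF assms(2)]]])
      (use assms in \<open>auto simp: chart_inv_chart\<close>)
  then show ?thesis
    using has_derivative_unique transition_has_derivative[OF assms(1,3,4,6)] by metis
qed

lemma chart_at_in: "chart_at A p \<in> A" "p \<in> fst (chart_at A p)"
proof -
  have "\<exists>c. c \<in> A \<and> p \<in> fst c" using atlas by (force simp: smooth_atlas_def)
  from someI_ex[OF this] show "chart_at A p \<in> A" "p \<in> fst (chart_at A p)" by (auto simp: chart_at_def)
qed

context
  fixes c p assumes c: "c \<in> A" and p: "p \<in> fst c"
begin

lemma chart_deriv_linear: "linear (chart_deriv A c p)"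
  unfolding chart_deriv_def using c p by (intro coord_change_linear chart_at_in)

lemma chart_inv_deriv_linear: "linear (chart_inv_deriv A c p)"
  unfolding chart_inv_deriv_def using c p by (intro coord_change_linear chart_at_in)

lemma chart_deriv_inverse [simp]:
  "chart_deriv A c p (chart_inv_deriv A c p v) = v"
  "chart_inv_deriv A c p (chart_deriv A c p v) = v"
  unfolding chart_deriv_def chart_inv_deriv_def using c p chart_at_in
  by (simp_all add: coord_change_trans coord_change_refl)

lemma coord_change_chart_deriv:
  "d \<in> A \<Longrightarrow> p \<in> fst d \<Longrightarrow> coord_change c d p (chart_deriv A c p v) = chart_deriv A d p v"
  unfolding chart_deriv_def using c p chart_at_in by (simp add: coord_change_trans)

lemma chart_inv_deriv_coord_change:
  "d \<in> A \<Longrightarrow> p \<in> fst d \<Longrightarrow> chart_inv_deriv A d p (coord_change c d p v) = chart_inv_deriv A c p v"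
  unfolding chart_inv_deriv_def using c p chart_at_in by (simp add: coord_change_trans)

lemma field_rep_change:
  "d \<in> A \<Longrightarrow> p \<in> fst d \<Longrightarrow> field_rep A d X p = coord_change c d p (field_rep A c X p)"
  by (simp add: field_rep_def coord_change_chart_deriv)

lemma metric_rep_chart:
  "metric_rep A g c (snd c p) u v = g p (chart_inv_deriv A c p u) (chart_inv_deriv A c p v)"
  using c p by (simp add: metric_rep_def chart_inv_chart)

lemma metric_rep_change:
  "d \<in> A \<Longrightarrow> p \<in> fst d \<Longrightarrow> metric_rep A g c (snd c p) u v
     = metric_rep A g d (snd d p) (coord_change c d p u) (coord_change c d p v)"
  by (simp add: metric_rep_def chart_inv_chart c p chart_inv_deriv_coord_change)

end

end

locale riemannian = smooth_manifold A
  for A :: "('a::t2_space, 'e::euclidean_space) chart set" +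
  fixes g :: "'a \<Rightarrow> 'e \<Rightarrow> 'e \<Rightarrow> real"
  assumes metric: "riemannian_metric A g"
begin

lemma g_bilinear: "bilinear (g p)" and g_sym: "g p u v = g p v u" and g_pos: "u \<noteq> 0 \<Longrightarrow> 0 < g p u u"
  using metric unfolding riemannian_metric_def by blast+

lemma metric_rep_smooth: "c \<in> A \<Longrightarrow> smooth_on (chart_image c) (\<lambda>y. metric_rep A g c y u v)"
  using metric unfolding riemannian_metric_def by blast

lemma metric_rep_Ck1: "c \<in> A \<Longrightarrow> Ck_on 1 (chart_image c) (\<lambda>y. metric_rep A g c y u v)"
  by (intro smooth_on_Ck1 metric_rep_smooth)

lemma g_metric_rep:
  "c \<in> A \<Longrightarrow> p \<in> fst c \<Longrightarrow> g p u v = metric_rep A g c (snd c p) (chart_deriv A c p u) (chart_deriv A c p v)"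
  by (simp add: metric_rep_chart)

lemma metric_rep_bilinear:
  assumes "c \<in> A" "y \<in> chart_image c" shows "bilinear (metric_rep A g c y)"
proof -
  obtain p where p: "p \<in> fst c" "y = snd c p" using assms by auto
  note lin = chart_inv_deriv_linear[OF assms(1) p(1)]
  show ?thesis
    unfolding bilinear_def p(2) metric_rep_chart[OF assms(1) p(1)]
    using linear_compose[OF lin bilinear_linear1[OF g_bilinear]]
      linear_compose[OF lin bilinear_linear2[OF g_bilinear]] by (auto simp: o_def)
qed

lemma metric_rep_sym: "metric_rep A g c y u v = metric_rep A g c y v u"
  by (simp add: metric_rep_def Let_def g_sym)

lemma metric_rep_pos:
  assumes "c \<in> A" "y \<in> chart_image c" "u \<noteq> 0" shows "0 < metric_rep A g c y u u"
proof -
  obtain p where p: "p \<in> fst c" "y = snd c p" using assms by auto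
  have "chart_inv_deriv A c p u \<noteq> 0"
    using assms(1,3) p(1) by (metis chart_deriv_inverse(1) chart_deriv_linear linear_0)
  then show ?thesis unfolding p(2) metric_rep_chart[OF assms(1) p(1)] by (rule g_pos)
qed

text \<open>\<open>christoffel\<close> with equal outer arguments reduces to one derivative of the metric: the other two terms cancel.\<close>

lemma cov_deriv_self:
  fixes p u X
  defines "c \<equiv> chart_at A p"
  shows "g p (cov_deriv A g X p u) u = lie_form (metric_rep A g c) (field_rep A c X \<circ> chart_inv c) (snd c p) u"
proof -
  have c: "c \<in> A" "p \<in> fst c" by (simp_all add: c_def chart_at_in)
  define y where "y = snd c p"
  have y: "y \<in> chart_image c" using c by (simp add: y_def)
  note S = open_chart(2)[OF c(1)] y
  have d: "(\<lambda>z. metric_rep A g c z u v) differentiable at y" for u v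
    using metric_rep_Ck1[OF c(1)] y by (auto simp: Ck1_iff)
  \<comment> \<open>The tangent space at \<open>p\<close> is by definition read in the selected
    chart, so there both differentials are the identity.\<close>
  have cid: "chart_deriv A c p v = v" "chart_inv_deriv A c p v = v" for v
    using coord_change_refl[OF c] by (simp_all add: chart_deriv_def chart_inv_deriv_def c_def[symmetric])
  define Du where "Du = frechet_derivative (field_rep A c X \<circ> chart_inv c) (at y) u"
  have l1: "linear (\<lambda>w. frechet_derivative (\<lambda>z. metric_rep A g c z a w) (at y) h)" for a h
    by (rule Ck1_family_derivative_linear[OF S]) (auto intro!: bilinear_linear2 metric_rep_bilinear[OF c(1)] d)
  have l2: "linear (\<lambda>w. frechet_derivative (\<lambda>z. metric_rep A g c z a b) (at y) w)" for a b
    using d frechet_derivative_works has_derivative_linear by blast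
  have "linear (\<lambda>w. christoffel A g c y u (X p) w)"
  proof -
    have eq: "(\<lambda>w. christoffel A g c y u (X p) w) = (\<lambda>w. (1/2) *\<^sub>R
       (frechet_derivative (\<lambda>z. metric_rep A g c z (X p) w) (at y) u
        + frechet_derivative (\<lambda>z. metric_rep A g c z u w) (at y) (X p)
        - frechet_derivative (\<lambda>z. metric_rep A g c z u (X p)) (at y) w))"
      by (simp add: christoffel_def fun_eq_iff)
    show ?thesis unfolding eq
      by (intro linear_compose_scale_right linear_compose_sub linear_compose_add l1 l2)
  qed
  then have "linear (\<lambda>w. g p Du w + christoffel A g c y u (X p) w)"
    by (intro linear_compose_add bilinear_linear2[OF g_bilinear])
  from theI'[OF pos_def_riesz[OF g_bilinear[of p] g_pos this]]
  have "g p (cov_deriv A g X p u) u = g p Du u + christoffel A g c y u (X p) u"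
    unfolding cov_deriv_def Let_def c_def[symmetric] y_def[symmetric] Du_def[symmetric] by blast
  also have "christoffel A g c y u (X p) u = frechet_derivative (\<lambda>z. metric_rep A g c z u u) (at y) (X p) / 2"
    by (simp add: christoffel_def metric_rep_sym[of c _ "X p" u])
  also have "X p = (field_rep A c X \<circ> chart_inv c) y"
    using c by (simp add: y_def field_rep_def chart_inv_chart cid)
  also have "g p Du u = metric_rep A g c y Du u"
    by (simp add: g_metric_rep[OF c] cid y_def)
  finally show ?thesis by (simp add: lie_form_def Du_def y_def)
qed

text \<open>\<open>cov_deriv\<close> is computed in the chart selected at \<open>p\<close>, which
  may vary erratically with \<open>p\<close>. The transformation law of \<open>lie_form\<close>
  moves the diagonal values, all that a divergence uses, into one fixed chart.\<close>

lemma cov_deriv_chart: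
  assumes X: "C1_field A X" and c: "c \<in> A" "p \<in> fst c"
  shows "g p (cov_deriv A g X p u) u =
    lie_form (metric_rep A g c) (field_rep A c X \<circ> chart_inv c) (snd c p) (chart_deriv A c p u)"
proof -
  define b where "b = chart_at A p"
  have b: "b \<in> A" "p \<in> fst b" by (simp_all add: b_def chart_at_in)
  define \<tau> where "\<tau> = snd c \<circ> chart_inv b"
  define S where "S = snd b ` (fst b \<inter> fst c)"
  have \<tau>p: "\<tau> (snd b p) = snd c p" using b by (simp add: \<tau>_def chart_inv_chart)
  have cc: "frechet_derivative \<tau> (at (snd b q)) = coord_change b c q" for q
    by (simp add: coord_change_def \<tau>_def)
  have df: "(field_rep A d X \<circ> chart_inv d) differentiable at (snd d p)" if "d \<in> A" "p \<in> fst d" for d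
    using X that by (auto simp: C1_field_def Ck1_iff)
  have "lie_form (metric_rep A g b) (field_rep A b X \<circ> chart_inv b) (snd b p) u
      = lie_form (metric_rep A g c) (field_rep A c X \<circ> chart_inv c) (\<tau> (snd b p)) (frechet_derivative \<tau> (at (snd b p)) u)"
  proof (rule lie_form_change[where S = S and U = "chart_image c"])
    show "open S" unfolding S_def by (intro open_chart_image open_chart b c)
    show "snd b p \<in> S" using b c by (auto simp: S_def)
    show "open (chart_image c)" by (intro open_chart c)
    show "\<tau> ` S \<subseteq> chart_image c" using b by (auto simp: S_def \<tau>_def chart_inv_chart)
    show "smooth_on S \<tau>" unfolding S_def \<tau>_def by (intro transition_smooth b c)
    show "bilinear (metric_rep A g c y)" if "y \<in> chart_image c" for y
      using that by (rule metric_rep_bilinear[OF c(1)])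
    show "metric_rep A g c y u v = metric_rep A g c y v u" for y u v by (rule metric_rep_sym)
    show "(\<lambda>y. metric_rep A g c y u v) differentiable at (\<tau> (snd b p))" for u v
      using metric_rep_Ck1[OF c(1)] c by (auto simp: Ck1_iff \<tau>p)
    show "(field_rep A c X \<circ> chart_inv c) differentiable at (\<tau> (snd b p))"
      unfolding \<tau>p by (rule df[OF c])
    show "(field_rep A b X \<circ> chart_inv b) differentiable at (snd b p)" by (rule df[OF b])
    fix x assume "x \<in> S"
    then obtain q where q: "q \<in> fst b" "q \<in> fst c" "x = snd b q" by (auto simp: S_def)
    have \<tau>q: "\<tau> x = snd c q" using b q by (simp add: \<tau>_def chart_inv_chart)
    show "metric_rep A g b x u v = metric_rep A g c (\<tau> x) (frechet_derivative \<tau> (at x) u) (frechet_derivative \<tau> (at x) v)" for u v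
      unfolding \<tau>q unfolding q(3) cc by (rule metric_rep_change) (use b c q in auto)
    show "(field_rep A c X \<circ> chart_inv c) (\<tau> x) = frechet_derivative \<tau> (at x) ((field_rep A b X \<circ> chart_inv b) x)"
      unfolding \<tau>q unfolding q(3) cc using field_rep_change[OF b(1) q(1) c(1) q(2)] b c q
      by (simp add: chart_inv_chart)
  qed
  then show ?thesis
    unfolding \<tau>p unfolding cc cov_deriv_self b_def[symmetric]
    using coord_change_chart_deriv[OF b c, of u] coord_change_refl[OF b, of u]
    by (simp add: chart_deriv_def b_def)
qed

end

section \<open>Vector fields given in a chart\<close>

context smooth_manifold begin

definition chart_field :: "('a, 'e) chart \<Rightarrow> ('e \<Rightarrow> 'e) \<Rightarrow> 'a \<Rightarrow> 'e" where
  "chart_field c w p = (if p \<in> fst c then chart_inv_deriv A c p (w (snd c p)) else 0)"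

lemma compact_chart_inv:
  assumes "c \<in> A" "compact K" "K \<subseteq> chart_image c"
  shows "compact (chart_inv c ` K)"
  using compact_continuous_image[OF continuous_on_subset[OF continuous_chart_inv[OF assms(1)] assms(3)] assms(2)] .

lemma field_rep_linear0:
  "d \<in> A \<Longrightarrow> p \<in> fst d \<Longrightarrow> X p = 0 \<Longrightarrow> field_rep A d X p = 0"
  by (simp add: field_rep_def linear_0 chart_deriv_linear)

context
  fixes c and w :: "'e \<Rightarrow> 'e" and K
  assumes c: "c \<in> A" and w: "Ck_on 1 (chart_image c) w"
    and K: "compact K" "K \<subseteq> chart_image c" and w0: "\<forall>y\<in>chart_image c - K. w y = 0"
begin

lemma field_rep_chart_field: "p \<in> fst c \<Longrightarrow> field_rep A c (chart_field c w) p = w (snd c p)"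
  using c by (simp add: field_rep_def chart_field_def)

lemma chart_field_zero:
  assumes "p \<notin> chart_inv c ` K" shows "chart_field c w p = 0"
proof (cases "p \<in> fst c")
  case True
  then have "snd c p \<notin> K" using assms c by (metis chart_inv_chart image_eqI)
  then show ?thesis
    using True c w0 by (simp add: chart_field_def linear_0 chart_inv_deriv_linear)
qed (simp add: chart_field_def)

lemma field_support_chart_field: "field_support (chart_field c w) \<subseteq> chart_inv c ` K"
  unfolding field_support_def
  by (rule closure_minimal) (use chart_field_zero compact_imp_closed[OF compact_chart_inv[OF c K]] in auto)

text \<open>Inside the domain of \<open>c\<close> the representation in another chart arises by a
  smooth change of coordinates. At other points the field vanishes in a neighbourhood, because the
  compact image of \<open>K\<close> is closed in a Hausdorff space.\<close>

lemma C1_field_chart_field: "C1_field A (chart_field c w)"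
  unfolding C1_field_def
proof (intro ballI Ck1_local)
  fix d z assume d: "d \<in> A" and z: "z \<in> chart_image d"
  define p where "p = chart_inv d z"
  have p: "p \<in> fst d" "snd d p = z" using z by (auto simp: p_def chart_inv_in chart_chart_inv)
  show "\<exists>U. open U \<and> z \<in> U \<and> Ck_on 1 U (field_rep A d (chart_field c w) \<circ> chart_inv d)"
  proof (cases "p \<in> fst c")
    case True
    define U where "U = snd d ` (fst d \<inter> fst c)"
    define S where "S = snd c ` (fst c \<inter> fst d)"
    define T where "T y = frechet_derivative (snd d \<circ> chart_inv c) (at y)" for y
    have op: "open U" "open S" unfolding U_def S_def by (intro open_chart_image open_chart c d)+
    have zU: "z \<in> U" using True p by (auto simp: U_def)
    have sm: "smooth_on S (snd d \<circ> chart_inv c)" "smooth_on U (snd c \<circ> chart_inv d)"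
      unfolding U_def S_def by (intro transition_smooth c d)+
    have S1: "Ck_on 1 S (\<lambda>y. T y (w y))"
    proof (rule Ck1_linear_family[where T = T and r = w, OF op(2)])
      show "linear (T y)" if "y \<in> S" for y
        using Ck1_has_derivative[OF smooth_on_Ck1[OF sm(1)] that] unfolding T_def by (rule has_derivative_linear)
      show "Ck_on 1 S (\<lambda>y. T y v)" for v
        unfolding T_def by (intro smooth_on_Ck1 smooth_on_derivative sm)
      show "Ck_on 1 S w" by (rule Ck1_subset[OF w]) (auto simp: S_def)
    qed
    have C1: "Ck_on 1 U (\<lambda>x. T ((snd c \<circ> chart_inv d) x) (w ((snd c \<circ> chart_inv d) x)))"
      by (rule Ck1_compose[where h = "\<lambda>y. T y (w y)", OF smooth_on_Ck1[OF sm(2)] S1])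
        (use d in \<open>auto simp: U_def S_def chart_inv_chart\<close>)
    have eq: "T ((snd c \<circ> chart_inv d) x) (w ((snd c \<circ> chart_inv d) x))
        = (field_rep A d (chart_field c w) \<circ> chart_inv d) x" if x: "x \<in> U" for x
    proof -
      obtain q where q: "q \<in> fst d" "q \<in> fst c" "x = snd d q" using x by (auto simp: U_def)
      show ?thesis
        using q c d field_rep_change[OF c q(2) d q(1)]
        by (simp add: chart_inv_chart T_def coord_change_def field_rep_chart_field)
    qed
    have "Ck_on 1 U (field_rep A d (chart_field c w) \<circ> chart_inv d)"
      by (rule Ck1_cong[OF op(1) eq C1])
    then show ?thesis using op zU by blast
  next
    case False
    define U where "U = snd d ` (fst d \<inter> - (chart_inv c ` K))"
    have op: "open U" unfolding U_def
      by (intro open_chart_image d open_Compl compact_imp_closed compact_chart_inv c K)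
    have "p \<notin> chart_inv c ` K" using False K(2) chart_inv_in[of _ c] by blast
    then have zU: "z \<in> U" using p by (auto simp: U_def)
    have "Ck_on 1 U (field_rep A d (chart_field c w) \<circ> chart_inv d)"
      by (rule Ck1_cong[OF op _ Ck1_const[of U 0]])
        (use d in \<open>auto simp: U_def chart_inv_chart field_rep_linear0 chart_field_zero\<close>)
    then show ?thesis using op zU by blast
  qed
qed

lemma test_field_chart_field: "test_field A (chart_field c w)"
  unfolding test_field_def
  using C1_field_chart_field field_support_chart_field compact_chart_inv[OF c K]
  by (metis closed_closure closed_Int_compact field_support_def inf.absorb1)

end

end

section \<open>Orthonormal frames\<close>

text \<open>
  Gram-Schmidt with respect to \<open>b\<close>.  A dependent vector yields \<open>0\<close>, because \<open>inverse 0 = 0\<close>; so the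
  process is given by one formula, which is measurable in \<open>b\<close> and \<open>u\<close> without case distinctions.
\<close>

fun gs_frame :: "('e::euclidean_space \<Rightarrow> 'e \<Rightarrow> real) \<Rightarrow> (nat \<Rightarrow> 'e) \<Rightarrow> nat \<Rightarrow> 'e" where
  "gs_frame b u n = (let r = u n - (\<Sum>i<n. b (u n) (gs_frame b u i) *\<^sub>R gs_frame b u i)
                     in inverse (sqrt (b r r)) *\<^sub>R r)"

declare gs_frame.simps [simp del]

locale pos_def_form =
  fixes b :: "'e::euclidean_space \<Rightarrow> 'e \<Rightarrow> real"
  assumes bil: "bilinear b" and sym: "b u v = b v u" and pos: "u \<noteq> 0 \<Longrightarrow> 0 < b u u"
begin

lemmas b_simps = bilinear_ladd[OF bil] bilinear_radd[OF bil] bilinear_lmul[OF bil] bilinear_rmul[OF bil]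
  bilinear_lsub[OF bil] bilinear_rsub[OF bil] bilinear_lzero[OF bil] bilinear_rzero[OF bil]

lemma b_sum_left: "b (\<Sum>i\<in>I. f i) v = (\<Sum>i\<in>I. b (f i) v)"
  using linear_sum[OF bilinear_linear1[OF bil]] .

lemma b_nonneg: "0 \<le> b u u"
  using pos[of u] b_simps by (cases "u = 0") auto

lemma b_eq_0: "b u u = 0 \<longleftrightarrow> u = 0"
  using pos[of u] b_simps by (cases "u = 0") auto

definition residual :: "(nat \<Rightarrow> 'e) \<Rightarrow> nat \<Rightarrow> 'e" where
  "residual u n = u n - (\<Sum>i<n. b (u n) (gs_frame b u i) *\<^sub>R gs_frame b u i)"

lemma gs_frame_residual: "gs_frame b u n = inverse (sqrt (b (residual u n) (residual u n))) *\<^sub>R residual u n"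
  by (subst gs_frame.simps) (simp add: Let_def residual_def)

lemma gs_frame_eq_0: "gs_frame b u n = 0 \<longleftrightarrow> residual u n = 0"
  by (simp add: gs_frame_residual b_eq_0)

lemma gs_frame_unit: "gs_frame b u n \<noteq> 0 \<Longrightarrow> b (gs_frame b u n) (gs_frame b u n) = 1"
  using pos[of "residual u n"] gs_frame_eq_0[of u n]
  by (simp add: gs_frame_residual b_simps real_sqrt_mult_self flip: mult.assoc inverse_mult_distrib)

lemma gs_frame_orthogonal_less: "j < n \<Longrightarrow> b (gs_frame b u n) (gs_frame b u j) = 0"
proof (induction n arbitrary: j rule: less_induct)
  case (less n)
  note IH = less.IH and jn = less.prems
  have o: "b (gs_frame b u i) (gs_frame b u j) = 0" if i: "i < n" "i \<noteq> j" for i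
  proof (cases "i < j")
    case True
    then show ?thesis using IH[OF jn True] sym[of "gs_frame b u i"] by simp
  next
    case False
    then show ?thesis using IH[OF i(1), of j] i(2) by simp
  qed
  have "(\<Sum>i<n. b (u n) (gs_frame b u i) * b (gs_frame b u i) (gs_frame b u j))
      = (\<Sum>i<n. if i = j then b (u n) (gs_frame b u j) * b (gs_frame b u j) (gs_frame b u j) else 0)"
    by (intro sum.cong) (auto simp: o)
  then have "b (residual u n) (gs_frame b u j) = b (u n) (gs_frame b u j)
      - b (u n) (gs_frame b u j) * b (gs_frame b u j) (gs_frame b u j)"
    using jn by (simp add: residual_def b_simps b_sum_left)
  \<comment> \<open>Both kinds of frame vector are covered: a unit vector makes the two terms
    cancel, a zero vector makes both vanish.\<close>
  also have "\<dots> = 0"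
    using gs_frame_unit[of u j] by (cases "gs_frame b u j = 0") (auto simp: b_simps)
  finally show ?case by (subst gs_frame_residual) (simp add: b_simps)
qed

lemma gs_frame_orthogonal: "i \<noteq> j \<Longrightarrow> b (gs_frame b u i) (gs_frame b u j) = 0"
  using gs_frame_orthogonal_less[of i j] gs_frame_orthogonal_less[of j i] sym by (metis nat_neq_iff)

lemma gs_frame_span: "span (gs_frame b u ` {..<n}) = span (u ` {..<n})"
proof (induction n)
  case (Suc n)
  let ?E = "gs_frame b u ` {..<n}"
  define s where "s = (\<Sum>i<n. b (u n) (gs_frame b u i) *\<^sub>R gs_frame b u i)"
  have s: "s \<in> span ?E" unfolding s_def by (intro span_sum span_scale span_base) auto
  have r: "residual u n = u n - s" by (simp add: residual_def s_def)
  have 1: "gs_frame b u n \<in> span (insert (u n) ?E)"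
    unfolding gs_frame_residual[of u n] r using s
    by (intro span_scale span_diff span_base[of "u n"] insertI1 subsetD[OF span_mono[OF subset_insertI]])
  have "residual u n = sqrt (b (residual u n) (residual u n)) *\<^sub>R gs_frame b u n"
    using b_eq_0[of "residual u n"] by (cases "residual u n = 0") (auto simp: gs_frame_residual)
  then have eq: "u n = s + sqrt (b (residual u n) (residual u n)) *\<^sub>R gs_frame b u n"
    using r by (metis add.commute diff_add_cancel)
  have 2: "u n \<in> span (insert (gs_frame b u n) ?E)"
    unfolding eq using s by (intro span_add span_scale span_base[of "gs_frame b u n"] insertI1 subsetD[OF span_mono[OF subset_insertI]])
  have "span (insert (gs_frame b u n) ?E) = span (insert (u n) ?E)"
  proof (intro subset_antisym span_minimal subspace_span insert_subsetI 1 2)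
    show "?E \<subseteq> span (insert (u n) ?E)" "?E \<subseteq> span (insert (gs_frame b u n) ?E)"
      by (rule order_trans[OF subset_insertI span_superset])+
  qed
  also have "\<dots> = span (insert (u n) (u ` {..<n}))"
    unfolding span_insert[of _ ?E] span_insert[of _ "u ` {..<n}"] Suc.IH ..
  finally show ?case by (simp only: lessThan_Suc image_insert)
qed (simp only: lessThan_0 image_empty)

definition frame_set :: "(nat \<Rightarrow> 'e) \<Rightarrow> nat \<Rightarrow> 'e set" where
  "frame_set u n = gs_frame b u ` {..<n} - {0}"

lemma frame_set_orthonormal_basis: "orthonormal_basis_of b (span (u ` {..<n})) (frame_set u n)"
  unfolding orthonormal_basis_of_def
proof (intro conjI ballI)
  show "frame_set u n \<subseteq> span (u ` {..<n})"
    unfolding frame_set_def gs_frame_span[of u n, symmetric] by (rule order_trans[OF Diff_subset span_superset])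
  show "span (frame_set u n) = span (u ` {..<n})"
    unfolding frame_set_def gs_frame_span[of u n, symmetric] by (rule span_delete_0)
  fix x y assume "x \<in> frame_set u n" "y \<in> frame_set u n"
  then obtain i j where ij: "x = gs_frame b u i" "y = gs_frame b u j" "x \<noteq> 0"
    unfolding frame_set_def by blast
  show "b x y = (if x = y then 1 else 0)"
    using gs_frame_unit[of u i] gs_frame_orthogonal[of i j u] ij by (cases "i = j") auto
qed

text \<open>Distinct indices with equal nonzero frame vectors would contradict orthogonality. The
  right-hand side has a fixed range of summation, whereas the set of frame vectors changes with the
  form and the plane; measurability is proved for the former.\<close>

lemma frame_set_sum:
  assumes "q 0 = (0::real)"
  shows "(\<Sum>e\<in>frame_set u n. q e) = (\<Sum>i<n. q (gs_frame b u i))"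
proof -
  let ?I = "{i\<in>{..<n}. gs_frame b u i \<noteq> 0}"
  have "inj_on (gs_frame b u) ?I"
  proof (rule inj_onI, rule ccontr)
    fix i j assume "i \<in> ?I" "j \<in> ?I" "gs_frame b u i = gs_frame b u j" "i \<noteq> j"
    then show False using gs_frame_orthogonal[of i j u] gs_frame_unit[of u i] by simp
  qed
  moreover have "frame_set u n = gs_frame b u ` ?I" by (auto simp: frame_set_def)
  ultimately have "(\<Sum>e\<in>frame_set u n. q e) = (\<Sum>i\<in>?I. q (gs_frame b u i))"
    by (simp add: sum.reindex o_def)
  also have "\<dots> = (\<Sum>i<n. q (gs_frame b u i))"
    by (rule sum.mono_neutral_left) (auto simp: assms)
  finally show ?thesis .
qed

context
  fixes S B assumes B: "orthonormal_basis_of b S B"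
begin

lemma orthonormal_basis_unit: "u \<in> B \<Longrightarrow> v \<in> B \<Longrightarrow> b u v = (if u = v then 1 else 0)"
  using B by (auto simp: orthonormal_basis_of_def)

lemma orthonormal_basis_independent: "independent B"
  unfolding dependent_def
proof clarify
  fix v assume v: "v \<in> B" "v \<in> span (B - {v})"
  from v(2) have "b v v = 0"
    by (rule span_induct[where P = "\<lambda>x. b v x = 0"])
      (use v(1) in \<open>auto simp: subspace_def b_simps orthonormal_basis_unit\<close>)
  then show False using orthonormal_basis_unit[OF v(1) v(1)] by simp
qed

lemma orthonormal_basis_finite: "finite B"
  using independent_imp_finite[OF orthonormal_basis_independent] .

lemma orthonormal_basis_card: "card B = dim S"
  using B orthonormal_basis_independent dim_eq_card_independent[of B] by (metis dim_span orthonormal_basis_of_def)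

lemma orthonormal_basis_expand:
  assumes "v \<in> S" shows "(\<Sum>e\<in>B. b v e *\<^sub>R e) = v"
proof -
  have "v \<in> span B" using assms B by (simp add: orthonormal_basis_of_def)
  then show ?thesis
  proof (rule span_induct[where P = "\<lambda>v. (\<Sum>e\<in>B. b v e *\<^sub>R e) = v"])
    show "subspace {v. (\<Sum>e\<in>B. b v e *\<^sub>R e) = v}"
      by (auto simp: subspace_def b_simps scaleR_add_left sum.distrib simp flip: scaleR_sum_right scaleR_scaleR)
    show "(\<Sum>e\<in>B. b v e *\<^sub>R e) = v" if "v \<in> B" for v
      using that orthonormal_basis_finite
      by (simp add: orthonormal_basis_unit if_distrib[of "\<lambda>x. x *\<^sub>R _"] sum.delta' sum.delta cong: if_cong)
  qed
qed

lemma orthonormal_basis_parseval: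
  assumes "v \<in> S" shows "(\<Sum>e\<in>B. b v e * b e w) = b v w"
  using arg_cong[OF orthonormal_basis_expand[OF assms], of "\<lambda>v. b v w"] by (simp add: b_sum_left b_simps)

end

text \<open>Expand one basis in the other and apply Parseval. The divergence thereby becomes
  independent of the basis that \<open>plane_div\<close> picks with \<open>SOME\<close>.\<close>

lemma orthonormal_basis_trace:
  fixes q :: "'e \<Rightarrow> 'e \<Rightarrow> real"
  assumes B: "orthonormal_basis_of b S B" and C: "orthonormal_basis_of b S C" and q: "bilinear q"
  shows "(\<Sum>e\<in>B. q e e) = (\<Sum>e\<in>C. q e e)"
proof -
  note q_simps = linear_sum[OF bilinear_linear1[OF q]] linear_sum[OF bilinear_linear2[OF q]]
    bilinear_lmul[OF q] bilinear_rmul[OF q]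
  have sub: "B \<subseteq> S" "C \<subseteq> S" using B C by (auto simp: orthonormal_basis_of_def)
  have "q e e = (\<Sum>f\<in>C. \<Sum>f'\<in>C. b e f * b e f' * q f f')" if "e \<in> B" for e
  proof -
    have e: "(\<Sum>f\<in>C. b e f *\<^sub>R f) = e"
      using orthonormal_basis_expand[OF C] that sub by blast
    have 1: "q x e = (\<Sum>f\<in>C. b e f * q x f)" for x
      using arg_cong[OF e, of "q x"] by (simp add: q_simps)
    have "q e e = (\<Sum>f\<in>C. b e f * q f e)"
      using arg_cong[OF e, of "\<lambda>x. q x e"] by (simp add: q_simps)
    then show ?thesis unfolding 1 by (simp add: sum_distrib_left mult.assoc)
  qed
  then have "(\<Sum>e\<in>B. q e e) = (\<Sum>e\<in>B. \<Sum>f\<in>C. \<Sum>f'\<in>C. b e f * b e f' * q f f')" by simp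
  also have "\<dots> = (\<Sum>f\<in>C. \<Sum>f'\<in>C. \<Sum>e\<in>B. b e f * b e f' * q f f')"
    by (subst sum.swap) (intro sum.cong refl sum.swap)
  also have "\<dots> = (\<Sum>f\<in>C. \<Sum>f'\<in>C. b f f' * q f f')"
  proof (intro sum.cong refl)
    fix f f' assume "f \<in> C" "f' \<in> C"
    then show "(\<Sum>e\<in>B. b e f * b e f' * q f f') = b f f' * q f f'"
      using orthonormal_basis_parseval[OF B, of f f'] sub by (auto simp: sym[of f] simp flip: sum_distrib_right)
  qed
  also have "\<dots> = (\<Sum>f\<in>C. q f f)"
    using orthonormal_basis_finite[OF C]
    by (simp add: orthonormal_basis_unit[OF C] if_distrib[of "\<lambda>x. x * _"] sum.delta sum.delta' cong: if_cong)
  finally show ?thesis .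
qed

end

section \<open>Traces over nearly orthonormal frames\<close>

lemma bilinear_inner: "bilinear (inner :: 'e::euclidean_space \<Rightarrow> 'e \<Rightarrow> real)"
  by (auto simp: bilinear_def inner_simps intro!: linearI)

interpretation inner_form: pos_def_form "inner :: 'e::euclidean_space \<Rightarrow> 'e \<Rightarrow> real"
  by unfold_locales (auto simp: inner_commute bilinear_inner)

text \<open>Gram-Schmidt on a spanning list with \<open>x\<close> put in front; being of unit
  length, \<open>x\<close> is its own first output.\<close>

lemma (in pos_def_form) orthonormal_basis_exists:
  assumes L: "subspace L" and x: "x \<in> L" "b x x = 1"
  shows "\<exists>B. orthonormal_basis_of b L B \<and> x \<in> B"
proof -
  obtain C where C: "C \<subseteq> L" "independent C" "L \<subseteq> span C" using basis_exists[of L] by metis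
  obtain l where l: "set l = C" using independent_imp_finite[OF C(2)] finite_list by blast
  have CL: "span C = L" using C L by (meson span_minimal subset_antisym)
  define u where "u i = (if i = 0 then x else l ! (i - 1))" for i
  have "{..<Suc (length l)} = insert 0 (Suc ` {..<length l})" by (auto simp: less_Suc_eq_0_disj)
  then have "u ` {..<Suc (length l)} = insert (u 0) ((\<lambda>i. u (Suc i)) ` {..<length l})"
    by (simp only: image_insert image_image)
  also have "\<dots> = insert x ((!) l ` {..<length l})" by (simp add: u_def)
  also have "(!) l ` {..<length l} = C" using l by (auto simp: set_conv_nth)
  finally have "span (u ` {..<Suc (length l)}) = L"
    using span_redundant[of x C] x(1) CL by (simp only:)
  then have B: "orthonormal_basis_of b L (frame_set u (Suc (length l)))"
    using frame_set_orthonormal_basis[of u "Suc (length l)"] by (simp only:)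
  have "residual u 0 = x" unfolding residual_def u_def by simp
  then have "gs_frame b u 0 = x" using x by (simp add: gs_frame_residual)
  moreover have "x \<noteq> 0" using x b_simps by auto
  ultimately have "x \<in> frame_set u (Suc (length l))"
    unfolding frame_set_def by (intro DiffI image_eqI[of _ _ 0]) auto
  then show ?thesis using B by blast
qed

text \<open>Bessel's inequality by duality: with \<open>v\<close> the combination of the
  \<open>f i\<close> with coefficients \<open>x \<bullet> f i\<close>, the sum equals
  \<open>x \<bullet> v\<close>, and \<open>v \<bullet> v\<close> exceeds the sum at most by the
  factor on the right. Cauchy-Schwarz concludes.\<close>

lemma near_orthonormal_bessel:
  fixes f :: "'i \<Rightarrow> 'e::euclidean_space"
  assumes fin: "finite B" and \<epsilon>: "0 \<le> \<epsilon>"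
    and near: "\<And>i j. i \<in> B \<Longrightarrow> j \<in> B \<Longrightarrow> \<bar>f i \<bullet> f j - (if i = j then 1 else 0)\<bar> \<le> \<epsilon>"
  shows "(\<Sum>i\<in>B. (x \<bullet> f i)\<^sup>2) \<le> (1 + real (card B) * \<epsilon>) * (x \<bullet> x)"
proof -
  define c where "c i = x \<bullet> f i" for i
  define s where "s = (\<Sum>i\<in>B. (c i)\<^sup>2)"
  define v where "v = (\<Sum>i\<in>B. c i *\<^sub>R f i)"
  have s0: "0 \<le> s" unfolding s_def by (intro sum_nonneg) auto
  have xv: "x \<bullet> v = s"
    by (simp add: v_def s_def inner_sum_right c_def power2_eq_square)
  have trm: "c i * c j * (f i \<bullet> f j) \<le> (if i = j then (c i)\<^sup>2 else 0) + \<epsilon> * (\<bar>c i\<bar> * \<bar>c j\<bar>)"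
    if "i \<in> B" "j \<in> B" for i j
  proof -
    have "c i * c j * (f i \<bullet> f j - (if i = j then 1 else 0)) \<le> \<bar>c i * c j\<bar> * \<bar>f i \<bullet> f j - (if i = j then 1 else 0)\<bar>"
      by (metis abs_ge_self abs_mult)
    also have "\<dots> \<le> \<bar>c i * c j\<bar> * \<epsilon>" by (intro mult_left_mono near that) simp
    finally show ?thesis by (auto simp: abs_mult power2_eq_square algebra_simps)
  qed
  have "v \<bullet> v = (\<Sum>i\<in>B. \<Sum>j\<in>B. c i * c j * (f i \<bullet> f j))"
    by (simp add: v_def inner_sum_left inner_sum_right sum_distrib_left mult.assoc mult.left_commute)
      (subst sum.swap, simp add: mult.left_commute)
  also have "\<dots> \<le> (\<Sum>i\<in>B. \<Sum>j\<in>B. (if i = j then (c i)\<^sup>2 else 0) + \<epsilon> * (\<bar>c i\<bar> * \<bar>c j\<bar>))"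
    by (intro sum_mono trm)
  also have "\<dots> = s + \<epsilon> * (\<Sum>i\<in>B. \<bar>c i\<bar>)\<^sup>2"
  proof -
    have "(\<Sum>i\<in>B. \<bar>c i\<bar>)\<^sup>2 = (\<Sum>i\<in>B. \<Sum>j\<in>B. \<bar>c i\<bar> * \<bar>c j\<bar>)"
      by (simp only: power2_eq_square sum_product)
    then show ?thesis using fin by (simp add: sum.distrib s_def sum_distrib_left)
  qed
  also have "\<dots> \<le> s + \<epsilon> * (s * card B)"
  proof -
    have "(\<Sum>i\<in>B. \<bar>c i\<bar>)\<^sup>2 \<le> (\<Sum>i\<in>B. \<bar>c i\<bar>\<^sup>2) * card B"
      using sum_squared_le_sum_of_squares[of "\<lambda>i. \<bar>c i\<bar>" B] by simp
    then show ?thesis using \<epsilon> by (simp add: s_def mult_left_mono)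
  qed
  finally have vv: "v \<bullet> v \<le> (1 + real (card B) * \<epsilon>) * s" by (simp add: algebra_simps)
  have "s * s \<le> (x \<bullet> x) * (v \<bullet> v)"
    using Cauchy_Schwarz_ineq[of x v] by (simp add: xv power2_eq_square)
  also have "\<dots> \<le> (x \<bullet> x) * ((1 + real (card B) * \<epsilon>) * s)"
    by (intro mult_left_mono vv) simp
  finally have "s * s \<le> ((1 + real (card B) * \<epsilon>) * (x \<bullet> x)) * s" by (simp add: algebra_simps)
  moreover have "0 \<le> (1 + real (card B) * \<epsilon>) * (x \<bullet> x)" using \<epsilon> by simp
  ultimately have "s \<le> (1 + real (card B) * \<epsilon>) * (x \<bullet> x)"
    using s0 by (cases "s = 0") (auto simp: mult_le_cancel_right)
  then show ?thesis by (simp add: s_def c_def)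
qed

section \<open>Splitting along a subspace, and the barrier function\<close>

locale subspace_split =
  fixes L B :: "'e::euclidean_space set"
  assumes B: "orthonormal_basis_of inner L B"
begin

definition P :: "'e \<Rightarrow> 'e" where "P x = (\<Sum>b\<in>B. (x \<bullet> b) *\<^sub>R b)"
definition Q :: "'e \<Rightarrow> 'e" where "Q x = x - P x"

lemma subspace_L: "subspace L"
  using B unfolding orthonormal_basis_of_def by (metis subspace_span)

lemma linear_P: "linear P"
  unfolding P_def by (rule linearI) (simp_all add: inner_simps scaleR_add_left sum.distrib scaleR_sum_right)

lemma linear_Q: "linear Q"
  unfolding Q_def using linear_P by (intro linear_compose_sub) (auto simp: linear_ident)

lemma P_in: "P x \<in> L"
  unfolding P_def using B subspace_L
  by (intro subspace_sum subspace_scale) (auto simp: orthonormal_basis_of_def)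

lemma P_id: "x \<in> L \<Longrightarrow> P x = x"
  unfolding P_def by (rule inner_form.orthonormal_basis_expand[OF B])

lemma P_inner: "P x \<bullet> y = (\<Sum>b\<in>B. (x \<bullet> b) * (y \<bullet> b))"
  unfolding P_def inner_sum_left by (intro sum.cong) (auto simp: inner_commute)

lemma P_inner_P: "P x \<bullet> P y = P x \<bullet> y"
proof -
  have "P x \<bullet> P y = P y \<bullet> P x" by (rule inner_commute)
  also have "\<dots> = P (P x) \<bullet> y" unfolding P_inner by (intro sum.cong) auto
  finally show ?thesis by (simp add: P_id P_in)
qed

lemma P_inner_Q: "P x \<bullet> Q y = 0" "Q y \<bullet> P x = 0"
  by (simp_all add: Q_def inner_simps P_inner_P inner_commute[of _ "P x"])

lemma Q_inner_Q: "Q x \<bullet> Q y = Q x \<bullet> y"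
  using P_inner_Q(2)[where x = y and y = x] by (simp add: Q_def[of y] inner_diff_right)

lemma inner_split: "x \<bullet> y = P x \<bullet> P y + Q x \<bullet> Q y"
proof -
  have "x \<bullet> y = (P x + Q x) \<bullet> y" by (simp add: Q_def)
  then show ?thesis by (simp only: inner_add_left P_inner_P Q_inner_Q)
qed

lemma norm_P_le: "norm (P x) \<le> norm x" and norm_Q_le: "norm (Q x) \<le> norm x"
  unfolding norm_le using inner_split[of x x] by simp_all

lemma dim_pos: "x \<in> L \<Longrightarrow> x \<noteq> 0 \<Longrightarrow> 1 \<le> dim L"
  by (metis One_nat_def Suc_leI dim_eq_0 gr0I singletonD subset_singleton_iff subsetD)

text \<open>
  Expand the trace of \<open>P\<close> over the \<open>f i\<close> in an orthonormal basis of \<open>L\<close> that contains the direction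
  of \<open>P x\<close>; the remaining \<open>m - 1\<close> basis vectors contribute at most about 1 each.
\<close>

lemma trace_lower_bound:
  fixes f :: "'i \<Rightarrow> 'e"
  assumes fin: "finite I" and card: "card I = dim L" and \<epsilon>: "0 \<le> \<epsilon>"
    and near: "\<And>i j. i \<in> I \<Longrightarrow> j \<in> I \<Longrightarrow> \<bar>f i \<bullet> f j - (if i = j then 1 else 0)\<bar> \<le> \<epsilon>"
  shows "(P x \<bullet> P x) * (1 - (\<Sum>i\<in>I. Q (f i) \<bullet> Q (f i)) - (real (dim L))\<^sup>2 * \<epsilon>) \<le> (\<Sum>i\<in>I. (P x \<bullet> f i)\<^sup>2)"
proof (cases "P x = 0")
  case False
  define m where "m = real (dim L)"
  define q where "q = (\<Sum>i\<in>I. Q (f i) \<bullet> Q (f i))"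
  define x1 where "x1 = (1 / norm (P x)) *\<^sub>R P x"
  have x1: "x1 \<in> L" "x1 \<bullet> x1 = 1"
    using False subspace_scale[OF subspace_L P_in] by (auto simp: x1_def dot_square_norm power2_eq_square)
  then obtain C where C: "orthonormal_basis_of inner L C" "x1 \<in> C"
    using inner_form.orthonormal_basis_exists[OF subspace_L] by blast
  have finC: "finite C" and cardC: "card C = dim L"
    using inner_form.orthonormal_basis_finite[OF C(1)] inner_form.orthonormal_basis_card[OF C(1)] by auto
  have Pf: "P z \<bullet> P z = (\<Sum>b\<in>C. (b \<bullet> z)\<^sup>2)" for z
  proof -
    have "bilinear (\<lambda>u v. (z \<bullet> u) * (z \<bullet> v))"
      unfolding bilinear_def by (auto intro!: linearI simp: inner_simps algebra_simps)
    from inner_form.orthonormal_basis_trace[OF B C(1) this]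
    show ?thesis unfolding P_inner_P unfolding P_inner power2_eq_square unfolding inner_commute[of _ z] .
  qed
  have "x1 \<noteq> 0" using x1(2) by force
  then have m1: "1 \<le> m" using dim_pos[OF x1(1)] by (simp add: m_def)
  have "m * (1 - \<epsilon>) - q \<le> (\<Sum>i\<in>I. f i \<bullet> f i) - q"
  proof -
    have "(\<Sum>i\<in>I. 1 - \<epsilon>) \<le> (\<Sum>i\<in>I. f i \<bullet> f i)"
    proof (rule sum_mono)
      show "1 - \<epsilon> \<le> f i \<bullet> f i" if "i \<in> I" for i using near[OF that that] by simp
    qed
    then show ?thesis using card by (simp add: m_def)
  qed
  also have "\<dots> = (\<Sum>i\<in>I. P (f i) \<bullet> P (f i))"
    unfolding q_def by (subst inner_split) (simp add: sum.distrib)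
  also have "\<dots> = (\<Sum>b\<in>C. \<Sum>i\<in>I. (b \<bullet> f i)\<^sup>2)" unfolding Pf by (rule sum.swap)
  also have "\<dots> = (\<Sum>i\<in>I. (x1 \<bullet> f i)\<^sup>2) + (\<Sum>b\<in>C - {x1}. \<Sum>i\<in>I. (b \<bullet> f i)\<^sup>2)"
    using finC C(2) by (rule sum.remove)
  also have "(\<Sum>b\<in>C - {x1}. \<Sum>i\<in>I. (b \<bullet> f i)\<^sup>2) \<le> (\<Sum>b\<in>C - {x1}. 1 + m * \<epsilon>)"
  proof (rule sum_mono)
    fix b assume "b \<in> C - {x1}"
    then have "b \<bullet> b = 1" using inner_form.orthonormal_basis_unit[OF C(1)] by simp
    then show "(\<Sum>i\<in>I. (b \<bullet> f i)\<^sup>2) \<le> 1 + m * \<epsilon>"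
      using near_orthonormal_bessel[OF fin \<epsilon> near, of b] card by (simp add: m_def)
  qed
  also have "(\<Sum>b\<in>C - {x1}. 1 + m * \<epsilon>) = (m - 1) * (1 + m * \<epsilon>)"
    using finC C(2) cardC m1 by (simp add: card_Diff_singleton m_def of_nat_diff)
  finally have "1 - q - m\<^sup>2 * \<epsilon> \<le> (\<Sum>i\<in>I. (x1 \<bullet> f i)\<^sup>2)"
    by (simp add: algebra_simps power2_eq_square)
  then have "(P x \<bullet> P x) * (1 - q - m\<^sup>2 * \<epsilon>) \<le> (P x \<bullet> P x) * (\<Sum>i\<in>I. (x1 \<bullet> f i)\<^sup>2)"
    by (intro mult_left_mono) auto
  also have "\<dots> = (\<Sum>i\<in>I. (P x \<bullet> f i)\<^sup>2)"
    using False by (simp add: x1_def sum_distrib_left power_mult_distrib power_divide dot_square_norm)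
  finally show ?thesis by (simp add: q_def m_def)
qed simp

text \<open>
  Minus the squared distance to the axis \<open>P = 0\<close>, made strongly convex across \<open>L\<close>.  The quartic term
  only serves to make the set where \<open>barrier C > -3/2\<close> bounded.
\<close>

definition barrier :: "real \<Rightarrow> 'e \<Rightarrow> real" where
  "barrier C x = - (P x \<bullet> P x) + C * (Q x \<bullet> Q x) - C\<^sup>2 * (Q x \<bullet> Q x)\<^sup>2"

definition barrier' :: "real \<Rightarrow> 'e \<Rightarrow> 'e \<Rightarrow> real" where
  "barrier' C x e = - 2 * (P x \<bullet> e) + (2 * C - 4 * C\<^sup>2 * (Q x \<bullet> Q x)) * (Q x \<bullet> e)"

text \<open>The Hessian of the barrier at \<open>(e, e)\<close>; the last term stems from
  differentiating the coefficient in \<open>barrier'\<close>.\<close>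

definition barrier'' :: "real \<Rightarrow> 'e \<Rightarrow> 'e \<Rightarrow> real" where
  "barrier'' C x e = - 2 * (P e \<bullet> P e) + (2 * C - 4 * C\<^sup>2 * (Q x \<bullet> Q x)) * (Q e \<bullet> Q e)
     - 8 * C\<^sup>2 * (Q x \<bullet> e)\<^sup>2"

text \<open>
  If the \<open>m\<close>-plane spanned by the \<open>f i\<close> is close to \<open>L\<close>, it contains nearly the radial direction
  \<open>P x\<close>, and the squared first derivatives outweigh the negative Hessian; if it is not, the
  convexity across \<open>L\<close> does.
\<close>

lemma barrier_trace:
  fixes f :: "'i \<Rightarrow> 'e" and k :: real
  assumes fin: "finite I" and card: "card I = dim L" and \<epsilon>: "0 \<le> \<epsilon>" "3 * (real (dim L) + 1)\<^sup>2 * \<epsilon> \<le> 1"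
    and near: "\<And>i j. i \<in> I \<Longrightarrow> j \<in> I \<Longrightarrow> \<bar>f i \<bullet> f j - (if i = j then 1 else 0)\<bar> \<le> \<epsilon>"
    and k: "k = 4 * real (dim L) + 3" and C: "C = 4 * k"
    and t: "3 / 4 \<le> P x \<bullet> P x" "P x \<bullet> P x \<le> 2"
    and n: "8 * C\<^sup>2 * (k + 2) * (Q x \<bullet> Q x) \<le> 1"
  shows "2 \<le> k * (\<Sum>i\<in>I. (barrier' C x (f i))\<^sup>2) + (\<Sum>i\<in>I. barrier'' C x (f i))"
proof -
  define m where "m = real (dim L)"
  define q where "q = (\<Sum>i\<in>I. Q (f i) \<bullet> Q (f i))"
  define N where "N = Q x \<bullet> Q x"
  define t where "t = P x \<bullet> P x"
  define a where "a = 2 * C - 4 * C\<^sup>2 * N"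
  define s where "s = (\<Sum>i\<in>I. (P x \<bullet> f i)\<^sup>2)"
  define r where "r = (\<Sum>i\<in>I. (Q x \<bullet> f i)\<^sup>2)"
  have m0: "0 \<le> m" by (simp add: m_def)
  have k3: "3 \<le> k" and C12: "12 \<le> C" using k C by auto
  have N0: "0 \<le> N" by (simp add: N_def)
  have q0: "0 \<le> q" unfolding q_def by (intro sum_nonneg) auto
  have r0: "0 \<le> r" unfolding r_def by (intro sum_nonneg) auto
  have m2: "m\<^sup>2 * \<epsilon> \<le> 1 / 3" "m * \<epsilon> \<le> 1 / 3" "\<epsilon> \<le> 1 / 3"
  proof -
    have "m\<^sup>2 * \<epsilon> \<le> (m + 1)\<^sup>2 * \<epsilon>" "m * \<epsilon> \<le> (m + 1)\<^sup>2 * \<epsilon>" "1 * \<epsilon> \<le> (m + 1)\<^sup>2 * \<epsilon>"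
      using m0 \<epsilon> by (intro mult_right_mono; simp add: power2_eq_square algebra_simps)+
    then show "m\<^sup>2 * \<epsilon> \<le> 1 / 3" "m * \<epsilon> \<le> 1 / 3" "\<epsilon> \<le> 1 / 3" using \<epsilon> by (auto simp: m_def)
  qed
  have CN: "4 * C * N \<le> 1"
  proof -
    have "1 * 1 \<le> C * (k + 2)" using k3 C12 by (intro mult_mono) auto
    then have "4 * C * N * 1 \<le> 4 * C * N * (2 * (C * (k + 2)))" using N0 C12 by (intro mult_left_mono) auto
    also have "\<dots> \<le> 1" using n by (simp add: N_def power2_eq_square algebra_simps)
    finally show ?thesis by simp
  qed
  have a: "C \<le> a" "a \<le> 2 * C"
    using mult_right_mono[OF CN, of C] C12 N0 by (auto simp: a_def power2_eq_square algebra_simps)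
  have a2: "a\<^sup>2 \<le> 4 * C\<^sup>2" using power_mono[of a "2 * C" 2] a C12 by (simp add: power_mult_distrib)
  have s: "t * (1 - q - m\<^sup>2 * \<epsilon>) \<le> s"
    unfolding s_def t_def q_def m_def by (rule trace_lower_bound[OF fin card \<epsilon>(1) near])
  have r: "r \<le> 2 * N"
  proof -
    have "r \<le> (1 + m * \<epsilon>) * N"
      using near_orthonormal_bessel[OF fin \<epsilon>(1) near, of "Q x"] card by (simp add: r_def m_def N_def)
    also have "\<dots> \<le> 2 * N" using m2 N0 by (intro mult_right_mono) auto
    finally show ?thesis .
  qed
  \<comment> \<open>Half of the tangential square is kept and the mixed term is paid for by the
    normal square, which the smallness of \<open>Q x \<bullet> Q x\<close> makes harmless.\<close>
  have sq: "2 * (P x \<bullet> e)\<^sup>2 - 4 * C\<^sup>2 * (Q x \<bullet> e)\<^sup>2 \<le> (barrier' C x e)\<^sup>2" for e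
  proof -
    define u v where "u = P x \<bullet> e" and "v = Q x \<bullet> e"
    have "0 \<le> (2 * u - 2 * (a * v))\<^sup>2" by simp
    then have "2 * u\<^sup>2 - a\<^sup>2 * v\<^sup>2 \<le> (- 2 * u + a * v)\<^sup>2"
      by (simp add: power2_eq_square algebra_simps)
    moreover have "a\<^sup>2 * v\<^sup>2 \<le> 4 * C\<^sup>2 * v\<^sup>2" using a2 by (intro mult_right_mono) auto
    ultimately show ?thesis by (simp add: barrier'_def a_def u_def v_def N_def)
  qed
  have "2 * s - 4 * C\<^sup>2 * r \<le> (\<Sum>i\<in>I. (barrier' C x (f i))\<^sup>2)"
    using sum_mono[of I, OF sq] by (simp add: s_def r_def sum_subtractf sum_distrib_left)
  then have 1: "k * (2 * s - 4 * C\<^sup>2 * r) \<le> k * (\<Sum>i\<in>I. (barrier' C x (f i))\<^sup>2)"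
    using k3 by (intro mult_left_mono) auto
  have Psum: "(\<Sum>i\<in>I. P (f i) \<bullet> P (f i)) \<le> 2 * m"
  proof -
    have "(\<Sum>i\<in>I. P (f i) \<bullet> P (f i)) \<le> (\<Sum>i\<in>I. 2)"
    proof (rule sum_mono)
      fix i assume "i \<in> I"
      then have "f i \<bullet> f i \<le> 2" using near[of i i] m2 by auto
      moreover have "0 \<le> Q (f i) \<bullet> Q (f i)" by simp
      ultimately show "P (f i) \<bullet> P (f i) \<le> 2" using inner_split[of "f i" "f i"] by linarith
    qed
    then show ?thesis using card by (simp add: m_def)
  qed
  have "(\<Sum>i\<in>I. barrier'' C x (f i)) = - 2 * (\<Sum>i\<in>I. P (f i) \<bullet> P (f i)) + a * q - 8 * C\<^sup>2 * r"
    by (simp add: barrier''_def a_def q_def r_def N_def sum_subtractf sum.distrib sum_distrib_left sum_negf)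
  moreover have "C * q \<le> a * q" using a q0 by (intro mult_right_mono) auto
  ultimately have 2: "- 4 * m + C * q - 8 * C\<^sup>2 * r \<le> (\<Sum>i\<in>I. barrier'' C x (f i))"
    using Psum by linarith
  have 3: "4 * C\<^sup>2 * r * (k + 2) \<le> 1"
  proof -
    have "4 * C\<^sup>2 * r * (k + 2) \<le> 4 * C\<^sup>2 * (2 * N) * (k + 2)"
      using r k3 by (intro mult_right_mono mult_left_mono) auto
    also have "\<dots> \<le> 1" using n by (simp add: N_def algebra_simps)
    finally show ?thesis .
  qed
  \<comment> \<open>From \<open>t \<ge> 3 / 4\<close> and
    \<open>m\<^sup>2 * \<epsilon> \<le> 1 / 3\<close> the tangential trace \<open>s\<close> is at
    least \<open>1 / 2 - 2 * q\<close>.\<close>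
  have 4: "k - 4 * k * q \<le> 2 * k * s"
  proof -
    have "3 / 4 * (2 / 3) \<le> t * (1 - m\<^sup>2 * \<epsilon>)"
      using assms(8) m2 by (intro mult_mono) (auto simp: t_def)
    moreover have "t * q \<le> 2 * q" using assms(9) q0 by (intro mult_right_mono) (auto simp: t_def)
    ultimately have "1 / 2 - 2 * q \<le> s" using s by (simp add: algebra_simps)
    then have "2 * k * (1 / 2 - 2 * q) \<le> 2 * k * s" using k3 by (intro mult_left_mono) auto
    then show ?thesis by (simp add: algebra_simps)
  qed
  \<comment> \<open>Here the constants are decided: \<open>C = 4 * k\<close> cancels the two
    multiples of \<open>q\<close>, and \<open>k = 4 * m + 3\<close> leaves 2 after paying
    \<open>4 * m\<close> and the error 1 of fact \<open>3\<close>.\<close>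
  have "k * (2 * s - 4 * C\<^sup>2 * r) + (- 4 * m + C * q - 8 * C\<^sup>2 * r)
      = 2 * k * s - 4 * C\<^sup>2 * r * (k + 2) - 4 * m + C * q" by (simp add: algebra_simps)
  moreover have "C * q = 4 * k * q" "k = 4 * m + 3" using k C by (auto simp: m_def)
  ultimately show ?thesis using 1 2 3 4 by linarith
qed

end

section \<open>Gradients and estimates for a variable metric\<close>

lemma Basis_list: "\<exists>l. set l = (Basis :: 'e::euclidean_space set) \<and> length l = DIM('e)"
  by (metis distinct_card finite_Basis finite_distinct_list)

context pos_def_form begin

text \<open>By counting dimensions, Gram-Schmidt never returns \<open>0\<close> on a basis of the
  whole space. This is what makes its outputs differentiable in the form.\<close>

lemma frame_Basis:
  assumes "set l = (Basis :: 'e set)" "length l = DIM('e)"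
  shows "orthonormal_basis_of b UNIV (frame_set ((!) l) DIM('e))"
    and "n < DIM('e) \<Longrightarrow> gs_frame b ((!) l) n \<noteq> 0"
proof -
  have "(!) l ` {..<DIM('e)} = Basis" using assms by (auto simp: set_conv_nth)
  then show B: "orthonormal_basis_of b UNIV (frame_set ((!) l) DIM('e))"
    using frame_set_orthonormal_basis[of "(!) l" "DIM('e)"] by (simp only: span_Basis)
  have card: "card (frame_set ((!) l) DIM('e)) = DIM('e)"
    using orthonormal_basis_card[OF B] by simp
  show "gs_frame b ((!) l) n \<noteq> 0" if n: "n < DIM('e)"
  proof
    assume 0: "gs_frame b ((!) l) n = 0"
    have "frame_set ((!) l) DIM('e) \<subseteq> gs_frame b ((!) l) ` ({..<DIM('e)} - {n})"
      unfolding frame_set_def using 0 by auto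
    then have "card (frame_set ((!) l) DIM('e)) \<le> card ({..<DIM('e)} - {n})"
      by (rule surj_card_le[rotated]) simp
    then show False using n card by simp
  qed
qed

text \<open>The map sends a \<open>b\<close>-orthonormal basis to the standard one. It will turn the
  metric at a single point into the Euclidean inner product.\<close>

lemma inner_representation: "\<exists>A :: 'e \<Rightarrow> 'e. linear A \<and> (\<forall>u v. A u \<bullet> A v = b u v)"
proof -
  obtain l where l: "set l = (Basis :: 'e set)" "length l = DIM('e)" using Basis_list by blast
  define E where "E = frame_set ((!) l) DIM('e)"
  have E: "orthonormal_basis_of b UNIV E" unfolding E_def by (rule frame_Basis[OF l])
  have fin: "finite E" by (rule orthonormal_basis_finite[OF E])
  have "card E = card (Basis :: 'e set)" using orthonormal_basis_card[OF E] by simp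
  then obtain h where h: "bij_betw h E (Basis :: 'e set)"
    using finite_same_card_bij[OF fin finite_Basis] by blast
  define A where "A x = (\<Sum>e\<in>E. b x e *\<^sub>R h e)" for x
  have "linear A" unfolding A_def
    by (rule linearI) (simp_all add: b_simps scaleR_add_left sum.distrib scaleR_sum_right)
  moreover have "A u \<bullet> A v = b u v" for u v
  proof -
    have hh: "h e \<bullet> h f = (if e = f then 1 else 0)" if "e \<in> E" "f \<in> E" for e f
    proof -
      have "h e \<in> Basis" "h f \<in> Basis" "h e = h f \<longleftrightarrow> e = f"
        using h that by (auto simp: bij_betw_def inj_on_eq_iff)
      then show ?thesis by (simp add: inner_Basis)
    qed
    have "A u \<bullet> A v = (\<Sum>e\<in>E. \<Sum>f\<in>E. b u e * b v f * (h e \<bullet> h f))"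
      by (simp add: A_def inner_sum_left inner_sum_right sum_distrib_left mult.assoc) (subst sum.swap, simp add: mult.left_commute)
    also have "\<dots> = (\<Sum>e\<in>E. \<Sum>f\<in>E. if e = f then b u e * b v f else 0)"
      by (intro sum.cong refl) (simp add: hh)
    also have "\<dots> = (\<Sum>e\<in>E. b u e * b v e)" using fin by simp
    also have "\<dots> = (\<Sum>e\<in>E. b u e * b e v)" by (simp add: sym[of v])
    also have "\<dots> = b u v" by (rule orthonormal_basis_parseval[OF E]) simp
    finally show ?thesis .
  qed
  ultimately show ?thesis by blast
qed

end

section \<open>Frames, gradients and size estimates for a \<open>C1\<close> metric\<close>

locale metric_on =
  fixes U :: "'e::euclidean_space set" and G :: "'e \<Rightarrow> 'e \<Rightarrow> 'e \<Rightarrow> real"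
  assumes open_U: "open U" and pos_def: "y \<in> U \<Longrightarrow> pos_def_form (G y)"
    and G_Ck1: "Ck_on 1 U (\<lambda>y. G y u v)"
begin

lemma G_bilinear: "y \<in> U \<Longrightarrow> bilinear (G y)"
  using pos_def by (auto simp: pos_def_form_def)

lemma Ck1_inverse_sqrt: "Ck_on 1 {0<..} (\<lambda>s::real. inverse (sqrt s))"
  by (rule Ck1_real[where f' = "\<lambda>s. - (inverse (sqrt s) * (inverse (sqrt s) / 2) * inverse (sqrt s))"])
    (auto intro!: derivative_eq_intros continuous_intros)

text \<open>Nonvanishing outputs keep the argument of the inverse square root positive, the range
  where it is \<open>C1\<close>.\<close>

lemma gs_frame_Ck1:
  assumes nz: "\<And>y n. y \<in> U \<Longrightarrow> n < N \<Longrightarrow> gs_frame (G y) u n \<noteq> 0" and "n < N"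
  shows "Ck_on 1 U (\<lambda>y. gs_frame (G y) u n)"
  using \<open>n < N\<close>
proof (induction n rule: less_induct)
  case (less n)
  have IH: "Ck_on 1 U (\<lambda>y. gs_frame (G y) u i)" if "i < n" for i
    using less that by simp
  define r where "r y = u n - (\<Sum>i<n. G y (u n) (gs_frame (G y) u i) *\<^sub>R gs_frame (G y) u i)" for y
  have Gu: "Ck_on 1 U (\<lambda>y. G y (u n) (gs_frame (G y) u i))" if "i < n" for i
    by (rule Ck1_bilinear_family[where r = "\<lambda>y. u n", OF open_U G_bilinear G_Ck1 Ck1_const IH[OF that]])
  have "Ck_on 1 U (\<lambda>y. u n + (\<Sum>i<n. - (G y (u n) (gs_frame (G y) u i) *\<^sub>R gs_frame (G y) u i)))"
  proof (rule Ck1_add[OF Ck1_const Ck1_sum])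
    fix i assume "i \<in> {..<n}"
    then have i: "i < n" by simp
    show "Ck_on 1 U (\<lambda>y. - (G y (u n) (gs_frame (G y) u i) *\<^sub>R gs_frame (G y) u i))"
      by (rule Ck1_bounded_linear[OF bounded_linear_minus[OF bounded_linear_ident] Ck1_bilinear[OF bounded_bilinear_scaleR Gu[OF i] IH[OF i]]])
  qed
  then have r: "Ck_on 1 U r"
    unfolding r_def by (simp add: sum_negf)
  have Grr: "Ck_on 1 U (\<lambda>y. G y (r y) (r y))"
    by (rule Ck1_bilinear_family[OF open_U G_bilinear G_Ck1 r r])
  have pos: "0 < G y (r y) (r y)" if y: "y \<in> U" for y
  proof -
    interpret pos_def_form "G y" using y by (rule pos_def)
    have "r y = residual u n" by (simp add: r_def residual_def)
    then have "r y \<noteq> 0" using nz[OF y less.prems] gs_frame_eq_0 by simp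
    then show ?thesis by (rule pos)
  qed
  have "Ck_on 1 U (\<lambda>y. inverse (sqrt (G y (r y) (r y))) *\<^sub>R r y)"
    by (rule Ck1_bilinear[OF bounded_bilinear_scaleR Ck1_compose[OF Grr Ck1_inverse_sqrt] r]) (use pos in auto)
  moreover have "(\<lambda>y. inverse (sqrt (G y (r y) (r y))) *\<^sub>R r y) = (\<lambda>y. gs_frame (G y) u n)"
    by (subst gs_frame.simps) (simp add: r_def Let_def)
  ultimately show ?case by simp
qed

text \<open>The metric dual of \<open>\<omega>\<close> is written in a \<open>C1\<close> orthonormal
  frame, which yields its regularity without inverting the metric as a matrix.\<close>

lemma gradient_exists:
  assumes lin: "\<And>y. y \<in> U \<Longrightarrow> linear (\<omega> y)" and \<omega>: "\<And>v. Ck_on 1 U (\<lambda>y. \<omega> y v)"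
  shows "\<exists>Y. Ck_on 1 U Y \<and> (\<forall>y\<in>U. \<forall>v. G y (Y y) v = (\<omega> y v :: real))"
proof -
  obtain l where l: "set l = (Basis :: 'e set)" "length l = DIM('e)" using Basis_list by blast
  define E where "E n y = gs_frame (G y) ((!) l) n" for n y
  have E: "Ck_on 1 U (E n)" if "n < DIM('e)" for n
    unfolding E_def using that by (rule gs_frame_Ck1[rotated]) (rule pos_def_form.frame_Basis(2)[OF pos_def l])
  define Y where "Y y = (\<Sum>n<DIM('e). \<omega> y (E n y) *\<^sub>R E n y)" for y
  have "Ck_on 1 U Y"
    unfolding Y_def
  proof (rule Ck1_sum)
    fix n assume "n \<in> {..<DIM('e)}"
    then have n: "n < DIM('e)" by simp
    show "Ck_on 1 U (\<lambda>y. \<omega> y (E n y) *\<^sub>R E n y)"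
      by (rule Ck1_bilinear[OF bounded_bilinear_scaleR Ck1_linear_family[OF open_U lin \<omega> E[OF n]] E[OF n]])
  qed
  moreover have "G y (Y y) v = \<omega> y v" if y: "y \<in> U" for y v
  proof -
    interpret pos_def_form "G y" using y by (rule pos_def)
    let ?F = "frame_set ((!) l) DIM('e)"
    note F = frame_Basis(1)[OF l]
    have "G y (Y y) v = (\<Sum>n<DIM('e). \<omega> y (E n y) * G y (E n y) v)"
      by (simp add: Y_def b_sum_left b_simps)
    also have "\<dots> = (\<Sum>e\<in>?F. \<omega> y e * G y e v)"
      unfolding E_def by (rule frame_set_sum[symmetric]) (simp add: b_simps)
    also have "\<dots> = \<omega> y (\<Sum>e\<in>?F. G y v e *\<^sub>R e)"
      by (simp add: linear_sum[OF lin[OF y]] linear_cmul[OF lin[OF y]] sym[of v] mult.commute)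
    also have "(\<Sum>e\<in>?F. G y v e *\<^sub>R e) = v" by (rule orthonormal_basis_expand[OF F]) simp
    finally show ?thesis .
  qed
  ultimately show ?thesis by blast
qed

text \<open>Differentiating the defining relation of \<open>Y\<close> expresses its derivative
  through \<open>\<omega>'\<close> and derivatives of the metric. What remains is the squared
  differential, the coordinate Hessian, and two metric terms that become of lower order after
  scaling.\<close>

lemma lie_form_gradient:
  fixes \<phi> :: "real \<Rightarrow> real"
  assumes y: "y \<in> U" and Y: "Ck_on 1 U Y" and grad: "\<And>z v. z \<in> U \<Longrightarrow> G z (Y z) v = \<omega> z v"
    and v: "(v has_derivative \<omega> y) (at y)" and \<omega>: "((\<lambda>z. \<omega> z e) has_derivative \<omega>') (at y)"
    and \<phi>: "(\<phi> has_real_derivative d) (at (v y))"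
  shows "lie_form G (\<lambda>z. \<phi> (v z) *\<^sub>R Y z) y e = d * (\<omega> y e)\<^sup>2 + \<phi> (v y) * (\<omega>' e
     - frechet_derivative (\<lambda>z. G z (Y y) e) (at y) e + frechet_derivative (\<lambda>z. G z e e) (at y) (Y y) / 2)"
proof -
  note lin = bilinear_linear1[OF G_bilinear] bilinear_linear2[OF G_bilinear]
  define DY where "DY = frechet_derivative Y (at y)"
  have DY: "(Y has_derivative DY) (at y)" unfolding DY_def by (rule Ck1_has_derivative[OF Y y])
  define DG where "DG u v = frechet_derivative (\<lambda>z. G z u v) (at y)" for u v
  have DG: "((\<lambda>z. G z u v) has_derivative DG u v) (at y)" for u v
    unfolding DG_def by (rule Ck1_has_derivative[OF G_Ck1 y])
  have "((\<lambda>z. G z (Y z) e) has_derivative (\<lambda>h. DG (Y y) e h + G y (DY h) e)) (at y)"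
    by (rule has_derivative_linear_family[where T = "\<lambda>z u. G z u e" and D = "\<lambda>u. DG u e", OF open_U y lin(1) DG DY])
  then have "((\<lambda>z. \<omega> z e) has_derivative (\<lambda>h. DG (Y y) e h + G y (DY h) e)) (at y)"
    by (rule has_derivative_transform_within_open[OF _ open_U y]) (simp add: grad)
  from has_derivative_unique[OF this \<omega>]
  have 1: "G y (DY h) e = \<omega>' h - DG (Y y) e h" for h by (metis add_diff_cancel_left')
  have "((\<lambda>z. \<phi> (v z)) has_derivative (\<lambda>h. d * \<omega> y h)) (at y)"
    using has_derivative_compose[OF v \<phi>[unfolded has_field_derivative_def]] .
  from has_derivative_scaleR[OF this DY]
  have "((\<lambda>z. \<phi> (v z) *\<^sub>R Y z) has_derivative (\<lambda>h. \<phi> (v y) *\<^sub>R DY h + (d * \<omega> y h) *\<^sub>R Y y)) (at y)" .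
  from frechet_derivative_at[OF this, symmetric]
  have "lie_form G (\<lambda>z. \<phi> (v z) *\<^sub>R Y z) y e =
     G y (\<phi> (v y) *\<^sub>R DY e + (d * \<omega> y e) *\<^sub>R Y y) e + DG e e (\<phi> (v y) *\<^sub>R Y y) / 2"
    by (simp add: lie_form_def DG_def)
  also have "DG e e (\<phi> (v y) *\<^sub>R Y y) = \<phi> (v y) * DG e e (Y y)"
    using linear_cmul[OF has_derivative_linear[OF DG]] by simp
  also have "G y (\<phi> (v y) *\<^sub>R DY e + (d * \<omega> y e) *\<^sub>R Y y) e = \<phi> (v y) * (\<omega>' e - DG (Y y) e e) + d * \<omega> y e * \<omega> y e"
    using bilinear_ladd[OF G_bilinear[OF y]] bilinear_lmul[OF G_bilinear[OF y]] by (simp add: 1 grad[OF y])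
  finally show ?thesis by (simp add: DG_def power2_eq_square algebra_simps)
qed

end

lemma bilinear_bound_Basis:
  fixes B :: "'e::euclidean_space \<Rightarrow> 'e \<Rightarrow> real"
  assumes B: "bilinear B"
  shows "\<bar>B u v\<bar> \<le> (\<Sum>i\<in>Basis. \<Sum>j\<in>Basis. \<bar>B i j\<bar>) * norm u * norm v"
proof -
  have ex: "B u v = (\<Sum>i\<in>Basis. \<Sum>j\<in>Basis. (u \<bullet> i) * (v \<bullet> j) * B i j)"
  proof -
    have "B u v = B (\<Sum>i\<in>Basis. (u \<bullet> i) *\<^sub>R i) v" by (simp add: euclidean_representation)
    also have "\<dots> = (\<Sum>i\<in>Basis. (u \<bullet> i) * B i v)"
      by (simp only: linear_sum[OF bilinear_linear1[OF B]] bilinear_lmul[OF B] real_scaleR_def)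
    also have "\<dots> = (\<Sum>i\<in>Basis. (u \<bullet> i) * (\<Sum>j\<in>Basis. (v \<bullet> j) * B i j))"
    proof (intro sum.cong refl arg_cong2[where f = "(*)"])
      fix i :: 'e
      have "B i v = B i (\<Sum>j\<in>Basis. (v \<bullet> j) *\<^sub>R j)" by (simp add: euclidean_representation)
      then show "B i v = (\<Sum>j\<in>Basis. (v \<bullet> j) * B i j)"
        by (simp only: linear_sum[OF bilinear_linear2[OF B]] bilinear_rmul[OF B] real_scaleR_def)
    qed
    finally show ?thesis by (simp add: sum_distrib_left mult.assoc)
  qed
  have "\<bar>B u v\<bar> \<le> (\<Sum>i\<in>Basis. \<Sum>j\<in>Basis. \<bar>(u \<bullet> i) * (v \<bullet> j) * B i j\<bar>)"
    unfolding ex by (intro order_trans[OF sum_abs] sum_mono sum_abs)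
  also have "\<dots> \<le> (\<Sum>i\<in>Basis. \<Sum>j\<in>Basis. norm u * norm v * \<bar>B i j\<bar>)"
    unfolding abs_mult by (intro sum_mono mult_right_mono mult_mono Basis_le_norm) auto
  also have "\<dots> = (\<Sum>i\<in>Basis. \<Sum>j\<in>Basis. \<bar>B i j\<bar>) * norm u * norm v"
    by (simp add: sum_distrib_left mult_ac)
  finally show ?thesis .
qed

lemma linear_injective_lower_bound:
  fixes A :: "'e::euclidean_space \<Rightarrow> 'e"
  assumes "linear A" "\<And>u. A u = 0 \<Longrightarrow> u = 0"
  obtains l where "0 < l" "\<And>u. l * norm u \<le> norm (A u)"
  using linear_inj_bounded_below_pos[of A] assms linear_injective_0[of A] by metis

text \<open>A unit vector of \<open>G y\<close> has squared Euclidean norm at most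
  \<open>2 / l\<^sup>2\<close>. The weight \<open>l\<^sup>2 / 2\<close> in the comparison with
  \<open>A\<close> is chosen so that \<open>A\<close> carries orthonormal families of
  \<open>G y\<close> to families orthonormal up to \<open>\<epsilon>\<close>.\<close>

lemma (in metric_on) metric_estimates:
  fixes A :: "'e \<Rightarrow> 'e"
  assumes y0: "y0 \<in> U" and A: "linear A" "\<And>u v. A u \<bullet> A v = G y0 u v" and \<epsilon>: "0 < \<epsilon>" "\<epsilon> \<le> 1"
  obtains l b D r where "0 < l" "l \<le> b" "0 \<le> D" "0 < r" "cball y0 r \<subseteq> U"
    "\<And>u. l * norm u \<le> norm (A u)" "\<And>u. norm (A u) \<le> b * norm u"
    "\<And>y u v. y \<in> cball y0 r \<Longrightarrow> \<bar>G y u v - A u \<bullet> A v\<bar> \<le> \<epsilon> * (l\<^sup>2 / 2) * norm u * norm v"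
    "\<And>y u. y \<in> cball y0 r \<Longrightarrow> l\<^sup>2 / 2 * (norm u)\<^sup>2 \<le> G y u u"
    "\<And>y u. y \<in> cball y0 r \<Longrightarrow> G y u u \<le> (2 * b * norm u)\<^sup>2"
    "\<And>y u v h. y \<in> cball y0 r \<Longrightarrow>
       \<bar>frechet_derivative (\<lambda>z. G z u v) (at y) h\<bar> \<le> D * norm u * norm v * norm h"
proof -
  interpret b0: pos_def_form "G y0" using y0 by (rule pos_def)
  have "u = 0" if "A u = 0" for u using A(2)[of u u] that b0.b_eq_0 by simp
  then obtain l where l: "0 < l" "\<And>u. l * norm u \<le> norm (A u)"
    using linear_injective_lower_bound[OF A(1)] by metis
  obtain b0 where b0: "\<And>u. norm (A u) \<le> b0 * norm u"
    using linear_bounded[OF A(1)] by blast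
  define b where "b = max l b0"
  have b: "l \<le> b" "norm (A u) \<le> b * norm u" for u
    using order_trans[OF b0 mult_right_mono[of b0 b "norm u"]] by (auto simp: b_def)
  define F where "F y = (\<Sum>i\<in>Basis. \<Sum>j\<in>Basis. \<bar>G y i j - G y0 i j\<bar>)" for y
  have Gc: "continuous_on U (\<lambda>y. G y u v)" for u v by (rule Ck1_continuous[OF G_Ck1])
  have "continuous_on U F" unfolding F_def by (intro continuous_intros Gc)
  then have "isCont F y0" using y0 open_U by (simp add: continuous_on_eq_continuous_at)
  moreover have "F y0 = 0" by (simp add: F_def)
  moreover have e0: "0 < \<epsilon> * (l\<^sup>2 / 2)" using \<epsilon> l by simp
  ultimately obtain d where d: "d > 0" "\<And>y. dist y y0 < d \<Longrightarrow> \<bar>F y\<bar> < \<epsilon> * (l\<^sup>2 / 2)"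
    unfolding continuous_at_eps_delta by (metis diff_zero dist_real_def)
  obtain r1 where r1: "r1 > 0" "cball y0 r1 \<subseteq> U" using open_U y0 open_contains_cball by blast
  define r where "r = min r1 (d / 2)"
  have r: "0 < r" "cball y0 r \<subseteq> U" using r1 d by (auto simp: r_def)
  define H where "H y = (\<Sum>k\<in>Basis. \<Sum>i\<in>Basis. \<Sum>j\<in>Basis. \<bar>frechet_derivative (\<lambda>z. G z i j) (at y) k\<bar>)" for y
  have "continuous_on (cball y0 r) H" unfolding H_def
    by (intro continuous_intros continuous_on_subset[OF Ck1_continuous_derivative[OF G_Ck1] r(2)])
  then have "bounded (H ` cball y0 r)"
    using compact_continuous_image compact_imp_bounded compact_cball by blast
  then obtain D where "\<forall>x\<in>H ` cball y0 r. norm x \<le> D" unfolding bounded_iff by blast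
  then have D: "\<bar>H y\<bar> \<le> D" if "y \<in> cball y0 r" for y using that by force
  have D0: "0 \<le> D" using D[of y0] r by auto
  show thesis
  proof (rule that[OF l(1) b(1) D0 r l(2) b(2)])
    fix y u v h assume y: "y \<in> cball y0 r"
    then have yU: "y \<in> U" using r by blast
    have "bilinear (\<lambda>u v. G y u v - G y0 u v)"
      using G_bilinear[OF yU] b0.bil unfolding bilinear_def by (auto intro: linear_compose_sub)
    from bilinear_bound_Basis[OF this]
    have "\<bar>G y u v - A u \<bullet> A v\<bar> \<le> F y * norm u * norm v" for u v :: 'e unfolding A(2) F_def .
    moreover have "F y \<le> \<epsilon> * (l\<^sup>2 / 2)"
      using d(2)[of y] y d(1) by (force simp: r_def dist_commute)
    ultimately have dG: "\<bar>G y u v - A u \<bullet> A v\<bar> \<le> \<epsilon> * (l\<^sup>2 / 2) * norm u * norm v" for u v :: 'e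
      by (meson mult_right_mono norm_ge_zero order_trans)
    then show "\<bar>G y u v - A u \<bullet> A v\<bar> \<le> \<epsilon> * (l\<^sup>2 / 2) * norm u * norm v" .
    have "\<epsilon> * (l\<^sup>2 / 2) * norm u * norm u \<le> 1 * (l\<^sup>2 / 2) * norm u * norm u"
      using \<epsilon> by (intro mult_right_mono) auto
    then have du: "\<bar>G y u u - A u \<bullet> A u\<bar> \<le> l\<^sup>2 / 2 * (norm u)\<^sup>2"
      using dG[of u u] by (simp add: power2_eq_square)
    have "(l * norm u)\<^sup>2 \<le> (norm (A u))\<^sup>2" using l by (intro power_mono) auto
    then show "l\<^sup>2 / 2 * (norm u)\<^sup>2 \<le> G y u u"
      using du unfolding dot_square_norm[of "A u"] power_mult_distrib by linarith
    have "(norm (A u))\<^sup>2 \<le> (b * norm u)\<^sup>2" by (intro power_mono b) auto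
    moreover have "l\<^sup>2 * (norm u)\<^sup>2 \<le> b\<^sup>2 * (norm u)\<^sup>2" using b(1) l(1) by (intro mult_right_mono power_mono) auto
    moreover have "0 \<le> b\<^sup>2 * (norm u)\<^sup>2" by simp
    ultimately show "G y u u \<le> (2 * b * norm u)\<^sup>2"
      using du unfolding dot_square_norm[of "A u"] power_mult_distrib by (simp only: power2_eq_square[of 2])
    define T where "T u v h = frechet_derivative (\<lambda>z. G z u v) (at y) h" for u v h :: 'e
    have Td: "(\<lambda>z. G z u v) differentiable (at y)" for u v :: 'e using G_Ck1 yU by (auto simp: Ck1_iff)
    have Tbil: "bilinear (\<lambda>u v. T u v h)" for h :: 'e
      unfolding bilinear_def T_def
    proof (intro conjI allI)
      show "linear (\<lambda>v. frechet_derivative (\<lambda>z. G z u v) (at y) h)" for u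
        by (rule Ck1_family_derivative_linear[OF open_U yU _ Td]) (rule bilinear_linear2[OF G_bilinear])
      show "linear (\<lambda>u. frechet_derivative (\<lambda>z. G z u v) (at y) h)" for v
        by (rule Ck1_family_derivative_linear[where T = "\<lambda>z u. G z u v", OF open_U yU _ Td]) (rule bilinear_linear1[OF G_bilinear])
    qed
    have Tlin: "linear (T u v)" for u v :: 'e
      unfolding T_def using Td frechet_derivative_works has_derivative_linear by blast
    have "T u v h = T u v (\<Sum>k\<in>Basis. (h \<bullet> k) *\<^sub>R k)" by (simp add: euclidean_representation)
    also have "\<dots> = (\<Sum>k\<in>Basis. (h \<bullet> k) * T u v k)"
      by (simp add: linear_sum[OF Tlin] linear_cmul[OF Tlin])
    finally have "\<bar>T u v h\<bar> \<le> (\<Sum>k\<in>Basis. \<bar>h \<bullet> k\<bar> * \<bar>T u v k\<bar>)"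
      by (metis (no_types, lifting) abs_mult sum.cong sum_abs)
    also have "\<dots> \<le> (\<Sum>k\<in>Basis. norm h * ((\<Sum>i\<in>Basis. \<Sum>j\<in>Basis. \<bar>T i j k\<bar>) * norm u * norm v))"
      by (intro sum_mono mult_mono Basis_le_norm bilinear_bound_Basis[OF Tbil]) auto
    also have "\<dots> = H y * (norm u * norm v * norm h)"
      by (simp add: H_def T_def sum_distrib_left sum_distrib_right mult_ac)
    also have "\<dots> \<le> D * (norm u * norm v * norm h)"
      using D[OF y] by (intro mult_right_mono) auto
    finally show "\<bar>frechet_derivative (\<lambda>z. G z u v) (at y) h\<bar> \<le> D * norm u * norm v * norm h"
      by (simp add: T_def mult.assoc)
  qed
qed

section \<open>The barrier field\<close>

lemma (in pos_def_form) orthonormal_basis_of_subspace_exists: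
  assumes L: "subspace L"
  shows "\<exists>B. orthonormal_basis_of b L B"
proof (cases "L = {0}")
  case True
  then have "orthonormal_basis_of b L {}" by (simp add: orthonormal_basis_of_def)
  then show ?thesis by blast
next
  case False
  then obtain x where x: "x \<in> L" "x \<noteq> 0" using subspace_0[OF L] by blast
  have "inverse (sqrt (b x x)) *\<^sub>R x \<in> L" using x L by (simp add: subspace_scale)
  moreover have "b (inverse (sqrt (b x x)) *\<^sub>R x) (inverse (sqrt (b x x)) *\<^sub>R x) = 1"
    using pos[OF x(2)] by (simp add: b_simps flip: mult.assoc inverse_mult_distrib)
  ultimately show ?thesis using orthonormal_basis_exists[OF L] by blast
qed

text \<open>With exponent at least 2 the derivative contains a positive power of
  \<open>max 0 x\<close> and is therefore continuous across \<open>0\<close>.\<close>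

lemma pos_power_has_derivative:
  assumes "2 \<le> n"
  shows "((\<lambda>x::real. max 0 x ^ n) has_real_derivative real n * max 0 x ^ (n - 1)) (at x)"
proof (cases x "0::real" rule: linorder_cases)
  case less
  have "((\<lambda>x::real. 0) has_real_derivative 0) (at x)" by simp
  then have "((\<lambda>x::real. max 0 x ^ n) has_real_derivative 0) (at x)"
    by (rule has_field_derivative_transform_within_open[of _ _ _ "{..<0}"]) (use less assms in \<open>auto simp: max_def\<close>)
  then show ?thesis using less assms by (simp add: max_absorb1 power_0_left)
next
  case greater
  have "((\<lambda>x. x ^ n) has_real_derivative real n * x ^ (n - 1)) (at x)"
    using DERIV_pow[of n x] by (simp add: One_nat_def)
  then have "((\<lambda>x::real. max 0 x ^ n) has_real_derivative real n * x ^ (n - 1)) (at x)"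
    by (rule has_field_derivative_transform_within_open[of _ _ _ "{0<..}"]) (use greater in \<open>auto simp: max_def\<close>)
  then show ?thesis using greater by (simp add: max_absorb2)
next
  case equal
  have "((\<lambda>h::real. max 0 h ^ n / h) \<longlongrightarrow> 0) (at 0)"
  proof (rule Lim_null_comparison[of _ "\<lambda>h. \<bar>h\<bar> ^ (n - 1)"])
    have "norm (max 0 h ^ n / h) \<le> \<bar>h\<bar> ^ (n - 1)" for h :: real
      using assms power_minus_mult[of n h] by (cases "h \<le> 0") (auto simp: max_def power_diff field_simps)
    then show "\<forall>\<^sub>F h::real in at 0. norm (max 0 h ^ n / h) \<le> \<bar>h\<bar> ^ (n - 1)" by simp
    have "((\<lambda>h::real. \<bar>h\<bar> ^ (n - 1)) \<longlongrightarrow> \<bar>0\<bar> ^ (n - 1)) (at 0)" by (intro tendsto_intros)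
    moreover have "\<bar>0::real\<bar> ^ (n - 1) = 0" using assms by (simp add: power_0_left)
    ultimately show "((\<lambda>h::real. \<bar>h\<bar> ^ (n - 1)) \<longlongrightarrow> 0) (at 0)" by (simp only:)
  qed
  then show ?thesis using equal assms by (simp add: has_field_derivative_iff power_0_left)
qed

context subspace_split begin

lemma bounded_linear_P: "bounded_linear P" and bounded_linear_Q: "bounded_linear Q"
  using linear_P linear_Q linear_conv_bounded_linear by auto

lemma P_adjoint: "P y \<bullet> x = P x \<bullet> y"
  using P_inner_P[of x y] P_inner_P[of y x] inner_commute[of "P x" "P y"] by simp

lemma Q_adjoint: "Q y \<bullet> x = Q x \<bullet> y"
  using Q_inner_Q[of x y] Q_inner_Q[of y x] inner_commute[of "Q x" "Q y"] by simp

lemma P_square_has_derivative: "((\<lambda>x. P x \<bullet> P x) has_derivative (\<lambda>h. 2 * (P x \<bullet> h))) (at x)"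
  by (rule has_derivative_eq_rhs, rule has_derivative_inner[OF bounded_linear_imp_has_derivative[OF bounded_linear_P]
        bounded_linear_imp_has_derivative[OF bounded_linear_P]])
    (rule ext, simp only: P_inner_P P_adjoint[of _ x] mult_2)

lemma Q_square_has_derivative: "((\<lambda>x. Q x \<bullet> Q x) has_derivative (\<lambda>h. 2 * (Q x \<bullet> h))) (at x)"
  by (rule has_derivative_eq_rhs, rule has_derivative_inner[OF bounded_linear_imp_has_derivative[OF bounded_linear_Q]
        bounded_linear_imp_has_derivative[OF bounded_linear_Q]])
    (rule ext, simp only: Q_inner_Q Q_adjoint[of _ x] mult_2)

lemma barrier_has_derivative: "(barrier C has_derivative barrier' C x) (at x)"
  unfolding barrier_def[abs_def]
  by (rule has_derivative_eq_rhs, (rule derivative_intros P_square_has_derivative Q_square_has_derivative)+)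
    (simp add: fun_eq_iff barrier'_def algebra_simps power2_eq_square)

lemma barrier'_has_derivative:
  "((\<lambda>x. barrier' C x e) has_derivative (\<lambda>h. - 2 * (P h \<bullet> e)
      + (2 * C - 4 * C\<^sup>2 * (Q x \<bullet> Q x)) * (Q h \<bullet> e) - 8 * C\<^sup>2 * (Q x \<bullet> h) * (Q x \<bullet> e))) (at x)"
proof -
  have P': "((\<lambda>x. P x \<bullet> e) has_derivative (\<lambda>h. P h \<bullet> e)) (at x)"
    and Q': "((\<lambda>x. Q x \<bullet> e) has_derivative (\<lambda>h. Q h \<bullet> e)) (at x)"
    by (intro has_derivative_inner_left bounded_linear_imp_has_derivative bounded_linear_P bounded_linear_Q)+
  show ?thesis unfolding barrier'_def
    by (rule has_derivative_eq_rhs, (rule derivative_intros P' Q' Q_square_has_derivative)+)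
      (simp add: fun_eq_iff algebra_simps)
qed

lemma barrier''_eq:
  "- 2 * (P e \<bullet> e) + (2 * C - 4 * C\<^sup>2 * (Q x \<bullet> Q x)) * (Q e \<bullet> e) - 8 * C\<^sup>2 * (Q x \<bullet> e) * (Q x \<bullet> e)
     = barrier'' C x e"
  by (simp add: barrier''_def P_inner_P Q_inner_Q power2_eq_square)

lemma linear_barrier': "linear (barrier' C x)"
  unfolding barrier'_def by (rule linearI) (simp_all add: inner_simps algebra_simps)

lemma barrier''_scale: "barrier'' C x (c *\<^sub>R e) = c\<^sup>2 * barrier'' C x e"
  by (simp add: barrier''_def linear_cmul[OF linear_P] linear_cmul[OF linear_Q] power2_eq_square algebra_simps)

lemma Ck1_barrier: "Ck_on 1 S (barrier C)"
proof (rule Ck1I[OF barrier_has_derivative])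
  show "continuous_on S (\<lambda>x. barrier' C x v)" for v
    using barrier'_has_derivative has_derivative_continuous
    by (intro continuous_at_imp_continuous_on) blast
qed

lemma Ck1_barrier': "Ck_on 1 S (\<lambda>x. barrier' C x e)"
  by (rule Ck1I[OF barrier'_has_derivative])
    (intro continuous_intros linear_continuous_on bounded_linear_P bounded_linear_Q)

lemma barrier'_bound:
  assumes "P x \<bullet> P x \<le> 4" "Q x \<bullet> Q x \<le> 1" "0 \<le> C" "2 * C * (Q x \<bullet> Q x) \<le> 2"
  shows "\<bar>barrier' C x e\<bar> \<le> (4 + 2 * C) * norm e"
proof -
  have n: "norm (P x) \<le> 2" "norm (Q x) \<le> 1"
    using assms(1,2) power2_le_imp_le[of "norm (P x)" 2] power2_le_imp_le[of "norm (Q x)" 1]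
    by (auto simp: power2_norm_eq_inner)
  have a: "\<bar>2 * C - 4 * C\<^sup>2 * (Q x \<bullet> Q x)\<bar> \<le> 2 * C"
    using mult_right_mono[OF assms(4), of "2 * C"] assms(3)
    by (auto simp: abs_le_iff power2_eq_square algebra_simps)
  have "\<bar>barrier' C x e\<bar> \<le> 2 * \<bar>P x \<bullet> e\<bar> + \<bar>2 * C - 4 * C\<^sup>2 * (Q x \<bullet> Q x)\<bar> * \<bar>Q x \<bullet> e\<bar>"
    unfolding barrier'_def abs_mult[symmetric] by (rule order_trans[OF abs_triangle_ineq]) (simp add: abs_mult)
  also have "\<dots> \<le> 2 * (2 * norm e) + 2 * C * (1 * norm e)"
  proof (intro add_mono mult_mono a)
    show "\<bar>P x \<bullet> e\<bar> \<le> 2 * norm e" "\<bar>Q x \<bullet> e\<bar> \<le> 1 * norm e"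
      using Cauchy_Schwarz_ineq2[of "P x" e] Cauchy_Schwarz_ineq2[of "Q x" e] n
      by (meson mult_right_mono norm_ge_zero order_trans)+
  qed (use assms in auto)
  finally show ?thesis by (simp add: algebra_simps)
qed

text \<open>Complete the square in \<open>C * (Q x \<bullet> Q x)\<close>.\<close>

lemma barrier_le: "barrier C x \<le> 1 / 4 - P x \<bullet> P x"
proof -
  have "0 \<le> (C * (Q x \<bullet> Q x) - 1 / 2)\<^sup>2" by simp
  then show ?thesis by (simp add: barrier_def power2_eq_square algebra_simps)
qed

text \<open>For \<open>c = C * (Q x \<bullet> Q x)\<close> the hypothesis gives
  \<open>c - c * c > - 3 / 2\<close>. This crudely excludes \<open>c \<ge> 12\<close>, and dividing
  by \<open>C \<ge> 12\<close> bounds the normal part.\<close>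

lemma barrier_support:
  assumes "- 3 / 2 < barrier C x" "12 \<le> C"
  shows "P x \<bullet> P x < 7 / 4" "Q x \<bullet> Q x \<le> 1"
proof -
  show "P x \<bullet> P x < 7 / 4" using assms barrier_le[of C x] by simp
  define t c where "t = P x \<bullet> P x" and "c = C * (Q x \<bullet> Q x)"
  have "0 \<le> t" by (simp add: t_def)
  then have "- 3 / 2 < c - c * c"
    using assms(1) by (simp add: barrier_def t_def[symmetric] c_def power2_eq_square algebra_simps)
  moreover have "12 * c \<le> c * c" if "12 \<le> c" using that by (intro mult_right_mono) auto
  ultimately have "c < 12" by linarith
  then have "C * (Q x \<bullet> Q x) < 12" by (simp add: c_def)
  moreover have "12 * (Q x \<bullet> Q x) \<le> C * (Q x \<bullet> Q x)" using assms by (intro mult_right_mono) auto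
  ultimately show "Q x \<bullet> Q x \<le> 1" by simp
qed

end

text \<open>In the application \<open>A\<close> makes the metric at the base point Euclidean,
  \<open>a\<close> is the centre, \<open>s\<close> is the inverse of the radius, and
  \<open>Y\<close> is the metric gradient of the rescaled barrier. \<open>L\<close> is then the
  image of the tangent plane under \<open>A\<close>.\<close>

locale barrier_setup = metric_on U G + subspace_split L B
  for U :: "'e::euclidean_space set" and G :: "'e \<Rightarrow> 'e \<Rightarrow> 'e \<Rightarrow> real" and L B :: "'e set" +
  fixes A :: "'e \<Rightarrow> 'e" and a :: 'e and s :: real and Y :: "'e \<Rightarrow> 'e" and k :: nat and C :: real
  assumes linA: "linear A" and s: "0 < s" and Y: "Ck_on 1 U Y"
    and grad: "z \<in> U \<Longrightarrow> G z (Y z) u = barrier' C (s *\<^sub>R A (z - a)) (s *\<^sub>R A u)"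
    and k: "k = 4 * dim L + 3" and C: "C = 4 * real k"
begin

lemma k_ge: "3 \<le> k" using k by simp

definition X :: "'e \<Rightarrow> 'e" where "X y = s *\<^sub>R A (y - a)"

definition v :: "'e \<Rightarrow> real" where "v y = barrier C (X y)"

definition \<phi> :: "real \<Rightarrow> real" where "\<phi> x = max 0 (x + 3 / 2) ^ k"

definition w :: "'e \<Rightarrow> 'e" where "w y = \<phi> (v y) *\<^sub>R Y y"

lemma X_has_derivative: "(X has_derivative (\<lambda>u. s *\<^sub>R A u)) (at y)"
proof -
  have bl: "bounded_linear A" using linA linear_conv_bounded_linear by blast
  have "((\<lambda>y. y - a) has_derivative (\<lambda>u. u)) (at y)" by (auto intro!: derivative_eq_intros)
  from has_derivative_scaleR_right[OF bounded_linear.has_derivative[OF bl this], of s] show ?thesis by (simp add: X_def[abs_def])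
qed

lemma v_has_derivative: "(v has_derivative (\<lambda>u. barrier' C (X y) (s *\<^sub>R A u))) (at y)"
  using has_derivative_compose[OF X_has_derivative barrier_has_derivative] by (simp add: v_def[abs_def])

lemma v_continuous: "continuous_on S v"
  using v_has_derivative has_derivative_continuous by (intro continuous_at_imp_continuous_on) blast

lemma X_continuous: "continuous_on S X"
  using X_has_derivative has_derivative_continuous by (intro continuous_at_imp_continuous_on) blast

lemma \<phi>_has_derivative: "(\<phi> has_real_derivative real k * max 0 (x + 3 / 2) ^ (k - 1)) (at x)"
proof -
  have "((\<lambda>x::real. x + 3 / 2) has_real_derivative 1) (at x)" by (auto intro!: derivative_eq_intros)
  from DERIV_chain2[OF pos_power_has_derivative this] k_ge show ?thesis by (simp add: \<phi>_def[abs_def])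
qed

lemma \<phi>_nonneg: "0 \<le> \<phi> x" by (simp add: \<phi>_def)

lemma \<phi>_eq_0: "\<phi> x = 0 \<longleftrightarrow> x \<le> - 3 / 2"
  using k_ge by (auto simp: \<phi>_def max_def)

text \<open>The base \<open>x + 3 / 2\<close> is at most 1, so lowering the exponent enlarges the
  power: \<open>\<phi>\<close> is dominated by its derivative divided by \<open>k\<close>, and the
  squared differential enters with the full weight \<open>k\<close>.\<close>

lemma \<phi>'_lower_bound: "x \<le> - 1 / 2 \<Longrightarrow> \<phi> x \<le> max 0 (x + 3 / 2) ^ (k - 1)"
  unfolding \<phi>_def using k by (intro power_decreasing) auto

lemma Ck1_w: "Ck_on 1 U w"
proof -
  have \<phi>: "Ck_on 1 UNIV \<phi>"
    by (rule Ck1_real[OF \<phi>_has_derivative]) (intro continuous_intros)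
  have "continuous_on U (\<lambda>x. s *\<^sub>R A u)" for u by (rule continuous_on_const)
  from Ck1I[OF X_has_derivative this] have "Ck_on 1 U X" .
  from Ck1_compose[OF this Ck1_barrier[of UNIV] subset_UNIV]
  have "Ck_on 1 U v" by (simp add: v_def[abs_def])
  from Ck1_bilinear[OF bounded_bilinear_scaleR Ck1_compose[OF this \<phi> subset_UNIV] Y]
  show ?thesis by (simp add: w_def[abs_def])
qed

lemma lie_form_w:
  assumes y: "y \<in> U"
  shows "lie_form G w y e = real k * max 0 (v y + 3 / 2) ^ (k - 1) * (s * barrier' C (X y) (A e))\<^sup>2
    + \<phi> (v y) * (s\<^sup>2 * barrier'' C (X y) (A e)
       - frechet_derivative (\<lambda>z. G z (Y y) e) (at y) e + frechet_derivative (\<lambda>z. G z e e) (at y) (Y y) / 2)"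
proof -
  have g: "G z (Y z) u = barrier' C (X z) (s *\<^sub>R A u)" if "z \<in> U" for z u
    using grad[OF that] by (simp add: X_def)
  have d: "((\<lambda>z. barrier' C (X z) (s *\<^sub>R A e)) has_derivative (\<lambda>h. - 2 * (P (s *\<^sub>R A h) \<bullet> (s *\<^sub>R A e))
      + (2 * C - 4 * C\<^sup>2 * (Q (X y) \<bullet> Q (X y))) * (Q (s *\<^sub>R A h) \<bullet> (s *\<^sub>R A e))
      - 8 * C\<^sup>2 * (Q (X y) \<bullet> (s *\<^sub>R A h)) * (Q (X y) \<bullet> (s *\<^sub>R A e)))) (at y)"
    by (rule has_derivative_compose[OF X_has_derivative barrier'_has_derivative])
  have "lie_form G (\<lambda>z. \<phi> (v z) *\<^sub>R Y z) y e
    = real k * max 0 (v y + 3 / 2) ^ (k - 1) * (barrier' C (X y) (s *\<^sub>R A e))\<^sup>2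
      + \<phi> (v y) * ((- 2 * (P (s *\<^sub>R A e) \<bullet> (s *\<^sub>R A e))
      + (2 * C - 4 * C\<^sup>2 * (Q (X y) \<bullet> Q (X y))) * (Q (s *\<^sub>R A e) \<bullet> (s *\<^sub>R A e))
      - 8 * C\<^sup>2 * (Q (X y) \<bullet> (s *\<^sub>R A e)) * (Q (X y) \<bullet> (s *\<^sub>R A e)))
      - frechet_derivative (\<lambda>z. G z (Y y) e) (at y) e + frechet_derivative (\<lambda>z. G z e e) (at y) (Y y) / 2)"
    by (rule lie_form_gradient[where \<omega> = "\<lambda>z u. barrier' C (X z) (s *\<^sub>R A u)", OF y Y g v_has_derivative d \<phi>_has_derivative])
  then show ?thesis
    by (simp only: w_def[abs_def] barrier''_eq barrier''_scale linear_cmul[OF linear_barrier'] real_scaleR_def)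
qed

lemma lie_form_zero: "y \<in> U \<Longrightarrow> \<phi> (v y) = 0 \<Longrightarrow> lie_form G w y e = 0"
  using k_ge by (simp add: lie_form_w \<phi>_eq_0 max_absorb1 power_0_left)

text \<open>\<open>barrier_trace\<close> supplies \<open>2 * s\<^sup>2\<close>. Metric derivatives
  and \<open>h\<close> cost only multiples of \<open>s\<close>, since \<open>Y\<close> is of order
  \<open>s\<close>; by \<open>sK\<close> one of the two units pays for them.\<close>

lemma barrier_estimate:
  assumes y: "y \<in> U" and l: "0 < l" and D: "0 \<le> D" and h: "0 \<le> h"
    and Ab: "\<And>u. norm (A u) \<le> b * norm u"
    and GA: "\<And>u v. \<bar>G y u v - A u \<bullet> A v\<bar> \<le> \<epsilon> * (l\<^sup>2 / 2) * norm u * norm v"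
    and Gl: "\<And>u. l\<^sup>2 / 2 * (norm u)\<^sup>2 \<le> G y u u"
    and Gb: "\<And>u. G y u u \<le> (2 * b * norm u)\<^sup>2"
    and GD: "\<And>u v h. \<bar>frechet_derivative (\<lambda>z. G z u v) (at y) h\<bar> \<le> D * norm u * norm v * norm h"
    and \<epsilon>: "0 \<le> \<epsilon>" "3 * (real (dim L) + 1)\<^sup>2 * \<epsilon> \<le> 1"
    and t: "3 / 4 \<le> P (X y) \<bullet> P (X y)" "P (X y) \<bullet> P (X y) \<le> 2"
    and n: "8 * C\<^sup>2 * (real k + 2) * (Q (X y) \<bullet> Q (X y)) \<le> 1"
    and I: "finite I" "card I = dim L" "\<And>e f. e \<in> I \<Longrightarrow> f \<in> I \<Longrightarrow> G y e f = (if e = f then 1 else 0)"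
    and K: "K = 2 / l\<^sup>2 * (4 + 2 * C) * b"
    and sK: "real (dim L) * (3 * D / l\<^sup>2) * K + h * (2 * b * K) \<le> s"
  shows "\<phi> (v y) * s\<^sup>2 \<le> (\<Sum>e\<in>I. lie_form G w y e) - h * sqrt (G y (w y) (w y))"
proof -
  interpret pos_def_form "G y" using y by (rule pos_def)
  have k3: "3 \<le> real k" and C12: "12 \<le> C" using k C by auto
  have b0: "0 \<le> b"
  proof -
    obtain i :: 'e where "i \<in> Basis" using nonempty_Basis by blast
    then have "norm (A i) \<le> b" using Ab[of i] by simp
    then show ?thesis using norm_ge_zero order_trans by blast
  qed
  have l2: "0 < l\<^sup>2" using l by simp
  have e2: "(norm e)\<^sup>2 \<le> 2 / l\<^sup>2" if "e \<in> I" for e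
    using Gl[of e] I(3)[OF that that] l2 by (simp add: field_simps)
  have ef: "norm e * norm f \<le> 2 / l\<^sup>2" if "e \<in> I" "f \<in> I" for e f
  proof -
    have "0 \<le> (norm e - norm f)\<^sup>2" by simp
    then have "2 * (norm e * norm f) \<le> (norm e)\<^sup>2 + (norm f)\<^sup>2" by (simp add: power2_eq_square algebra_simps)
    then show ?thesis using e2[OF that(1)] e2[OF that(2)] by linarith
  qed
  have near: "\<bar>A e \<bullet> A f - (if e = f then 1 else 0)\<bar> \<le> \<epsilon>" if "e \<in> I" "f \<in> I" for e f
  proof -
    have "\<bar>A e \<bullet> A f - (if e = f then 1 else 0)\<bar> \<le> \<epsilon> * (l\<^sup>2 / 2) * (norm e * norm f)"
      using GA[of e f] I(3)[OF that] by (simp add: abs_minus_commute mult.assoc)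
    also have "\<dots> \<le> \<epsilon> * (l\<^sup>2 / 2) * (2 / l\<^sup>2)"
      by (intro mult_left_mono ef that) (use \<epsilon> in simp)
    finally show ?thesis using l2 by simp
  qed
  have n1: "C * (C * (Q (X y) \<bullet> Q (X y))) \<le> 1 / 8" "Q (X y) \<bullet> Q (X y) \<le> 1" "2 * C * (Q (X y) \<bullet> Q (X y)) \<le> 2"
  proof -
    define N where "N = Q (X y) \<bullet> Q (X y)"
    have N: "0 \<le> N" by (simp add: N_def)
    have "8 * (C * (C * N)) * 1 \<le> 8 * (C * (C * N)) * (real k + 2)"
      using N C12 k3 by (intro mult_left_mono) auto
    then show 1: "C * (C * (Q (X y) \<bullet> Q (X y))) \<le> 1 / 8"
      using n by (simp add: N_def power2_eq_square algebra_simps)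
    have 2: "C * N \<le> C * (C * N)"
      using mult_right_mono[of 1 C "C * N"] C12 N by simp
    then show "2 * C * (Q (X y) \<bullet> Q (X y)) \<le> 2" using 1 by (simp add: N_def)
    have "N \<le> C * N" using mult_right_mono[of 1 C N] C12 N by simp
    then show "Q (X y) \<bullet> Q (X y) \<le> 1" using 1 2 by (simp add: N_def)
  qed
  \<comment> \<open>Test the gradient with itself: ellipticity from below, the bound on
    \<open>barrier'\<close> from above, then cancel one factor \<open>norm (Y y)\<close>.\<close>
  have Yn: "norm (Y y) \<le> K * s"
  proof (cases "Y y = 0")
    case False
    have "l\<^sup>2 / 2 * (norm (Y y))\<^sup>2 \<le> G y (Y y) (Y y)" by (rule Gl)
    also have "\<dots> = barrier' C (X y) (s *\<^sub>R A (Y y))" using grad[OF y] by (simp add: X_def)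
    also have "\<dots> \<le> (4 + 2 * C) * norm (s *\<^sub>R A (Y y))"
      using barrier'_bound[of "X y" C "s *\<^sub>R A (Y y)"] t n1 C12 by (simp add: abs_le_iff)
    also have "\<dots> \<le> (4 + 2 * C) * (s * (b * norm (Y y)))"
      using Ab[of "Y y"] s C12 by (intro mult_left_mono) auto
    finally have "(l\<^sup>2 / 2 * norm (Y y)) * norm (Y y) \<le> ((4 + 2 * C) * s * b) * norm (Y y)"
      by (simp add: power2_eq_square mult_ac)
    then have "l\<^sup>2 / 2 * norm (Y y) \<le> (4 + 2 * C) * s * b"
      using False by (simp add: mult_le_cancel_right)
    then show ?thesis using l2 by (simp add: K field_simps)
  next
    case True
    then show ?thesis using s l2 b0 C12 by (simp add: K)
  qed
  define S1 S2 where "S1 = (\<Sum>e\<in>I. (barrier' C (X y) (A e))\<^sup>2)" and "S2 = (\<Sum>e\<in>I. barrier'' C (X y) (A e))"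
  have trace: "2 \<le> real k * S1 + S2"
    unfolding S1_def S2_def
    by (rule barrier_trace[OF I(1,2) \<epsilon> near]) (use k C t n in auto)
  have \<phi>0: "0 \<le> \<phi> (v y)" by (rule \<phi>_nonneg)
  have v: "v y \<le> - 1 / 2" unfolding v_def using barrier_le[of C "X y"] t by simp
  have S10: "0 \<le> S1" unfolding S1_def by (intro sum_nonneg) auto
  \<comment> \<open>Each metric derivative is at most \<open>D * (2 / l\<^sup>2) * (K * s)\<close>,
    and the second one enters halved: together three halves of this.\<close>
  define R where "R = 3 * D / l\<^sup>2 * (K * s)"
  have lower: "\<phi> (v y) * real k * s\<^sup>2 * (barrier' C (X y) (A e))\<^sup>2 + \<phi> (v y) * s\<^sup>2 * barrier'' C (X y) (A e) - \<phi> (v y) * R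
      \<le> lie_form G w y e" if e: "e \<in> I" for e
  proof -
    define d1 d2 where "d1 = frechet_derivative (\<lambda>z. G z (Y y) e) (at y) e"
      and "d2 = frechet_derivative (\<lambda>z. G z e e) (at y) (Y y)"
    have "D * (norm e)\<^sup>2 * norm (Y y) \<le> D * (2 / l\<^sup>2) * (K * s)"
      using e2[OF e] D Yn by (intro mult_mono) auto
    then have "\<bar>d1\<bar> \<le> D * (2 / l\<^sup>2) * (K * s)" "\<bar>d2\<bar> \<le> D * (2 / l\<^sup>2) * (K * s)"
      using GD[of "Y y" e e] GD[of e e "Y y"] by (simp_all add: d1_def d2_def power2_eq_square mult_ac)
    then have "- R \<le> - d1 + d2 / 2" by (simp add: R_def)
    then have "\<phi> (v y) * (s\<^sup>2 * barrier'' C (X y) (A e) - R) \<le> \<phi> (v y) * (s\<^sup>2 * barrier'' C (X y) (A e) - d1 + d2 / 2)"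
      by (intro mult_left_mono \<phi>0) simp
    moreover have "real k * \<phi> (v y) * (s * barrier' C (X y) (A e))\<^sup>2
        \<le> real k * max 0 (v y + 3 / 2) ^ (k - 1) * (s * barrier' C (X y) (A e))\<^sup>2"
      by (intro mult_right_mono mult_left_mono \<phi>'_lower_bound v) auto
    ultimately show ?thesis
      unfolding lie_form_w[OF y] d1_def[symmetric] d2_def[symmetric]
      by (simp add: power_mult_distrib algebra_simps)
  qed
  have "\<phi> (v y) * s\<^sup>2 * (real k * S1 + S2) - \<phi> (v y) * (real (dim L) * R)
     = (\<Sum>e\<in>I. \<phi> (v y) * real k * s\<^sup>2 * (barrier' C (X y) (A e))\<^sup>2 + \<phi> (v y) * s\<^sup>2 * barrier'' C (X y) (A e) - \<phi> (v y) * R)"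
    using I(2) by (simp add: S1_def S2_def sum_subtractf sum.distrib sum_distrib_left algebra_simps)
  also have "\<dots> \<le> (\<Sum>e\<in>I. lie_form G w y e)" by (rule sum_mono) (rule lower)
  finally have sum_ge: "\<phi> (v y) * s\<^sup>2 * (real k * S1 + S2) - \<phi> (v y) * (real (dim L) * R) \<le> (\<Sum>e\<in>I. lie_form G w y e)" .
  have "\<phi> (v y) * s\<^sup>2 * 2 \<le> \<phi> (v y) * s\<^sup>2 * (real k * S1 + S2)"
    using trace \<phi>0 by (intro mult_left_mono) auto
  moreover have "sqrt (G y (w y) (w y)) \<le> \<phi> (v y) * (2 * b * (K * s))"
  proof -
    have "G y (w y) (w y) = (\<phi> (v y))\<^sup>2 * G y (Y y) (Y y)" by (simp add: w_def b_simps power2_eq_square)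
    also have "\<dots> \<le> (\<phi> (v y))\<^sup>2 * (2 * b * norm (Y y))\<^sup>2" by (intro mult_left_mono Gb) auto
    also have "\<dots> = (\<phi> (v y) * (2 * b * norm (Y y)))\<^sup>2" by (simp add: power_mult_distrib)
    finally have "sqrt (G y (w y) (w y)) \<le> \<phi> (v y) * (2 * b * norm (Y y))"
      using \<phi>0 b0 by (intro real_le_lsqrt) (auto simp: b_nonneg)
    also have "\<dots> \<le> \<phi> (v y) * (2 * b * (K * s))" using \<phi>0 b0 Yn by (intro mult_left_mono) auto
    finally show ?thesis .
  qed
  then have "h * sqrt (G y (w y) (w y)) \<le> h * (\<phi> (v y) * (2 * b * (K * s)))" using h by (rule mult_left_mono)
  moreover have "\<phi> (v y) * s * (real (dim L) * (3 * D / l\<^sup>2) * K + h * (2 * b * K)) \<le> \<phi> (v y) * s * s"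
    using sK \<phi>0 s by (intro mult_left_mono) auto
  ultimately show ?thesis using sum_ge by (simp add: R_def power2_eq_square algebra_simps)
qed

end

text \<open>
  The centre \<open>a\<close> is a point of \<open>M - Z\<close> near \<open>y0\<close>, and \<open>\<rho>\<close> is the radius of the largest cylinder around
  \<open>a\<close> that avoids \<open>Z\<close>.  Since \<open>Z\<close> lies in a thin cone around the tangent plane, it can meet the
  support of the field only where the estimate for the barrier applies.
\<close>

lemma (in metric_on) barrier_field_exists:
  fixes Z M L :: "'e set" and h :: real
  assumes y0: "y0 \<in> U" "y0 \<in> Z" and Z: "closedin (top_of_set U) Z" "Z \<subseteq> M"
    and frontier: "\<And>d. 0 < d \<Longrightarrow> \<exists>a\<in>M - Z. dist a y0 < d"
    and L: "subspace L"
    and cone: "\<And>\<eta>. 0 < \<eta> \<Longrightarrow> \<exists>r>0. \<forall>y\<in>M \<inter> ball y0 r. \<forall>y'\<in>M \<inter> ball y0 r.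
        \<exists>u\<in>L. norm (y - y' - u) \<le> \<eta> * norm (y - y')"
    and h: "0 \<le> h"
  obtains w K Ob Bad c where
    "Ck_on 1 U w" "compact K" "K \<subseteq> U" "\<And>y. y \<in> U \<Longrightarrow> y \<notin> K \<Longrightarrow> w y = 0"
    "open Ob" "Ob \<subseteq> U" "Ob \<inter> Z \<noteq> {}" "0 < c" "compact Bad" "Bad \<subseteq> U" "Bad \<inter> Z = {}"
    "\<And>y I. y \<in> U \<Longrightarrow> y \<notin> Bad \<Longrightarrow> finite I \<Longrightarrow> card I = dim L \<Longrightarrow>
       (\<And>e f. e \<in> I \<Longrightarrow> f \<in> I \<Longrightarrow> G y e f = (if e = f then 1 else 0)) \<Longrightarrow>
       (if y \<in> Ob then c else 0) \<le> (\<Sum>e\<in>I. lie_form G w y e) - h * sqrt (G y (w y) (w y))"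
proof -
  obtain A :: "'e \<Rightarrow> 'e" where A: "linear A" "\<And>u v. A u \<bullet> A v = G y0 u v"
    using pos_def_form.inner_representation[OF pos_def[OF y0(1)]] by blast
  define m where "m = dim L"
  define k where "k = 4 * m + 3"
  define C where "C = 4 * real k"
  \<comment> \<open>\<open>n0\<close> and \<open>\<epsilon>\<close> are the largest values that
    \<open>barrier_trace\<close> tolerates for the normal square and for the defect of
    orthonormality.\<close>
  define n0 where "n0 = 1 / (8 * C\<^sup>2 * (real k + 2))"
  define \<epsilon> where "\<epsilon> = 1 / (3 * (real m + 1)\<^sup>2)"
  have k3: "3 \<le> real k" and C12: "12 \<le> C" by (auto simp: k_def C_def)
  have m1: "1 \<le> (real m + 1)\<^sup>2" by (simp add: power2_eq_square algebra_simps)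
  have \<epsilon>: "0 < \<epsilon>" "\<epsilon> \<le> 1" "3 * (real m + 1)\<^sup>2 * \<epsilon> \<le> 1"
  proof -
    have p: "1 \<le> 3 * (real m + 1)\<^sup>2" using m1 by linarith
    then show "0 < \<epsilon>" unfolding \<epsilon>_def by (intro divide_pos_pos) linarith+
    show "\<epsilon> \<le> 1" unfolding \<epsilon>_def by (rule divide_le_eq_1_pos[THEN iffD2]) (use p in linarith)+
    show "3 * (real m + 1)\<^sup>2 * \<epsilon> \<le> 1" unfolding \<epsilon>_def using p by simp
  qed
  have C2: "144 \<le> C\<^sup>2" using power_mono[OF C12, of 2] by simp
  have "1 * 1 \<le> 8 * C\<^sup>2 * (real k + 2)" using C2 k3 by (intro mult_mono) auto
  then have n0: "0 < n0" "n0 \<le> 1" "8 * C\<^sup>2 * (real k + 2) * n0 = 1" by (auto simp: n0_def)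
  have Cn0: "C * n0 \<le> 1 / 8"
  proof -
    have "8 * C * n0 * 1 \<le> 8 * C * n0 * (C * (real k + 2))"
      using C12 n0 k3 mult_mono[of 1 C 1 "real k + 2"] by (intro mult_left_mono) auto
    then show ?thesis using n0(3) by (simp add: power2_eq_square algebra_simps)
  qed
  obtain l b D r1 where est: "0 < l" "l \<le> b" "0 \<le> D" "0 < r1" "cball y0 r1 \<subseteq> U"
    "\<And>u. l * norm u \<le> norm (A u)" "\<And>u. norm (A u) \<le> b * norm u"
    "\<And>y u v. y \<in> cball y0 r1 \<Longrightarrow> \<bar>G y u v - A u \<bullet> A v\<bar> \<le> \<epsilon> * (l\<^sup>2 / 2) * norm u * norm v"
    "\<And>y u. y \<in> cball y0 r1 \<Longrightarrow> l\<^sup>2 / 2 * (norm u)\<^sup>2 \<le> G y u u"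
    "\<And>y u. y \<in> cball y0 r1 \<Longrightarrow> G y u u \<le> (2 * b * norm u)\<^sup>2"
    "\<And>y u v h. y \<in> cball y0 r1 \<Longrightarrow>
       \<bar>frechet_derivative (\<lambda>z. G z u v) (at y) h\<bar> \<le> D * norm u * norm v * norm h"
    using metric_estimates[OF y0(1) A \<epsilon>(1,2)] by metis
  have b: "0 < b" using est by linarith
  have Ainj: "u = 0" if "A u = 0" for u
    using est(6)[of u] est(1) that by (simp add: mult_le_0_iff)
  have dimL: "dim (A ` L) = m"
    unfolding m_def
    using dim_image_eq[OF A(1) inj_on_subset[OF _ subset_UNIV]] linear_injective_0[OF A(1)] Ainj by blast
  obtain B where B: "orthonormal_basis_of inner (A ` L) B"
    using inner_form.orthonormal_basis_of_subspace_exists[OF linear_subspace_image[OF A(1) L]] by blast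
  interpret subspace_split "A ` L" B using B by unfold_locales
  \<comment> \<open>On \<open>Z\<close> the normal square is at most
    \<open>(2 * \<eta>)\<^sup>2\<close> times the tangential one, which is at most
    \<open>7 / 4\<close> where the field lives: \<open>7 * \<eta>\<^sup>2\<close> lies below
    \<open>n0 = 9 * \<eta>\<^sup>2\<close>.\<close>
  define \<eta> where "\<eta> = sqrt n0 / 3"
  have \<eta>: "0 < \<eta>" "\<eta> \<le> 1 / 3" "9 * \<eta>\<^sup>2 = n0" using n0 by (auto simp: \<eta>_def power_divide)
  obtain r2 where r2: "0 < r2" "\<And>y y'. y \<in> M \<Longrightarrow> y \<in> ball y0 r2 \<Longrightarrow> y' \<in> M \<Longrightarrow> y' \<in> ball y0 r2 \<Longrightarrow>
        \<exists>u\<in>L. norm (y - y' - u) \<le> (\<eta> * l / b) * norm (y - y')"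
    using cone[of "\<eta> * l / b"] \<eta> est(1) b by (metis IntI divide_pos_pos mult_pos_pos)
  define r where "r = min r1 (r2 / 2)"
  have r: "0 < r" "r \<le> r1" "r < r2" using r2 est(4) by (auto simp: r_def)
  have rU: "cball y0 r \<subseteq> U" using est(5) r by (meson order_trans subset_cball)
  \<comment> \<open>The cone condition is used between two arbitrary points of \<open>M\<close>,
    since later neither \<open>a\<close> nor the nearest point of \<open>Z\<close> is its base
    point. As \<open>\<eta> \<le> 1 / 3\<close>, the normal part on the right is absorbed on the
    left.\<close>
  have QF: "norm (Q (A (y - y'))) \<le> 2 * \<eta> * norm (P (A (y - y')))"
    if yy: "y \<in> M" "y \<in> cball y0 r" "y' \<in> M" "y' \<in> cball y0 r" for y y'
  proof -
    obtain u where u: "u \<in> L" "norm (y - y' - u) \<le> (\<eta> * l / b) * norm (y - y')"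
      using r2(2)[of y y'] yy r by auto
    have "A (y - y') = A (y - y' - u) + A u" using linear_add[OF A(1), of "y - y' - u" u] by simp
    then have "Q (A (y - y')) = Q (A (y - y' - u)) + Q (A u)" by (simp add: linear_add[OF linear_Q])
    also have "Q (A u) = 0" using u by (simp add: Q_def P_id)
    finally have "norm (Q (A (y - y'))) \<le> norm (A (y - y' - u))" by (simp add: norm_Q_le)
    also have "\<dots> \<le> b * ((\<eta> * l / b) * norm (y - y'))"
      using est(7)[of "y - y' - u"] u(2) b by (meson less_imp_le mult_left_mono order_trans)
    also have "\<dots> = \<eta> * (l * norm (y - y'))" using b by simp
    also have "\<dots> \<le> \<eta> * norm (A (y - y'))" using est(6) \<eta> by (intro mult_left_mono) auto
    also have "\<dots> \<le> \<eta> * (norm (P (A (y - y'))) + norm (Q (A (y - y'))))"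
      using norm_triangle_ineq[of "P (A (y - y'))" "Q (A (y - y'))"] \<eta> by (intro mult_left_mono) (auto simp: Q_def)
    also have "\<dots> \<le> \<eta> * norm (P (A (y - y'))) + 1 / 3 * norm (Q (A (y - y')))"
      using mult_right_mono[OF \<eta>(2), of "norm (Q (A (y - y')))"] by (simp add: algebra_simps)
    moreover have "0 \<le> \<eta> * norm (P (A (y - y')))" using \<eta> by simp
    ultimately show ?thesis by linarith
  qed
  define K0 where "K0 = 2 / l\<^sup>2 * (4 + 2 * C) * b"
  define c4 where "c4 = real m * (3 * D / l\<^sup>2) * K0 + h * (2 * b * K0)"
  have c4: "0 \<le> c4" using est(1,3) h b C12 by (simp add: c4_def K0_def)
  \<comment> \<open>The first entry forces \<open>\<rho> \<le> b * d\<close> to be so small that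
    \<open>s = 1 / \<rho>\<close> exceeds the error constant \<open>c4\<close>; the second keeps the
    support of the field in the ball of radius \<open>r\<close> about \<open>y0\<close>.\<close>
  define d where "d = min (1 / (b * (c4 + 1))) (r / (2 * (1 + 2 * b / l)))"
  have bl: "0 < 2 * b / l" using b est(1) by simp
  have d: "0 < d" "b * d * (c4 + 1) \<le> 1" "d * (1 + 2 * b / l) < r"
  proof -
    show "0 < d" using b c4 bl r unfolding d_def by (auto intro!: divide_pos_pos mult_pos_pos)
    have "d \<le> 1 / (b * (c4 + 1))" by (simp add: d_def)
    moreover have "0 < b * (c4 + 1)" using b c4 by simp
    ultimately have "d * (b * (c4 + 1)) \<le> 1" by (simp only: pos_le_divide_eq)
    then show "b * d * (c4 + 1) \<le> 1" by (simp add: algebra_simps)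
    have "d \<le> r / (2 * (1 + 2 * b / l))" by (simp add: d_def)
    then have "d * (2 * (1 + 2 * b / l)) \<le> r" using bl by (simp add: pos_le_divide_eq)
    moreover have "d * (2 * q) = 2 * (d * q)" for q by simp
    ultimately have "2 * (d * (1 + 2 * b / l)) \<le> r" by (simp only:)
    moreover have "q < r" if "2 * q \<le> r" for q using that r(1) by linarith
    ultimately show "d * (1 + 2 * b / l) < r" by blast
  qed
  obtain a where a: "a \<in> M" "a \<notin> Z" "dist a y0 < d" using frontier[OF d(1)] by blast
  have dr: "d < r"
  proof -
    have "d * 1 \<le> d * (1 + 2 * b / l)" using d(1) bl by (intro mult_left_mono) auto
    then show ?thesis using d(3) by simp
  qed
  have ar: "a \<in> cball y0 r" using a(3) dr by (simp add: dist_commute)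
  define F where "F y = norm (P (A (y - a)))" for y
  have "continuous_on UNIV F"
    unfolding F_def using linear_continuous_on bounded_linear_P A(1)
    by (intro continuous_intros continuous_on_compose2[OF linear_continuous_on[OF bounded_linear_P], of UNIV]
        continuous_on_compose2[OF linear_continuous_on[of A], of UNIV]) (auto simp: linear_conv_bounded_linear)
  then have Fc: "continuous_on S F" for S using continuous_on_subset by blast
  \<comment> \<open>\<open>Z\<close> is closed only relative to \<open>U\<close>, but its part in a
    closed ball contained in \<open>U\<close> is compact, so the tangential distance attains its
    minimum.\<close>
  obtain Z' where Z': "closed Z'" "Z = Z' \<inter> U"
    using Z(1) unfolding closedin_closed by blast
  then have W: "Z \<inter> cball y0 r = Z' \<inter> cball y0 r" using rU by blast
  have "compact (Z \<inter> cball y0 r)" unfolding W using Z'(1) by (simp add: closed_Int_compact)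
  moreover have y0W: "y0 \<in> Z \<inter> cball y0 r" using y0 r by simp
  ultimately obtain ys where ys: "ys \<in> Z \<inter> cball y0 r" "\<And>y. y \<in> Z \<inter> cball y0 r \<Longrightarrow> F ys \<le> F y"
    using continuous_attains_inf[OF _ _ Fc[of "Z \<inter> cball y0 r"]] by blast
  define \<rho> where "\<rho> = F ys"
  \<comment> \<open>If the tangential parts of \<open>ys\<close> and \<open>a\<close> agreed, the
    cone condition would make the normal parts agree too, forcing \<open>ys = a\<close>, although
    \<open>a\<close> is not in \<open>Z\<close>.\<close>
  have \<rho>0: "0 < \<rho>"
  proof (rule ccontr)
    assume "\<not> 0 < \<rho>"
    then have "P (A (ys - a)) = 0" by (simp add: \<rho>_def F_def)
    moreover from this have "Q (A (ys - a)) = 0"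
      using QF[of ys a] ys(1) Z(2) a(1) ar by auto
    ultimately have "A (ys - a) = 0" by (simp add: Q_def)
    then show False using Ainj[of "ys - a"] ys(1) a(2) by simp
  qed
  have \<rho>d: "\<rho> \<le> b * d"
  proof -
    have "\<rho> \<le> F y0" unfolding \<rho>_def by (rule ys(2)[OF y0W])
    also have "\<dots> \<le> norm (A (y0 - a))" unfolding F_def by (rule norm_P_le)
    also have "\<dots> \<le> b * norm (y0 - a)" by (rule est(7))
    also have "\<dots> \<le> b * d" using a(3) b by (intro mult_left_mono) (auto simp: dist_norm norm_minus_commute)
    finally show ?thesis .
  qed
  define s where "s = 1 / \<rho>"
  have s0: "0 < s" using \<rho>0 by (simp add: s_def)
  have sc4: "c4 \<le> s"
  proof -
    have "\<rho> * (c4 + 1) \<le> 1" 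
      by (rule order_trans[OF mult_right_mono[OF \<rho>d] d(2)]) (use c4 in simp)
    then show ?thesis using \<rho>0 by (simp add: s_def field_simps)
  qed
  have lin\<omega>: "linear (\<lambda>u. barrier' C x (s *\<^sub>R A u))" for x
    using linear_compose[OF linear_compose_scale_right[OF A(1)] linear_barrier'] by (simp add: o_def)
  have \<omega>C: "Ck_on 1 U (\<lambda>y. barrier' C (s *\<^sub>R A (y - a)) (s *\<^sub>R A u))" for u
  proof -
    have "Ck_on 1 U (\<lambda>y. s *\<^sub>R A (y - a))"
    proof (rule Ck1I)
      have bA: "bounded_linear A" using A(1) linear_conv_bounded_linear by blast
      have "((\<lambda>y. y - a) has_derivative (\<lambda>u. u)) (at y)" for y by (auto intro!: derivative_eq_intros)
      from has_derivative_scaleR_right[OF bounded_linear.has_derivative[OF bA this], of s]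
      show "((\<lambda>y. s *\<^sub>R A (y - a)) has_derivative (\<lambda>u. s *\<^sub>R A u)) (at y)" for y .
      show "continuous_on U (\<lambda>x. s *\<^sub>R A v)" for v by (rule continuous_on_const)
    qed
    from Ck1_compose[OF this Ck1_barrier'[of UNIV C "s *\<^sub>R A u"] subset_UNIV] show ?thesis .
  qed
  obtain Y where Y: "Ck_on 1 U Y" "\<And>y u. y \<in> U \<Longrightarrow> G y (Y y) u = barrier' C (s *\<^sub>R A (y - a)) (s *\<^sub>R A u)"
    using gradient_exists[of "\<lambda>y u. barrier' C (s *\<^sub>R A (y - a)) (s *\<^sub>R A u)", OF lin\<omega> \<omega>C] by blast
  interpret barrier_setup U G "A ` L" B A a s Y k C
    by (intro barrier_setup.intro barrier_setup_axioms.intro metric_on_axioms subspace_split_axioms A(1) s0 Y)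
      (auto simp: k_def C_def dimL)
  \<comment> \<open>On the support the scaled point has norm at most 2, hence
    \<open>norm (A (y - a)) \<le> 2 * \<rho>\<close>; the lower bound \<open>l\<close> for
    \<open>A\<close> gives the radius.\<close>
  define K where "K = cball a (2 * \<rho> / l)"
  have Kr: "K \<subseteq> cball y0 r"
  proof
    fix y assume "y \<in> K"
    then have "dist y0 y \<le> d + 2 * \<rho> / l"
      using a(3) dist_triangle[of y0 y a] by (auto simp: K_def dist_commute)
    also have "\<dots> \<le> d + 2 * (b * d) / l" using \<rho>d est(1) by (intro add_mono divide_right_mono) auto
    also have "\<dots> = d * (1 + 2 * b / l)" by (simp add: algebra_simps)
    finally show "y \<in> cball y0 r" using d(3) by simp
  qed
  have PX: "P (X y) = s *\<^sub>R P (A (y - a))" and QX: "Q (X y) = s *\<^sub>R Q (A (y - a))" for y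
    by (simp_all add: X_def linear_cmul[OF linear_P] linear_cmul[OF linear_Q])
  have sF: "P (X y) \<bullet> P (X y) = (s * F y)\<^sup>2" for y
    by (simp add: PX F_def dot_square_norm power_mult_distrib)
  have supp: "P (X y) \<bullet> P (X y) < 7 / 4" "Q (X y) \<bullet> Q (X y) \<le> 1" "y \<in> K" if "\<phi> (v y) \<noteq> 0" for y
  proof -
    have v: "- 3 / 2 < barrier C (X y)" using that by (auto simp: \<phi>_eq_0 v_def)
    show 1: "P (X y) \<bullet> P (X y) < 7 / 4" "Q (X y) \<bullet> Q (X y) \<le> 1" using barrier_support[OF v C12] by auto
    then have "(norm (X y))\<^sup>2 \<le> 2\<^sup>2" using inner_split[of "X y" "X y"] by (simp add: power2_norm_eq_inner)
    then have "norm (X y) \<le> 2" by (rule power2_le_imp_le) simp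
    have "\<rho> * s = 1" using \<rho>0 by (simp add: s_def)
    then have "norm (A (y - a)) = \<rho> * norm (X y)" using s0 by (simp add: X_def flip: mult.assoc)
    then have "norm (A (y - a)) \<le> 2 * \<rho>" using \<open>norm (X y) \<le> 2\<close> \<rho>0 by simp
    then have "l * norm (y - a) \<le> 2 * \<rho>" using est(6) order_trans by blast
    then show "y \<in> K" using est(1) by (simp add: K_def dist_norm norm_minus_commute field_simps)
  qed
  have ZX: "1 \<le> P (X y) \<bullet> P (X y)" "Q (X y) \<bullet> Q (X y) \<le> (2 * \<eta>)\<^sup>2 * (P (X y) \<bullet> P (X y))"
    if "y \<in> Z" "y \<in> cball y0 r" for y
  proof -
    have "1 \<le> s * F y" using ys(2)[of y] that \<rho>0 by (simp add: s_def \<rho>_def)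
    then show "1 \<le> P (X y) \<bullet> P (X y)" unfolding sF by simp
    have "norm (Q (X y)) \<le> 2 * \<eta> * norm (P (X y))"
      using mult_left_mono[OF QF[of y a], of s] that Z(2) a(1) ar s0 by (auto simp: PX QX)
    then have "(norm (Q (X y)))\<^sup>2 \<le> (2 * \<eta> * norm (P (X y)))\<^sup>2" by (rule power_mono) simp
    then show "Q (X y) \<bullet> Q (X y) \<le> (2 * \<eta>)\<^sup>2 * (P (X y) \<bullet> P (X y))"
      by (simp add: power2_norm_eq_inner power_mult_distrib)
  qed
  \<comment> \<open>Where the field lives but \<open>barrier_estimate\<close> may fail: tangentially
    too close to the axis, or too far from the plane. Weak inequalities make the set
    compact.\<close>
  define Bad where "Bad = {y \<in> K. P (X y) \<bullet> P (X y) \<le> 7 / 4 \<and> (P (X y) \<bullet> P (X y) \<le> 3 / 4 \<or> n0 \<le> Q (X y) \<bullet> Q (X y))}"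
  \<comment> \<open>The level \<open>- 5 / 4\<close> lies between the cutoff \<open>- 3 / 2\<close>
    and the value at \<open>ys\<close>, which is at least \<open>- 1\<close>; on \<open>Ob\<close>
    the argument of the power therefore exceeds \<open>1 / 4\<close>.\<close>
  define Ob where "Ob = {y \<in> U. - 5 / 4 < v y}"
  have PXc: "continuous_on UNIV (\<lambda>y. P (X y) \<bullet> P (X y))" and QXc: "continuous_on UNIV (\<lambda>y. Q (X y) \<bullet> Q (X y))"
    using continuous_on_compose2[OF linear_continuous_on[OF bounded_linear_P, of UNIV] X_continuous[of UNIV] subset_UNIV]
      continuous_on_compose2[OF linear_continuous_on[OF bounded_linear_Q, of UNIV] X_continuous[of UNIV] subset_UNIV]
    by (auto intro: continuous_intros)
  have "closed {y. P (X y) \<bullet> P (X y) \<le> 7 / 4 \<and> (P (X y) \<bullet> P (X y) \<le> 3 / 4 \<or> n0 \<le> Q (X y) \<bullet> Q (X y))}"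
    by (intro closed_Collect_conj closed_Collect_disj closed_Collect_le PXc QXc continuous_on_const)
  from compact_Int_closed[OF compact_cball this]
  have Badc: "compact Bad" unfolding Bad_def K_def Int_def mem_Collect_eq .
  have Obo: "open Ob"
    using open_Int[OF open_U open_Collect_less[OF continuous_on_const v_continuous[of UNIV], of "- 5 / 4"]]
    by (simp add: Ob_def Collect_conj_eq)
  have ysr: "ys \<in> Z" "ys \<in> cball y0 r" using ys(1) by auto
  have ysOb: "ys \<in> Ob"
  proof -
    have t: "P (X ys) \<bullet> P (X ys) = 1" unfolding sF using \<rho>0 by (simp add: s_def \<rho>_def)
    define N where "N = Q (X ys) \<bullet> Q (X ys)"
    have "N \<le> n0" using ZX(2)[OF ysr] \<eta>(3) n0 by (simp add: N_def t power_mult_distrib)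
    then have "C * N \<le> 1" using mult_left_mono[of N n0 C] C12 Cn0 by linarith
    then have "C * N * (C * N) \<le> C * N * 1" using C12 by (intro mult_left_mono) (auto simp: N_def)
    then have "- 1 \<le> v ys" by (simp add: v_def barrier_def t N_def[symmetric] power2_eq_square algebra_simps)
    then show ?thesis using ysr rU by (auto simp: Ob_def)
  qed
  define c where "c = (1 / 4) ^ k * s\<^sup>2"
  show thesis
  proof (rule that[of w K Ob c Bad])
    show "Ck_on 1 U w" by (rule Ck1_w)
    show "compact K" "K \<subseteq> U" using Kr rU by (auto simp: K_def)
    show "w y = 0" if "y \<notin> K" for y using supp(3)[of y] that by (auto simp: w_def)
    show "open Ob" "Ob \<subseteq> U" "compact Bad" using Obo Badc by (auto simp: Ob_def)
    show "Bad \<subseteq> U" using Kr rU by (auto simp: Bad_def)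
    show "Ob \<inter> Z \<noteq> {}" using ysOb ysr by blast
    show "0 < c" using s0 by (simp add: c_def)
    show "Bad \<inter> Z = {}"
    proof (rule ccontr)
      assume "Bad \<inter> Z \<noteq> {}"
      then obtain y where y: "y \<in> K" "y \<in> Z" "P (X y) \<bullet> P (X y) \<le> 7 / 4"
          "P (X y) \<bullet> P (X y) \<le> 3 / 4 \<or> n0 \<le> Q (X y) \<bullet> Q (X y)" by (auto simp: Bad_def)
      have z: "1 \<le> P (X y) \<bullet> P (X y)" "Q (X y) \<bullet> Q (X y) \<le> (2 * \<eta>)\<^sup>2 * (P (X y) \<bullet> P (X y))"
        using ZX[of y] y Kr by auto
      have "n0 \<le> (2 * \<eta>)\<^sup>2 * (7 / 4)"
        using y(3,4) z mult_left_mono[OF y(3), of "(2 * \<eta>)\<^sup>2"] by force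
      then show False using \<eta>(3) n0(1) by (simp add: power_mult_distrib)
    qed
    fix y I assume y: "y \<in> U" "y \<notin> Bad" and I: "finite I" "card I = dim L"
      "\<And>e f. e \<in> I \<Longrightarrow> f \<in> I \<Longrightarrow> G y e f = (if e = f then 1 else 0)"
    show "(if y \<in> Ob then c else 0) \<le> (\<Sum>e\<in>I. lie_form G w y e) - h * sqrt (G y (w y) (w y))"
    proof (cases "\<phi> (v y) = 0")
      case True
      then have "w y = 0" by (simp add: w_def)
      moreover have "G y 0 0 = 0" using bilinear_lzero[OF G_bilinear[OF y(1)]] .
      moreover have "y \<notin> Ob" using True by (auto simp: \<phi>_eq_0 Ob_def)
      ultimately show ?thesis using lie_form_zero[OF y(1) True] by simp
    next
      case False
      have yr: "y \<in> cball y0 r1" using supp(3)[OF False] Kr r(2) by (meson subset_cball subsetD)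
      have t: "3 / 4 \<le> P (X y) \<bullet> P (X y)" "P (X y) \<bullet> P (X y) \<le> 2" and "Q (X y) \<bullet> Q (X y) \<le> n0"
        using supp[OF False] y(2) by (auto simp: Bad_def)
      then have "8 * C\<^sup>2 * (real k + 2) * (Q (X y) \<bullet> Q (X y)) \<le> 8 * C\<^sup>2 * (real k + 2) * n0"
        by (intro mult_left_mono) auto
      then have n: "8 * C\<^sup>2 * (real k + 2) * (Q (X y) \<bullet> Q (X y)) \<le> 1" using n0 by simp
      have "\<phi> (v y) * s\<^sup>2 \<le> (\<Sum>e\<in>I. lie_form G w y e) - h * sqrt (G y (w y) (w y))"
        by (rule barrier_estimate[OF y(1) est(1,3) h est(7) est(8)[OF yr] est(9)[OF yr] est(10)[OF yr] est(11)[OF yr]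
              _ _ t n I(1) _ I(3) K0_def])
          (use \<epsilon> I(2) sc4 in \<open>auto simp: dimL m_def[symmetric] c4_def\<close>)
      moreover have "c \<le> \<phi> (v y) * s\<^sup>2" if "y \<in> Ob"
      proof -
        have "(1 / 4) ^ k \<le> \<phi> (v y)"
          unfolding \<phi>_def using that by (intro power_mono) (auto simp: Ob_def)
        then show ?thesis unfolding c_def by (rule mult_right_mono) simp
      qed
      moreover have "0 \<le> \<phi> (v y) * s\<^sup>2" using \<phi>_nonneg by simp
      ultimately show ?thesis by auto
    qed
  qed
qed

section \<open>Compactness of the Grassmann bundle\<close>

text \<open>The projection along a compact factor is a closed map, so preimages of closed sets are
  projections of closed parts of the graph.\<close>

lemma continuous_on_closed_graph_compact:
  fixes f :: "'x::topological_space \<Rightarrow> 'y::topological_space"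
  assumes T: "compact T" and fim: "f \<in> S \<rightarrow> T"
    and graph: "closedin (top_of_set (S \<times> T)) ((\<lambda>x. (x, f x)) ` S)"
  shows "continuous_on S f"
  unfolding continuous_on_closed_gen[OF fim]
proof (intro allI impI)
  fix U assume U: "closedin (top_of_set T) U"
  have "closed_map (prod_topology (top_of_set S) (top_of_set T)) (top_of_set S) fst"
    using T by (intro Abstract_Topological_Spaces.closed_map_fst) (simp add: compact_space_subtopology)
  then have cm: "closed_map (top_of_set (S \<times> T)) (top_of_set S) fst"
    by (simp add: prod_topology_subtopology_eu)
  have "closedin (top_of_set (S \<times> T)) (S \<times> U)"
    unfolding prod_topology_subtopology_eu[symmetric] closedin_prod_Times_iff using U by auto
  then have "closedin (top_of_set (S \<times> T)) ((\<lambda>x. (x, f x)) ` S \<inter> S \<times> U)"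
    using graph by (intro closedin_Int)
  with cm have "closedin (top_of_set S) (fst ` ((\<lambda>x. (x, f x)) ` S \<inter> S \<times> U))"
    by (simp add: closed_map_def)
  moreover have "fst ` ((\<lambda>x. (x, f x)) ` S \<inter> S \<times> U) = S \<inter> f -` U" by force
  ultimately show "closedin (top_of_set S) (S \<inter> f -` U)" by simp
qed

lemma continuous_on_blinfun_apply:
  "continuous_on S f \<Longrightarrow> continuous_on S g \<Longrightarrow> continuous_on S (\<lambda>x. blinfun_apply (f x) (g x))"
  by (rule bounded_bilinear.continuous_on[OF bounded_bilinear_blinfun_apply])

lemma (in subspace_split) plane_proj_apply: "blinfun_apply (plane_proj L) x = P x"
proof -
  have "closest_point L = P"
  proof
    fix x
    have "P x = closest_point L x"
    proof (rule closest_point_unique)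
      show "convex L" "closed L" using subspace_L by (auto simp: subspace_imp_convex closed_subspace)
      show "P x \<in> L" by (rule P_in)
      show "\<forall>z\<in>L. dist x (P x) \<le> dist x z"
      proof
        fix z assume z: "z \<in> L"
        have "Q (x - z) = x - P x" using z by (simp add: Q_def linear_diff[OF linear_P] P_id)
        then show "dist x (P x) \<le> dist x z" using norm_Q_le[of "x - z"] by (simp add: dist_norm)
      qed
    qed
    then show "closest_point L x = P x" by simp
  qed
  then show ?thesis unfolding plane_proj_def using bounded_linear_P by (simp add: bounded_linear_Blinfun_apply)
qed

lemma subspace_split_exists:
  fixes S :: "'e::euclidean_space set"
  assumes "subspace S" obtains B where "subspace_split S B"
  using inner_form.orthonormal_basis_of_subspace_exists[OF assms] subspace_split.intro by blast

section \<open>The Grassmannian as a set of orthogonal projections\<close>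

definition grassmannian :: "nat \<Rightarrow> ('e::euclidean_space \<Rightarrow>\<^sub>L 'e) set" where
  "grassmannian m = plane_proj ` {S. subspace S \<and> dim S = m}"

lemma plane_proj_fixed:
  assumes "subspace S" shows "blinfun_apply (plane_proj S) x = x \<longleftrightarrow> x \<in> S"
proof -
  obtain B where "subspace_split S B" using subspace_split_exists[OF assms] .
  then interpret subspace_split S B .
  show ?thesis unfolding plane_proj_apply using P_in[of x] P_id[of x] by metis
qed

lemma range_plane_proj:
  assumes "subspace S" shows "range (blinfun_apply (plane_proj S)) = S"
proof -
  obtain B where "subspace_split S B" using subspace_split_exists[OF assms] .
  then interpret subspace_split S B .
  show ?thesis
  proof (intro subset_antisym subsetI)
    show "x \<in> S" if "x \<in> range (blinfun_apply (plane_proj S))" for x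
      using that P_in by (auto simp: plane_proj_apply)
    show "x \<in> range (blinfun_apply (plane_proj S))" if "x \<in> S" for x
      using plane_proj_fixed[OF assms, of x] that by (metis rangeI)
  qed
qed

lemma grassmannian_range:
  assumes "R \<in> grassmannian m"
  shows "subspace (range (blinfun_apply R))" "dim (range (blinfun_apply R)) = m"
    "plane_proj (range (blinfun_apply R)) = R"
  using assms by (auto simp: grassmannian_def range_plane_proj)

text \<open>The trace of an orthogonal projection is its rank. In this form all conditions are
  equations between continuous functions, so closedness is immediate.\<close>

lemma grassmannian_eq:
  "grassmannian m = {R :: 'e::euclidean_space \<Rightarrow>\<^sub>L 'e. (\<forall>x. R (R x) = R x) \<and>
     (\<forall>x y. R x \<bullet> y = x \<bullet> R y) \<and> (\<Sum>b\<in>Basis. R b \<bullet> b) = real m}" (is "_ = ?R")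
proof -
  have trace: "(\<Sum>b\<in>Basis. plane_proj S b \<bullet> b) = real (dim S)" if S: "subspace S" for S :: "'e set"
  proof -
    obtain B where "subspace_split S B" using subspace_split_exists[OF S] .
    then interpret subspace_split S B .
    have "(\<Sum>b\<in>Basis. plane_proj S b \<bullet> b) = (\<Sum>b\<in>Basis. \<Sum>e\<in>B. (e \<bullet> b) * (e \<bullet> b))"
      unfolding plane_proj_apply P_inner by (simp add: inner_commute)
    also have "\<dots> = (\<Sum>e\<in>B. \<Sum>b\<in>Basis. (e \<bullet> b) * (e \<bullet> b))" by (rule sum.swap)
    also have "\<dots> = (\<Sum>e\<in>B. e \<bullet> e)" by (simp add: euclidean_inner[symmetric])
    also have "\<dots> = (\<Sum>e\<in>B. 1)"
      by (intro sum.cong refl) (simp add: inner_form.orthonormal_basis_unit[OF B])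
    finally show ?thesis using inner_form.orthonormal_basis_card[OF B] by simp
  qed
  have "plane_proj S \<in> ?R" if S: "subspace S" "dim S = m" for S :: "'e set"
  proof -
    obtain B where "subspace_split S B" using subspace_split_exists[OF S(1)] .
    then interpret subspace_split S B .
    have "P x \<bullet> y = x \<bullet> P y" for x y using P_adjoint[of x y] by (simp add: inner_commute)
    then show ?thesis using trace[OF S(1)] S(2) by (simp add: plane_proj_apply P_id P_in)
  qed
  moreover have "R \<in> grassmannian m" if R: "R \<in> ?R" for R
  proof -
    define S where "S = range (blinfun_apply R)"
    have S: "subspace S" unfolding S_def
      by (rule linear_subspace_image) (auto intro: bounded_linear.linear blinfun.bounded_linear_right)
    obtain B where "subspace_split S B" using subspace_split_exists[OF S] .
    then interpret subspace_split S B .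
    have "P x = R x" for x
    proof -
      have "P (x - R x) \<bullet> z = 0" for z
      proof -
        obtain u where u: "P z = R u" using P_in[of z] by (auto simp: S_def)
        have "P (x - R x) \<bullet> z = (x - R x) \<bullet> R u" using P_adjoint[of "x - R x" z] u by (simp add: inner_commute)
        also have "\<dots> = (R (x - R x)) \<bullet> u" using R by simp
        also have "R (x - R x) = 0" using R by (simp add: blinfun.diff_right)
        finally show ?thesis by simp
      qed
      then have "P (x - R x) = 0" by (metis inner_eq_zero_iff)
      moreover have "P (R x) = R x" by (rule P_id) (simp add: S_def)
      ultimately show ?thesis by (simp add: linear_diff[OF linear_P])
    qed
    then have eq: "plane_proj S = R" by (intro blinfun_eqI) (simp add: plane_proj_apply)
    have "real (dim S) = real m" using trace[OF S] R by (simp add: eq)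
    then show ?thesis using S eq by (auto simp: grassmannian_def)
  qed
  ultimately show ?thesis by (auto simp: grassmannian_def)
qed

lemma compact_grassmannian: "compact (grassmannian m :: ('e::euclidean_space \<Rightarrow>\<^sub>L 'e) set)"
  unfolding compact_eq_bounded_closed
proof
  show "bounded (grassmannian m :: ('e \<Rightarrow>\<^sub>L 'e) set)"
    unfolding bounded_iff
  proof (intro exI[of _ 1] ballI)
    fix R :: "'e \<Rightarrow>\<^sub>L 'e" assume "R \<in> grassmannian m"
    then obtain S where S: "subspace S" "R = plane_proj S" by (auto simp: grassmannian_def)
    obtain B where "subspace_split S B" using subspace_split_exists[OF S(1)] .
    then interpret subspace_split S B .
    show "norm R \<le> 1" by (rule norm_blinfun_bound) (auto simp: S plane_proj_apply norm_P_le)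
  qed
  show "closed (grassmannian m :: ('e \<Rightarrow>\<^sub>L 'e) set)"
    unfolding grassmannian_eq
    by (intro closed_Collect_conj closed_Collect_all closed_Collect_eq continuous_on_inner continuous_on_sum
        continuous_on_blinfun_apply continuous_on_id continuous_on_const)
qed

text \<open>A projection of rank \<open>m\<close> is the one onto the image plane as soon as it
  fixes every \<open>T y (R x)\<close>, because inclusion and equal dimension give equality. These
  equations define a closed graph, so no formula for the projection onto an image is
  required.\<close>

lemma continuous_plane_image:
  fixes T :: "'x::metric_space \<Rightarrow> 'e::euclidean_space \<Rightarrow> 'e"
  assumes lin: "\<And>y. y \<in> S \<Longrightarrow> linear (T y)" and inj: "\<And>y. y \<in> S \<Longrightarrow> inj (T y)"
    and T: "\<And>v. continuous_on S (\<lambda>y. T y v)"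
  shows "continuous_on (S \<times> grassmannian m) (\<lambda>(y, R). plane_proj (T y ` range (blinfun_apply R)))"
proof (rule continuous_on_closed_graph_compact[OF compact_grassmannian])
  let ?G = "grassmannian m :: ('e \<Rightarrow>\<^sub>L 'e) set"
  let ?f = "\<lambda>(y, R). plane_proj (T y ` range (blinfun_apply R))"
  let ?D = "(S \<times> ?G) \<times> ?G"
  have sub: "subspace (T y ` range (blinfun_apply R))" "dim (T y ` range (blinfun_apply R)) = m"
    if "y \<in> S" "R \<in> ?G" for y R
    using that grassmannian_range[OF that(2)] linear_subspace_image[OF lin]
      dim_image_eq[OF lin inj_on_subset[OF inj subset_UNIV]] by auto
  then show "?f \<in> S \<times> ?G \<rightarrow> ?G" by (auto simp: grassmannian_def)
  define C where "C x = {p \<in> ?D. blinfun_apply (snd p) (T (fst (fst p)) (blinfun_apply (snd (fst p)) x))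
      - T (fst (fst p)) (blinfun_apply (snd (fst p)) x) = 0}" for x
  have Tc: "continuous_on ?D (\<lambda>p. T (fst (fst p)) (blinfun_apply (snd (fst p)) x))" for x
  proof (rule continuous_on_linear_family[where T = "\<lambda>p. T (fst (fst p))"])
    show "linear (T (fst (fst p)))" if "p \<in> ?D" for p using that lin by auto
    show "continuous_on ?D (\<lambda>p. T (fst (fst p)) v)" for v
      by (rule continuous_on_compose2[OF T]) (auto intro!: continuous_intros)
    show "continuous_on ?D (\<lambda>p. blinfun_apply (snd (fst p)) x)"
      by (intro continuous_on_blinfun_apply continuous_intros)
  qed
  have "closedin (top_of_set ?D) (C x)" for x
    unfolding C_def
    by (rule continuous_closedin_preimage_constant)
      (intro continuous_on_diff continuous_on_blinfun_apply Tc continuous_intros)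
  then have "closedin (top_of_set ?D) (\<Inter>x. C x)" by (intro closedin_INT) auto
  moreover have "(\<Inter>x. C x) = (\<lambda>x. (x, ?f x)) ` (S \<times> ?G)"
  proof (intro subset_antisym subsetI)
    fix p assume p: "p \<in> (\<Inter>x. C x)"
    obtain y R R' where pe: "p = ((y, R), R')" by (metis prod.collapse)
    have D: "y \<in> S" "R \<in> ?G" "R' \<in> ?G" and fixd: "\<And>x. R' (T y (R x)) = T y (R x)"
      using p by (auto simp: C_def pe)
    have "T y ` range (blinfun_apply R) \<subseteq> range (blinfun_apply R')"
    proof clarify
      fix x
      show "T y (R x) \<in> range (blinfun_apply R')"
        by (rule range_eqI[of _ _ "T y (R x)"]) (simp add: fixd)
    qed
    then have "T y ` range (blinfun_apply R) = range (blinfun_apply R')"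
      using sub[OF D(1,2)] grassmannian_range[OF D(3)] by (intro subspace_dim_equal) auto
    then have "R' = ?f (y, R)" using grassmannian_range(3)[OF D(3)] by simp
    then show "p \<in> (\<lambda>x. (x, ?f x)) ` (S \<times> ?G)" using D pe by auto
  next
    fix p assume "p \<in> (\<lambda>x. (x, ?f x)) ` (S \<times> ?G)"
    then obtain y R where D: "y \<in> S" "R \<in> ?G" "p = ((y, R), plane_proj (T y ` range (blinfun_apply R)))" by auto
    have "plane_proj (T y ` range (blinfun_apply R)) \<in> ?G" using sub[OF D(1,2)] by (auto simp: grassmannian_def)
    moreover have "plane_proj (T y ` range (blinfun_apply R)) (T y (R x)) = T y (R x)" for x
      unfolding plane_proj_fixed[OF sub(1)[OF D(1,2)]] by simp
    ultimately show "p \<in> (\<Inter>x. C x)" using D by (auto simp: C_def)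
  qed
  ultimately show "closedin (top_of_set ?D) ((\<lambda>x. (x, ?f x)) ` (S \<times> ?G))" by simp
qed

context smooth_manifold begin

definition grassmann_generator :: "('a, 'e) chart \<Rightarrow> nat \<Rightarrow> ('e \<times> ('e \<Rightarrow>\<^sub>L 'e)) set \<Rightarrow> ('a \<times> 'e set) set" where
  "grassmann_generator c m Q =
     {(p, S) \<in> grassmann_bundle m. p \<in> fst c \<and> (snd c p, plane_proj (chart_deriv A c p ` S)) \<in> Q}"

lemma grassmann_topology_eq:
  "grassmann_topology A m = topology_generated_by {grassmann_generator c m Q | c Q. c \<in> A \<and> open Q}"
  unfolding grassmann_topology_def grassmann_generator_def ..

lemma openin_grassmann_generator:
  "c \<in> A \<Longrightarrow> open Q \<Longrightarrow> openin (grassmann_topology A m) (grassmann_generator c m Q)"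
  unfolding grassmann_topology_eq by (rule topology_generated_by_Basis) blast

lemma openin_grassmann_fst:
  assumes "open U" shows "openin (grassmann_topology A m) {(p, S) \<in> grassmann_bundle m. p \<in> U}"
proof -
  have "{(p, S) \<in> grassmann_bundle m. p \<in> U}
      = (\<Union>c\<in>A. grassmann_generator c m ((snd c ` (fst c \<inter> U)) \<times> UNIV))" (is "?l = ?r")
  proof (intro subset_antisym subsetI)
    fix x assume "x \<in> ?l"
    then show "x \<in> ?r" using chart_at_in[of "fst x"] by (force simp: grassmann_generator_def)
  next
    fix x assume "x \<in> ?r"
    then obtain c p S q where c: "c \<in> A" "x = (p, S)" "x \<in> grassmann_bundle m" "p \<in> fst c" "q \<in> fst c" "q \<in> U" "snd c p = snd c q"
      by (auto simp: grassmann_generator_def)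
    then have "p = q" by (metis chart_inv_chart)
    then show "x \<in> ?l" using c by simp
  qed
  also have "openin (grassmann_topology A m) \<dots>"
    using assms by (intro openin_Union ballI) (auto intro!: openin_grassmann_generator open_Times open_chart_image)
  finally show ?thesis .
qed

lemma chart_deriv_plane:
  assumes "c \<in> A" "p \<in> fst c" "(p, S) \<in> grassmann_bundle m"
  shows "plane_proj (chart_deriv A c p ` S) \<in> grassmannian m"
    and "subspace (chart_deriv A c p ` S)" and "dim (chart_deriv A c p ` S) = m"
proof -
  have inj: "inj (chart_deriv A c p)" using assms(1,2) by (metis chart_deriv_inverse(2) injI)
  show 1: "subspace (chart_deriv A c p ` S)" and 2: "dim (chart_deriv A c p ` S) = m"
    using assms linear_subspace_image[OF chart_deriv_linear[OF assms(1,2)]]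
      dim_image_eq[OF chart_deriv_linear[OF assms(1,2)] inj_on_subset[OF inj subset_UNIV]]
    by (auto simp: grassmann_bundle_def)
  then show "plane_proj (chart_deriv A c p ` S) \<in> grassmannian m" by (auto simp: grassmannian_def)
qed

text \<open>The part of the bundle over \<open>K\<close> is the image of \<open>K\<close> times the
  Grassmannian under the inverse trivialization \<open>\<Phi>\<close>. Continuity is tested on the
  generators, which involve every chart \<open>d\<close> of the atlas, hence the transition maps.
  The result makes varifolds finite over \<open>K\<close>.\<close>

lemma compactin_grassmann:
  assumes c: "c \<in> A" and K: "compact K" "K \<subseteq> chart_image c"
  shows "compactin (grassmann_topology A m) {(p, S) \<in> grassmann_bundle m. p \<in> chart_inv c ` K}"
proof -
  let ?G = "grassmannian m :: ('e \<Rightarrow>\<^sub>L 'e) set"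
  define \<Phi> where "\<Phi> = (\<lambda>(y, R :: 'e \<Rightarrow>\<^sub>L 'e). (chart_inv c y, chart_inv_deriv A c (chart_inv c y) ` range (blinfun_apply R)))"
  have pc: "chart_inv c y \<in> fst c" "snd c (chart_inv c y) = y" if "y \<in> K" for y
    using chart_inv_in[OF subsetD[OF K(2) that]] chart_chart_inv[OF subsetD[OF K(2) that]] by simp_all
  have \<Phi>_in: "\<Phi> (y, R) \<in> grassmann_bundle m" if "y \<in> K" "R \<in> ?G" for y R
  proof -
    have "inj (chart_inv_deriv A c (chart_inv c y))"
      using c pc(1)[OF that(1)] by (metis chart_deriv_inverse(1) injI)
    then have "dim (chart_inv_deriv A c (chart_inv c y) ` range (blinfun_apply R)) = m"
      using grassmannian_range(2)[OF that(2)]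
        dim_image_eq[OF chart_inv_deriv_linear[OF c pc(1)[OF that(1)]] inj_on_subset[OF _ subset_UNIV]] by metis
    moreover have "subspace (chart_inv_deriv A c (chart_inv c y) ` range (blinfun_apply R))"
      by (rule linear_subspace_image[OF chart_inv_deriv_linear[OF c pc(1)[OF that(1)]] grassmannian_range(1)[OF that(2)]])
    ultimately show ?thesis
      by (simp only: \<Phi>_def grassmann_bundle_def prod.case mem_Collect_eq)
  qed
  have "continuous_map (top_of_set (K \<times> ?G)) (grassmann_topology A m) \<Phi>"
    unfolding grassmann_topology_eq
  proof (rule continuous_on_generated_topo)
    fix W assume "W \<in> {grassmann_generator c m Q | c Q. c \<in> A \<and> open Q}"
    then obtain d Q where d: "d \<in> A" "open Q" "W = grassmann_generator d m Q" by blast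
    define S where "S = snd c ` (fst c \<inter> fst d)"
    define T where "T y = coord_change c d (chart_inv c y)" for y
    define f where "f = (\<lambda>(y, R :: 'e \<Rightarrow>\<^sub>L 'e). plane_proj (T y ` range (blinfun_apply R)))"
    have S: "open S" unfolding S_def by (intro open_chart_image c open_chart d)
    have q: "chart_inv c y \<in> fst c" "chart_inv c y \<in> fst d" "snd c (chart_inv c y) = y" if "y \<in> S" for y
      using that c by (auto simp: S_def chart_inv_chart)
    have TF: "T y = frechet_derivative (snd d \<circ> chart_inv c) (at y)" if "y \<in> S" for y
      using q[OF that] by (simp add: T_def coord_change_def)
    have fc: "continuous_on (S \<times> ?G) f" unfolding f_def
    proof (rule continuous_plane_image)
      fix y assume y: "y \<in> S"
      show "linear (T y)" unfolding T_def by (rule coord_change_linear[OF c d(1) q(1,2)[OF y]])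
      show "inj (T y)" unfolding T_def
        by (rule inj_on_inverseI[of _ "coord_change d c (chart_inv c y)"])
          (use c d q[OF y] in \<open>simp add: coord_change_trans coord_change_refl\<close>)
    next
      show "continuous_on S (\<lambda>y. T y v)" for v
        by (rule continuous_on_eq[OF Ck1_continuous_derivative[OF smooth_on_Ck1[OF transition_smooth[OF c d(1)]], folded S_def]])
          (simp add: TF)
    qed
    have "continuous_on S (snd d \<circ> chart_inv c)"
      unfolding S_def by (intro Ck1_continuous smooth_on_Ck1 transition_smooth c d)
    then have "continuous_on (S \<times> ?G) (\<lambda>x. (snd d \<circ> chart_inv c) (fst x))"
      by (rule continuous_on_compose2) (auto intro: continuous_intros)
    from continuous_on_Pair[OF this fc]
    have hc: "continuous_on ((K \<inter> S) \<times> ?G) (\<lambda>x. ((snd d \<circ> chart_inv c) (fst x), f x))"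
      by (rule continuous_on_subset) auto
    have "openin (top_of_set ((K \<inter> S) \<times> ?G)) ((K \<inter> S) \<times> ?G \<inter> (\<lambda>x. ((snd d \<circ> chart_inv c) (fst x), f x)) -` Q)"
      by (rule continuous_openin_preimage_gen[OF hc d(2)])
    moreover have "openin (top_of_set (K \<times> ?G)) ((K \<inter> S) \<times> ?G)"
      using S by (intro openin_Times openin_open_Int) (auto simp: openin_subtopology_self)
    ultimately have "openin (top_of_set (K \<times> ?G)) ((K \<inter> S) \<times> ?G \<inter> (\<lambda>x. ((snd d \<circ> chart_inv c) (fst x), f x)) -` Q)"
      by (rule openin_trans)
    moreover have "\<Phi> -` W \<inter> topspace (top_of_set (K \<times> ?G)) = (K \<inter> S) \<times> ?G \<inter> (\<lambda>x. ((snd d \<circ> chart_inv c) (fst x), f x)) -` Q"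
    proof -
      have "\<Phi> (y, R) \<in> W \<longleftrightarrow> y \<in> S \<and> ((snd d \<circ> chart_inv c) y, f (y, R)) \<in> Q" if y: "y \<in> K" "R \<in> ?G" for y R
      proof -
        have iff: "y \<in> S \<longleftrightarrow> chart_inv c y \<in> fst d"
          using pc[OF y(1)] q(2) by (auto simp: S_def) (metis IntI imageI)
        have "chart_deriv A d (chart_inv c y) ` chart_inv_deriv A c (chart_inv c y) ` X = T y ` X"
          if "chart_inv c y \<in> fst d" for X
          using coord_change_chart_deriv[OF c pc(1)[OF y(1)] d(1) that] chart_deriv_inverse(1)[OF c pc(1)[OF y(1)]]
          unfolding image_image T_def by metis
        then show ?thesis
          using \<Phi>_in[OF y] unfolding d(3) grassmann_generator_def iff by (auto simp: \<Phi>_def f_def)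
      qed
      then show ?thesis by force
    qed
    ultimately show "openin (top_of_set (K \<times> ?G)) (\<Phi> -` W \<inter> topspace (top_of_set (K \<times> ?G)))" by simp
  next
    show "\<Phi> ` topspace (top_of_set (K \<times> ?G)) \<subseteq> \<Union> {grassmann_generator c m Q | c Q. c \<in> A \<and> open Q}"
    proof
      fix x assume "x \<in> \<Phi> ` topspace (top_of_set (K \<times> ?G))"
      then obtain y R where "y \<in> K" "R \<in> ?G" "x = \<Phi> (y, R)" by auto
      then have "x \<in> grassmann_generator c m UNIV"
        using \<Phi>_in[of y R] pc(1) by (auto simp: grassmann_generator_def \<Phi>_def)
      then show "x \<in> \<Union> {grassmann_generator c m Q | c Q. c \<in> A \<and> open Q}"
        using c open_UNIV by blast
    qed
  qed
  moreover have "compactin (top_of_set (K \<times> ?G)) (K \<times> ?G)"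
    by (simp add: compactin_subtopology compact_Times K(1) compact_grassmannian)
  ultimately have "compactin (grassmann_topology A m) (\<Phi> ` (K \<times> ?G))" by (intro image_compactin)
  moreover have "\<Phi> ` (K \<times> ?G) = {(p, S :: 'e set) \<in> grassmann_bundle m. p \<in> chart_inv c ` K}"
  proof (intro subset_antisym subsetI)
    fix x assume "x \<in> \<Phi> ` (K \<times> ?G)"
    then show "x \<in> {(p, S :: 'e set) \<in> grassmann_bundle m. p \<in> chart_inv c ` K}"
      using \<Phi>_in by (force simp: \<Phi>_def)
  next
    fix x assume "x \<in> {(p, S :: 'e set) \<in> grassmann_bundle m. p \<in> chart_inv c ` K}"
    then obtain y S where y: "y \<in> K" "x = (chart_inv c y, S)" "x \<in> grassmann_bundle m" by auto
    note cp = chart_deriv_plane[OF c pc(1)[OF y(1)] y(3)[unfolded y(2)]]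
    have "chart_inv_deriv A c (chart_inv c y) ` range (blinfun_apply (plane_proj (chart_deriv A c (chart_inv c y) ` S))) = S"
      unfolding range_plane_proj[OF cp(2)] image_image chart_deriv_inverse(2)[OF c pc(1)[OF y(1)]] by simp
    then have "\<Phi> (y, plane_proj (chart_deriv A c (chart_inv c y) ` S)) = x"
      by (simp only: \<Phi>_def prod.case y(2))
    then show "x \<in> \<Phi> ` (K \<times> ?G)"
      using y(1) cp(1) by (intro image_eqI[where f = \<Phi>]) auto
  qed
  ultimately show ?thesis by simp
qed

end

section \<open>Measurability and boundedness of the divergence\<close>

text \<open>An unsymmetrized polarization of \<open>lie_form\<close>: trace invariance and the
  coefficient bounds ask only for bilinearity.\<close>

lemma (in metric_on) lie_form_bilinear:
  assumes y: "y \<in> U" and w: "w differentiable (at y)"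
  shows "bilinear (\<lambda>u v. G y (frechet_derivative w (at y) u) v + frechet_derivative (\<lambda>z. G z u v) (at y) (w y) / 2)"
proof -
  have lw: "linear (frechet_derivative w (at y))" using w frechet_derivative_works has_derivative_linear by blast
  have d: "(\<lambda>z. G z u v) differentiable (at y)" for u v using G_Ck1 y by (auto simp: Ck1_iff)
  have l1: "linear (\<lambda>v. frechet_derivative (\<lambda>z. G z u v) (at y) h)" for u h
    by (rule Ck1_family_derivative_linear[OF open_U y _ d]) (rule bilinear_linear2[OF G_bilinear])
  have l2: "linear (\<lambda>u. frechet_derivative (\<lambda>z. G z u v) (at y) h)" for v h
    by (rule Ck1_family_derivative_linear[where T = "\<lambda>z u. G z u v", OF open_U y _ d]) (rule bilinear_linear1[OF G_bilinear])
  show ?thesis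
    using bilinear_ladd[OF G_bilinear[OF y]] bilinear_radd[OF G_bilinear[OF y]]
      bilinear_lmul[OF G_bilinear[OF y]] bilinear_rmul[OF G_bilinear[OF y]]
      linear_add[OF lw] linear_cmul[OF lw] linear_add[OF l1] linear_cmul[OF l1] linear_add[OF l2] linear_cmul[OF l2]
    by (auto simp: bilinear_def algebra_simps intro!: linearI)
qed

lemma measurable_linear_family:
  fixes T :: "'x \<Rightarrow> 'b::euclidean_space \<Rightarrow> 'c::euclidean_space"
  assumes lin: "\<And>x. x \<in> space M \<Longrightarrow> linear (T x)"
    and T: "\<And>v. (\<lambda>x. T x v) \<in> borel_measurable M" and r: "r \<in> borel_measurable M"
  shows "(\<lambda>x. T x (r x)) \<in> borel_measurable M"
proof -
  have "(\<lambda>x. \<Sum>b\<in>Basis. (r x \<bullet> b) *\<^sub>R T x b) \<in> borel_measurable M"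
    by (intro borel_measurable_sum borel_measurable_scaleR borel_measurable_inner r T borel_measurable_const)
  moreover have "(\<Sum>b\<in>Basis. (r x \<bullet> b) *\<^sub>R T x b) = T x (r x)" if "x \<in> space M" for x
    using linear_sum[OF lin[OF that], of "\<lambda>b. (r x \<bullet> b) *\<^sub>R b" Basis] linear_cmul[OF lin[OF that]]
    by (simp add: euclidean_representation)
  ultimately show ?thesis by (simp cong: measurable_cong)
qed

lemma measurable_bilinear_family:
  fixes G :: "'x \<Rightarrow> 'e::euclidean_space \<Rightarrow> 'e \<Rightarrow> real"
  assumes bil: "\<And>x. x \<in> space M \<Longrightarrow> bilinear (G x)" and G: "\<And>u v. (\<lambda>x. G x u v) \<in> borel_measurable M"
    and r: "r \<in> borel_measurable M" and s: "s \<in> borel_measurable M"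
  shows "(\<lambda>x. G x (r x) (s x)) \<in> borel_measurable M"
proof (rule measurable_linear_family[where T = "\<lambda>x v. G x (r x) v", OF _ _ s])
  show "linear (G x (r x))" if "x \<in> space M" for x using bil[OF that] by (rule bilinear_linear2)
  show "(\<lambda>x. G x (r x) v) \<in> borel_measurable M" for v
    by (rule measurable_linear_family[where T = "\<lambda>x u. G x u v", OF _ G r]) (use bil bilinear_linear1 in blast)
qed

lemma measurable_gs_frame:
  fixes G :: "'x \<Rightarrow> 'e::euclidean_space \<Rightarrow> 'e \<Rightarrow> real"
  assumes bil: "\<And>x. x \<in> space M \<Longrightarrow> bilinear (G x)" and G: "\<And>u v. (\<lambda>x. G x u v) \<in> borel_measurable M"
    and u: "\<And>i. (\<lambda>x. u x i) \<in> borel_measurable M"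
  shows "(\<lambda>x. gs_frame (G x) (u x) n) \<in> borel_measurable M"
proof (induction n rule: less_induct)
  case (less n)
  define r where "r x = u x n - (\<Sum>i<n. G x (u x n) (gs_frame (G x) (u x) i) *\<^sub>R gs_frame (G x) (u x) i)" for x
  have r: "r \<in> borel_measurable M" unfolding r_def
    by (intro borel_measurable_diff borel_measurable_sum borel_measurable_scaleR u measurable_bilinear_family[OF bil G] less) auto
  have "(\<lambda>x. inverse (sqrt (G x (r x) (r x))) *\<^sub>R r x) \<in> borel_measurable M"
    by (intro borel_measurable_scaleR borel_measurable_inverse measurable_compose[OF _ borel_measurable_sqrt]
        measurable_bilinear_family[OF bil G r r] r)
  moreover have "(\<lambda>x. inverse (sqrt (G x (r x) (r x))) *\<^sub>R r x) = (\<lambda>x. gs_frame (G x) (u x) n)"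
    by (subst gs_frame.simps) (simp add: r_def Let_def)
  ultimately show ?case by simp
qed

context metric_on begin

lemma measurable_on_U:
  fixes f :: "'e \<Rightarrow> 'b::topological_space"
  assumes "continuous_on U f" "y \<in> borel_measurable M" "y \<in> space M \<rightarrow> U"
  shows "(\<lambda>x. f (y x)) \<in> borel_measurable M"
proof -
  have "y \<in> measurable M (restrict_space borel U)" using assms by (intro measurable_restrict_space2) auto
  from measurable_compose[OF this borel_measurable_continuous_on_restrict[OF assms(1)]] show ?thesis .
qed

lemma measurable_lie_form:
  assumes w: "Ck_on 1 U w" and y: "y \<in> borel_measurable M" "y \<in> space M \<rightarrow> U" and e: "e \<in> borel_measurable M"
  shows "(\<lambda>x. lie_form G w (y x) (e x)) \<in> borel_measurable M"
proof -
  define q where "q x u v = G (y x) (frechet_derivative w (at (y x)) u) v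
     + frechet_derivative (\<lambda>z. G z u v) (at (y x)) (w (y x)) / 2" for x u v
  have yU: "y x \<in> U" if "x \<in> space M" for x using y that by auto
  have bil: "bilinear (G (y x))" if "x \<in> space M" for x using G_bilinear yU that by blast
  note mG = measurable_on_U[OF Ck1_continuous[OF G_Ck1] y]
  have mq: "(\<lambda>x. q x u v) \<in> borel_measurable M" for u v
  proof -
    have "(\<lambda>x. frechet_derivative (\<lambda>z. G z u v) (at (y x)) (w (y x))) \<in> borel_measurable M"
    proof (rule measurable_linear_family[where T = "\<lambda>x. frechet_derivative (\<lambda>z. G z u v) (at (y x))"])
      show "linear (frechet_derivative (\<lambda>z. G z u v) (at (y x)))" if "x \<in> space M" for x
        using Ck1_has_derivative[OF G_Ck1 yU[OF that]] by (rule has_derivative_linear)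
      show "(\<lambda>x. frechet_derivative (\<lambda>z. G z u v) (at (y x)) h) \<in> borel_measurable M" for h
        by (rule measurable_on_U[OF Ck1_continuous_derivative[OF G_Ck1] y])
      show "(\<lambda>x. w (y x)) \<in> borel_measurable M" by (rule measurable_on_U[OF Ck1_continuous[OF w] y])
    qed
    moreover have "(\<lambda>x. G (y x) (frechet_derivative w (at (y x)) u) v) \<in> borel_measurable M"
      by (rule measurable_bilinear_family[OF bil mG measurable_on_U[OF Ck1_continuous_derivative[OF w] y]]) simp_all
    ultimately show ?thesis unfolding q_def by simp
  qed
  have bq: "bilinear (q x)" if "x \<in> space M" for x
    unfolding q_def using lie_form_bilinear[OF yU[OF that]] w yU[OF that] by (auto simp: Ck1_iff)
  have "(\<lambda>x. q x (e x) (e x)) \<in> borel_measurable M"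
    by (rule measurable_bilinear_family[where G = q, OF bq mq e e])
  then show ?thesis by (simp add: q_def lie_form_def)
qed

text \<open>The minimum over \<open>K\<close> times the unit sphere, extended by
  homogeneity.\<close>

lemma ellipticity_on_compact:
  assumes K: "compact K" "K \<subseteq> U"
  obtains l where "0 < l" "\<And>y u. y \<in> K \<Longrightarrow> l * (norm u)\<^sup>2 \<le> G y u u"
proof (cases "K = {}")
  case False
  have cont: "continuous_on (K \<times> sphere 0 1) (\<lambda>x. G (fst x) (snd x) (snd x))"
  proof (rule continuous_on_bilinear_family[where G = "\<lambda>x. G (fst x)"])
    show "bilinear (G (fst x))" if "x \<in> K \<times> sphere 0 1" for x using that K G_bilinear by auto
    show "continuous_on (K \<times> sphere 0 1) (\<lambda>x. G (fst x) u v)" for u v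
      by (rule continuous_on_compose2[OF Ck1_continuous[OF G_Ck1]]) (use K in \<open>auto intro!: continuous_intros\<close>)
  qed (intro continuous_intros)+
  have comp: "compact (K \<times> sphere (0::'e) 1)" by (intro compact_Times K compact_sphere)
  obtain i :: 'e where "i \<in> Basis" using nonempty_Basis by blast
  then have ne: "K \<times> sphere (0::'e) 1 \<noteq> {}" using False by auto
  from continuous_attains_inf[OF comp ne cont]
  obtain x where x: "x \<in> K \<times> sphere 0 1"
      "\<And>z. z \<in> K \<times> sphere 0 1 \<Longrightarrow> G (fst x) (snd x) (snd x) \<le> G (fst z) (snd z) (snd z)"
    by blast
  define l where "l = G (fst x) (snd x) (snd x)"
  interpret x: pos_def_form "G (fst x)" using x(1) K by (intro pos_def) auto
  have "0 < l" unfolding l_def using x(1) by (intro x.pos) auto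
  moreover have "l * (norm u)\<^sup>2 \<le> G y u u" if y: "y \<in> K" for y u
  proof (cases "u = 0")
    case False
    interpret pos_def_form "G y" using y K by (intro pos_def) auto
    have "l \<le> G y (inverse (norm u) *\<^sub>R u) (inverse (norm u) *\<^sub>R u)"
      unfolding l_def using x(2)[of "(y, inverse (norm u) *\<^sub>R u)"] y False by simp
    then show ?thesis using False by (simp add: b_simps field_simps power2_eq_square)
  next
    case True
    then show ?thesis using bilinear_lzero[OF G_bilinear] y K by auto
  qed
  ultimately show ?thesis using that by blast
next
  case True
  then show ?thesis using that[of 1] by simp
qed

text \<open>The coefficients of the polarized form are continuous in \<open>y\<close>, and
  ellipticity bounds the Euclidean norm of vectors that are unit for the metric.\<close>

lemma lie_form_bounded_on_compact:
  assumes w: "Ck_on 1 U w" and K: "compact K" "K \<subseteq> U"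
  obtains D where "0 \<le> D" "\<And>y e. y \<in> K \<Longrightarrow> G y e e = 1 \<Longrightarrow> \<bar>lie_form G w y e\<bar> \<le> D"
proof -
  obtain l where l: "0 < l" "\<And>y u. y \<in> K \<Longrightarrow> l * (norm u)\<^sup>2 \<le> G y u u" using ellipticity_on_compact[OF K] by metis
  define q where "q y u v = G y (frechet_derivative w (at y) u) v
     + frechet_derivative (\<lambda>z. G z u v) (at y) (w y) / 2" for y u v
  define F where "F y = (\<Sum>i\<in>Basis. \<Sum>j\<in>Basis. \<bar>q y i j\<bar>)" for y
  have lin: "linear (frechet_derivative (\<lambda>z. G z u v) (at y))" if "y \<in> U" for y u v
    using Ck1_has_derivative[OF G_Ck1 that] by (rule has_derivative_linear)
  have "continuous_on U (\<lambda>y. q y u v)" for u v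
  proof -
    have 1: "continuous_on U (\<lambda>y. G y (frechet_derivative w (at y) u) v)"
      by (rule continuous_on_bilinear_family[OF G_bilinear Ck1_continuous[OF G_Ck1] Ck1_continuous_derivative[OF w] continuous_on_const])
    have 2: "continuous_on U (\<lambda>y. frechet_derivative (\<lambda>z. G z u v) (at y) (w y))"
      by (rule continuous_on_linear_family[OF lin Ck1_continuous_derivative[OF G_Ck1] Ck1_continuous[OF w]])
    show ?thesis unfolding q_def by (rule continuous_on_add[OF 1 continuous_on_divide[OF 2 continuous_on_const]]) simp
  qed
  then have "continuous_on U F" unfolding F_def by (intro continuous_on_sum continuous_on_rabs)
  from compact_imp_bounded[OF compact_continuous_image[OF continuous_on_subset[OF this K(2)] K(1)]]
  have "bounded (F ` K)" .
  then obtain b where b: "\<forall>x\<in>F ` K. norm x \<le> b" unfolding bounded_iff by blast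
  have F0: "0 \<le> F y" for y unfolding F_def by (intro sum_nonneg) auto
  show thesis
  proof (rule that[of "\<bar>b\<bar> / l"])
    show "0 \<le> \<bar>b\<bar> / l" using l by simp
    fix y e assume y: "y \<in> K" "G y e e = 1"
    have bil: "bilinear (q y)"
      unfolding q_def using lie_form_bilinear[of y w] w y(1) K(2) by (auto simp: Ck1_iff)
    have "\<bar>lie_form G w y e\<bar> \<le> F y * norm e * norm e"
      using bilinear_bound_Basis[OF bil, of e e] by (simp add: F_def lie_form_def q_def)
    also have "\<dots> = F y * (norm e)\<^sup>2" by (simp add: power2_eq_square)
    also have "\<dots> \<le> \<bar>b\<bar> * (1 / l)"
    proof (rule mult_mono)
      show "F y \<le> \<bar>b\<bar>" using b y(1) F0[of y] by force
      show "(norm e)\<^sup>2 \<le> 1 / l" using l(2)[OF y(1), of e] y(2) l(1) by (simp add: field_simps)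
    qed auto
    finally show "\<bar>lie_form G w y e\<bar> \<le> \<bar>b\<bar> / l" by simp
  qed
qed

end

lemma (in metric_on) lie_form_trace_independent:
  assumes w: "Ck_on 1 U w" and y: "y \<in> U"
    and I: "orthonormal_basis_of (G y) S I" and J: "orthonormal_basis_of (G y) S J"
  shows "(\<Sum>e\<in>I. lie_form G w y e) = (\<Sum>e\<in>J. lie_form G w y e)"
proof -
  have "bilinear (\<lambda>u v. G y (frechet_derivative w (at y) u) v + frechet_derivative (\<lambda>z. G z u v) (at y) (w y) / 2)"
    using w y by (intro lie_form_bilinear) (auto simp: Ck1_iff)
  from pos_def_form.orthonormal_basis_trace[OF pos_def[OF y] I J this]
  show ?thesis by (simp add: lie_form_def)
qed

lemma (in pos_def_form) cauchy_schwarz: "\<bar>b u v\<bar> \<le> sqrt (b u u) * sqrt (b v v)"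
proof (cases "v = 0")
  case False
  then have v: "0 < b v v" by (rule pos)
  define t where "t = b u v / b v v"
  have "0 \<le> b (u - t *\<^sub>R v) (u - t *\<^sub>R v)" by (rule b_nonneg)
  also have "\<dots> = b u u - (b u v)\<^sup>2 / b v v"
    using v by (simp add: b_simps t_def sym[of v u] power2_eq_square field_simps)
  finally have "(b u v)\<^sup>2 \<le> b u u * b v v" using v by (simp add: field_simps)
  from real_sqrt_le_mono[OF this] show ?thesis by (simp only: real_sqrt_abs real_sqrt_mult)
qed (simp add: b_simps)

section \<open>Varifolds: measurability and finiteness over compact sets\<close>

lemma (in smooth_manifold) varifold_fst_measurable:
  assumes "varifold A m V" shows "fst \<in> borel_measurable V"
proof (rule borel_measurableI)
  fix U :: "'a set" assume "open U"
  then have "{(p, S :: 'e set) \<in> grassmann_bundle m. p \<in> U} \<in> sets V"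
    using assms openin_grassmann_fst by (auto simp: varifold_def)
  moreover have "fst -` U \<inter> space V = {(p, S :: 'e set) \<in> grassmann_bundle m. p \<in> U}"
    using assms by (auto simp: varifold_def)
  ultimately show "fst -` U \<inter> space V \<in> sets V" by simp
qed

lemma (in smooth_manifold) varifold_chart_measurable:
  assumes V: "varifold A m V" and c: "c \<in> A"
  shows "(\<lambda>(p, S). (snd c p, plane_proj (chart_deriv A c p ` S)))
    \<in> borel_measurable (restrict_space V {(p, S). p \<in> fst c})" (is "?f \<in> borel_measurable ?M")
proof (rule borel_measurableI)
  fix Q :: "('e \<times> ('e \<Rightarrow>\<^sub>L 'e)) set" assume Q: "open Q"
  have "grassmann_generator c m Q \<in> sets V"
    using V openin_grassmann_generator[OF c Q] by (auto simp: varifold_def)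
  moreover have "?f -` Q \<inter> space ?M = {(p, S). p \<in> fst c} \<inter> grassmann_generator c m Q"
    using V by (auto simp: varifold_def space_restrict_space grassmann_generator_def)
  ultimately show "?f -` Q \<inter> space ?M \<in> sets ?M" by (auto simp: sets_restrict_space)
qed

lemma (in smooth_manifold) weight_emeasure:
  assumes "varifold A m V" "B \<in> sets borel"
  shows "emeasure (weight V) B = emeasure V {(p, S) \<in> grassmann_bundle m. p \<in> B}"
proof -
  have "fst -` B \<inter> space V = {(p, S) \<in> grassmann_bundle m. p \<in> B}" using assms by (auto simp: varifold_def)
  then show ?thesis
    unfolding weight_def using emeasure_distr[OF varifold_fst_measurable[OF assms(1)] assms(2)] by simp
qed

lemma (in smooth_manifold) weight_chart_compact_finite:
  assumes V: "varifold A m V" and c: "c \<in> A" and K: "compact K" "K \<subseteq> chart_image c"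
  shows "emeasure (weight V) (chart_inv c ` K) < \<infinity>"
proof -
  have "chart_inv c ` K \<in> sets borel"
    using compact_chart_inv[OF c K] by (intro borel_compact)
  from weight_emeasure[OF V this] compactin_grassmann[OF c K, of m] V
  show ?thesis by (simp add: varifold_def)
qed

section \<open>The divergence of a field given in a chart\<close>

context riemannian begin

lemma g_pos_def: "pos_def_form (g p)"
  by unfold_locales (auto simp: g_bilinear g_pos intro: g_sym)

lemma metric_on_chart: "c \<in> A \<Longrightarrow> metric_on (chart_image c) (metric_rep A g c)"
  by (intro metric_on.intro open_chart metric_rep_Ck1 pos_def_form.intro metric_rep_bilinear metric_rep_sym metric_rep_pos)

context
  fixes c and w :: "'e \<Rightarrow> 'e" and K
  assumes c: "c \<in> A" and w: "Ck_on 1 (chart_image c) w"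
    and K: "compact K" "K \<subseteq> chart_image c" and w0: "\<forall>y\<in>chart_image c - K. w y = 0"
begin

text \<open>Such a point may lie outside the domain of \<open>c\<close>, so the computation runs in
  the chart selected at \<open>p\<close>, where the field vanishes on a whole neighbourhood.\<close>

lemma plane_div_chart_field_zero:
  assumes p: "p \<notin> chart_inv c ` K"
  shows "plane_div A g (chart_field c w) p S = 0"
proof -
  define b where "b = chart_at A p"
  have b: "b \<in> A" "p \<in> fst b" by (simp_all add: b_def chart_at_in)
  define U where "U = snd b ` (fst b \<inter> - (chart_inv c ` K))"
  have U: "open U" unfolding U_def
    by (intro open_chart_image b open_Compl compact_imp_closed compact_chart_inv c K)
  have pU: "snd b p \<in> U" using p b by (auto simp: U_def)
  have rep: "(field_rep A b (chart_field c w) \<circ> chart_inv b) y = 0" if yU: "y \<in> U" for y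
  proof -
    obtain q where q: "q \<in> fst b" "q \<notin> chart_inv c ` K" "y = snd b q" using yU by (auto simp: U_def)
    then show ?thesis
      using field_rep_linear0[where X = "chart_field c w", OF b(1) q(1) chart_field_zero[OF c w K w0 q(2)]] b by (simp add: chart_inv_chart)
  qed
  have "frechet_derivative (field_rep A b (chart_field c w) \<circ> chart_inv b) (at (snd b p)) = (\<lambda>x. 0)"
    using frechet_derivative_cong_open[where g = "\<lambda>y. 0", OF U pU rep] by (simp only: frechet_derivative_const)
  moreover have "linear (frechet_derivative (\<lambda>z. metric_rep A g b z e e) (at (snd b p)))" for e
    using Ck1_has_derivative[OF metric_rep_Ck1[OF b(1)]] b(2) by (intro has_derivative_linear) auto
  moreover have "bilinear (metric_rep A g b (snd b p))" using b by (intro metric_rep_bilinear) auto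
  ultimately have "g p (cov_deriv A g (chart_field c w) p e) e = 0" for e
    unfolding cov_deriv_self b_def[symmetric] lie_form_def using rep[OF pU]
    by (simp add: linear_0 bilinear_lzero)
  then show ?thesis by (simp add: plane_div_def)
qed

text \<open>The chart differential is an isometry onto the coordinate metric; \<open>I\<close> is
  the image of the basis chosen in \<open>plane_div\<close>.\<close>

lemma plane_div_chart_field:
  assumes p: "p \<in> fst c" and S: "subspace S"
  shows "\<exists>I. orthonormal_basis_of (metric_rep A g c (snd c p)) (chart_deriv A c p ` S) I \<and>
    plane_div A g (chart_field c w) p S = (\<Sum>e\<in>I. lie_form (metric_rep A g c) w (snd c p) e)"
proof -
  define B where "B = (SOME B. orthonormal_basis_of (g p) S B)"
  have B: "orthonormal_basis_of (g p) S B"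
    unfolding B_def by (rule someI_ex[OF pos_def_form.orthonormal_basis_of_subspace_exists[OF g_pos_def S]])
  define I where "I = chart_deriv A c p ` B"
  have inj: "inj (chart_deriv A c p)" using c p by (metis chart_deriv_inverse(2) injI)
  have eq_iff: "chart_deriv A c p u = chart_deriv A c p v \<longleftrightarrow> u = v" for u v using inj by (simp add: inj_eq)
  have "orthonormal_basis_of (metric_rep A g c (snd c p)) (chart_deriv A c p ` S) I"
    using B linear_span_image[OF chart_deriv_linear[OF c p], of B]
    unfolding orthonormal_basis_of_def I_def
    by (auto simp: g_metric_rep[OF c p] eq_iff)
  moreover have "plane_div A g (chart_field c w) p S = (\<Sum>e\<in>I. lie_form (metric_rep A g c) w (snd c p) e)"
  proof -
    have y: "snd c p \<in> chart_image c" using p by simp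
    have rep: "(field_rep A c (chart_field c w) \<circ> chart_inv c) z = w z" if "z \<in> chart_image c" for z
      using field_rep_chart_field[OF c w K w0 chart_inv_in[OF that]] chart_chart_inv[OF that] by simp
    have "frechet_derivative (field_rep A c (chart_field c w) \<circ> chart_inv c) (at (snd c p)) = frechet_derivative w (at (snd c p))"
      by (rule frechet_derivative_cong_open[OF open_chart(2)[OF c] y rep])
    then have "g p (cov_deriv A g (chart_field c w) p e) e = lie_form (metric_rep A g c) w (snd c p) (chart_deriv A c p e)" for e
      unfolding cov_deriv_chart[OF C1_field_chart_field[OF c w K w0] c p] lie_form_def using rep[OF y] by simp
    then show ?thesis
      unfolding plane_div_def B_def[symmetric] Let_def I_def
      using inj by (simp add: sum.reindex inj_on_subset[OF inj])
  qed
  ultimately show ?thesis by blast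
qed

text \<open>The projections of a basis of the model space span the plane. Those that depend on
  earlier ones produce zero frame vectors, on which \<open>lie_form\<close> vanishes, so all
  \<open>DIM('e)\<close> terms may be summed.\<close>

lemma plane_div_gs_frame:
  assumes p: "p \<in> fst c" and S: "(p, S) \<in> grassmann_bundle m"
    and l: "set l = (Basis :: 'e set)" "length l = DIM('e)"
  shows "plane_div A g (chart_field c w) p S = (\<Sum>n<DIM('e). lie_form (metric_rep A g c) w (snd c p)
    (gs_frame (metric_rep A g c (snd c p)) (\<lambda>i. plane_proj (chart_deriv A c p ` S) (l ! i)) n))"
proof -
  interpret metric_on "chart_image c" "metric_rep A g c" by (rule metric_on_chart[OF c])
  have y: "snd c p \<in> chart_image c" using p by simp
  interpret pos_def_form "metric_rep A g c (snd c p)" by (rule pos_def[OF y])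
  note T = chart_deriv_plane[OF c p S]
  have "subspace S" using S by (simp add: grassmann_bundle_def)
  then obtain I where I: "orthonormal_basis_of (metric_rep A g c (snd c p)) (chart_deriv A c p ` S) I"
    "plane_div A g (chart_field c w) p S = (\<Sum>e\<in>I. lie_form (metric_rep A g c) w (snd c p) e)"
    using plane_div_chart_field[OF p] by blast
  let ?u = "\<lambda>i. plane_proj (chart_deriv A c p ` S) (l ! i)"
  have "(!) l ` {..<DIM('e)} = Basis" using l by (auto simp: set_conv_nth)
  then have "?u ` {..<DIM('e)} = blinfun_apply (plane_proj (chart_deriv A c p ` S)) ` Basis"
    by (metis image_image)
  then have "span (?u ` {..<DIM('e)}) = range (blinfun_apply (plane_proj (chart_deriv A c p ` S)))"
    using linear_span_image[of "blinfun_apply (plane_proj (chart_deriv A c p ` S))" Basis]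
    by (simp add: bounded_linear.linear blinfun.bounded_linear_right)
  also have "\<dots> = chart_deriv A c p ` S" by (rule range_plane_proj[OF T(2)])
  finally have "orthonormal_basis_of (metric_rep A g c (snd c p)) (chart_deriv A c p ` S) (frame_set ?u DIM('e))"
    using frame_set_orthonormal_basis[of ?u "DIM('e)"] by (simp only:)
  from lie_form_trace_independent[OF w y I(1) this]
  have "plane_div A g (chart_field c w) p S = (\<Sum>e\<in>frame_set ?u DIM('e). lie_form (metric_rep A g c) w (snd c p) e)"
    using I(2) by simp
  also have "\<dots> = (\<Sum>n<DIM('e). lie_form (metric_rep A g c) w (snd c p) (gs_frame (metric_rep A g c (snd c p)) ?u n))"
  proof (rule frame_set_sum)
    have "linear (frechet_derivative w (at (snd c p)))"
      using Ck1_has_derivative[OF w y] by (rule has_derivative_linear)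
    then show "lie_form (metric_rep A g c) w (snd c p) 0 = 0"
      using frechet_derivative_cong_open[OF open_U y, of "\<lambda>z. metric_rep A g c z 0 0" "\<lambda>z. 0"] bilinear_lzero[OF G_bilinear]
      by (simp add: lie_form_def linear_0 b_simps)
  qed
  finally show ?thesis .
qed

text \<open>
  Integrability has to be proved: \<open>first_variation\<close> is a Bochner integral and would silently be \<open>0\<close>
  otherwise.  Gram-Schmidt applied to the projected basis gives a Borel choice of frames.
\<close>

lemma plane_div_chart_field_measurable:
  assumes V: "varifold A m V"
  shows "(\<lambda>(p, S). plane_div A g (chart_field c w) p S) \<in> borel_measurable V"
proof -
  interpret metric_on "chart_image c" "metric_rep A g c" by (rule metric_on_chart[OF c])
  obtain l where l: "set l = (Basis :: 'e set)" "length l = DIM('e)" using Basis_list by blast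
  let ?D = "{(p, S :: 'e set). p \<in> fst c}"
  define M where "M = restrict_space V ?D"
  have sp: "space M = {(p, S) \<in> grassmann_bundle m. p \<in> fst c}"
    using V by (auto simp: M_def space_restrict_space varifold_def)
  have D: "?D \<inter> space V \<in> sets V"
  proof -
    have "fst -` fst c \<inter> space V \<in> sets V"
      using varifold_fst_measurable[OF V] borel_open[OF open_chart(1)[OF c]] by (rule measurable_sets)
    moreover have "?D \<inter> space V = fst -` fst c \<inter> space V" by auto
    ultimately show ?thesis by simp
  qed
  define y where "y x = snd c (fst x)" for x :: "'a \<times> 'e set"
  define R where "R x = plane_proj (chart_deriv A c (fst x) ` snd x)" for x :: "'a \<times> 'e set"
  have yR: "(\<lambda>x. (y x, R x)) \<in> borel_measurable M"
    using varifold_chart_measurable[OF V c] by (simp add: M_def y_def R_def case_prod_beta')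
  have y: "y \<in> borel_measurable M"
    using measurable_compose[OF yR borel_measurable_continuous_onI[of fst]] by (simp add: continuous_on_fst)
  have yU: "y \<in> space M \<rightarrow> chart_image c" by (auto simp: sp y_def)
  have R: "(\<lambda>x. blinfun_apply (R x) v) \<in> borel_measurable M" for v
    using measurable_compose[OF yR borel_measurable_continuous_onI[of "\<lambda>x. blinfun_apply (snd x) v"]]
    by (simp add: continuous_on_blinfun_apply continuous_on_snd)
  have bil: "bilinear (metric_rep A g c (y x))" if "x \<in> space M" for x
    using that yU G_bilinear by blast
  define E where "E n x = gs_frame (metric_rep A g c (y x)) (\<lambda>i. blinfun_apply (R x) (l ! i)) n" for n x
  have E: "E n \<in> borel_measurable M" for n
    unfolding E_def[abs_def]
    by (rule measurable_gs_frame[where G = "\<lambda>x. metric_rep A g c (y x)" and u = "\<lambda>x i. blinfun_apply (R x) (l ! i)",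
          OF bil measurable_on_U[OF Ck1_continuous[OF G_Ck1] y yU] R])
  have "(\<lambda>x. \<Sum>n<DIM('e). lie_form (metric_rep A g c) w (y x) (E n x)) \<in> borel_measurable M"
    by (intro borel_measurable_sum measurable_lie_form w y yU E)
  moreover have "(\<lambda>(p, S). plane_div A g (chart_field c w) p S) x
      = (\<Sum>n<DIM('e). lie_form (metric_rep A g c) w (y x) (E n x))" if "x \<in> space M" for x
    using that plane_div_gs_frame[OF _ _ l] by (auto simp: sp y_def E_def R_def)
  ultimately have "(\<lambda>(p, S). plane_div A g (chart_field c w) p S) \<in> borel_measurable M"
    by (subst measurable_cong)
  then have "(\<lambda>x. indicator ?D x *\<^sub>R (\<lambda>(p, S). plane_div A g (chart_field c w) p S) x) \<in> borel_measurable V"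
    unfolding M_def by (subst (asm) borel_measurable_restrict_space_iff[OF D])
  \<comment> \<open>Off the domain of \<open>c\<close> the divergence is already \<open>0\<close>,
    so restriction to the chart loses nothing.\<close>
  moreover have "(\<lambda>x. indicator ?D x *\<^sub>R (\<lambda>(p, S). plane_div A g (chart_field c w) p S) x)
     = (\<lambda>(p, S). plane_div A g (chart_field c w) p S)"
  proof
    fix x :: "'a \<times> 'e set"
    have "fst x \<in> fst c" if "fst x \<in> chart_inv c ` K"
      using that chart_inv_in[OF subsetD[OF K(2)]] by auto
    then have "plane_div A g (chart_field c w) (fst x) (snd x) = 0" if "fst x \<notin> fst c"
      using that plane_div_chart_field_zero[of "fst x" "snd x"] by blast
    then show "indicator ?D x *\<^sub>R (\<lambda>(p, S). plane_div A g (chart_field c w) p S) x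
       = (\<lambda>(p, S). plane_div A g (chart_field c w) p S) x"
      by (cases "fst x \<in> fst c") (simp_all add: indicator_def case_prod_beta)
  qed
  ultimately show ?thesis by simp
qed

lemma plane_div_chart_field_bounded:
  obtains D where "0 \<le> D" "\<And>(p :: 'a) (S :: 'e set). (p, S) \<in> grassmann_bundle m \<Longrightarrow> \<bar>plane_div A g (chart_field c w) p S\<bar> \<le> D"
proof -
  interpret metric_on "chart_image c" "metric_rep A g c" by (rule metric_on_chart[OF c])
  obtain D where D: "0 \<le> D" "\<And>y e. y \<in> K \<Longrightarrow> metric_rep A g c y e e = 1 \<Longrightarrow> \<bar>lie_form (metric_rep A g c) w y e\<bar> \<le> D"
    using lie_form_bounded_on_compact[OF w K] by blast
  show thesis
  proof (rule that[of "real m * D"])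
    show "0 \<le> real m * D" using D by simp
    fix p :: 'a and S :: "'e set" assume S: "(p, S) \<in> grassmann_bundle m"
    show "\<bar>plane_div A g (chart_field c w) p S\<bar> \<le> real m * D"
    proof (cases "p \<in> chart_inv c ` K")
      case True
      then obtain y where y: "y \<in> K" "p = chart_inv c y" by blast
      then have p: "p \<in> fst c" "snd c p = y"
        using chart_inv_in[OF subsetD[OF K(2) y(1)]] chart_chart_inv[OF subsetD[OF K(2) y(1)]] by auto
      have "subspace S" using S by (simp add: grassmann_bundle_def)
      then obtain I where I: "orthonormal_basis_of (metric_rep A g c y) (chart_deriv A c p ` S) I"
        "plane_div A g (chart_field c w) p S = (\<Sum>e\<in>I. lie_form (metric_rep A g c) w y e)"
        using plane_div_chart_field[OF p(1)] unfolding p(2) by blast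
      interpret pos_def_form "metric_rep A g c y" using y K by (intro pos_def) auto
      have "\<bar>\<Sum>e\<in>I. lie_form (metric_rep A g c) w y e\<bar> \<le> (\<Sum>e\<in>I. D)"
        by (rule order_trans[OF sum_abs sum_mono]) (use D(2)[OF y(1)] orthonormal_basis_unit[OF I(1)] in auto)
      then show ?thesis
        using orthonormal_basis_card[OF I(1)] chart_deriv_plane(3)[OF c p(1) S] I(2) by simp
    next
      case False
      then show ?thesis using plane_div_chart_field_zero D by simp
    qed
  qed
qed

lemma plane_div_chart_field_integrable:
  assumes V: "varifold A m V"
  shows "integrable V (\<lambda>(p, S). plane_div A g (chart_field c w) p S)"
proof -
  obtain D where D: "0 \<le> D" "\<And>(p :: 'a) (S :: 'e set). (p, S) \<in> grassmann_bundle m \<Longrightarrow> \<bar>plane_div A g (chart_field c w) p S\<bar> \<le> D"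
    using plane_div_chart_field_bounded[of m] by blast
  let ?C = "{(p, S :: 'e set) \<in> grassmann_bundle m. p \<in> chart_inv c ` K}"
  have B: "chart_inv c ` K \<in> sets borel" using compact_chart_inv[OF c K] by (intro borel_compact)
  have sp: "space V = grassmann_bundle m" using V by (simp add: varifold_def)
  have C: "?C \<in> sets V"
  proof -
    have "?C = fst -` (chart_inv c ` K) \<inter> space V" unfolding sp by auto
    then show ?thesis using measurable_sets[OF varifold_fst_measurable[OF V] B] by simp
  qed
  have "emeasure V ?C < \<infinity>"
    using weight_chart_compact_finite[OF V c K] weight_emeasure[OF V B] by simp
  then show ?thesis
  proof (rule integrableI_bounded_set[OF C plane_div_chart_field_measurable[OF V]])
    show "AE x in V. x \<in> ?C \<longrightarrow> norm (case x of (p, S) \<Rightarrow> plane_div A g (chart_field c w) p S) \<le> D"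
      using D(2) by (intro AE_I2) auto
    show "AE x in V. x \<notin> ?C \<longrightarrow> (case x of (p, S) \<Rightarrow> plane_div A g (chart_field c w) p S) = 0"
      using plane_div_chart_field_zero by (intro AE_I2) (auto simp: sp)
  qed
qed

end

end

section \<open>The area estimate\<close>

text \<open>Induction over measurable functions; it splits integrals along the Lebesgue
  decomposition of the total variation.\<close>

lemma nn_integral_sum_measure:
  assumes s1: "sets M1 = sets M" and s2: "sets M2 = sets M"
    and M: "\<And>B. B \<in> sets M \<Longrightarrow> emeasure M B = emeasure M1 B + emeasure M2 B"
    and f: "f \<in> borel_measurable M"
  shows "(\<integral>\<^sup>+x. f x \<partial>M) = (\<integral>\<^sup>+x. f x \<partial>M1) + (\<integral>\<^sup>+x. f x \<partial>M2)"
  using f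
proof (induction rule: borel_measurable_induct)
  case (cong f g)
  have "(\<integral>\<^sup>+x. f x \<partial>M) = (\<integral>\<^sup>+x. g x \<partial>M)" "(\<integral>\<^sup>+x. f x \<partial>M1) = (\<integral>\<^sup>+x. g x \<partial>M1)"
     "(\<integral>\<^sup>+x. f x \<partial>M2) = (\<integral>\<^sup>+x. g x \<partial>M2)"
    using cong(3) sets_eq_imp_space_eq[OF s1] sets_eq_imp_space_eq[OF s2] by (auto intro!: nn_integral_cong)
  then show ?case using cong by simp
next
  case (set A)
  then show ?case using M s1 s2 by simp
next
  case (mult u c)
  then have "u \<in> borel_measurable M1" "u \<in> borel_measurable M2"
    using s1 s2 by (simp_all cong: measurable_cong_sets)
  then show ?case using mult by (simp add: nn_integral_cmult distrib_left)
next
  case (add u v)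
  then have "u \<in> borel_measurable M1" "u \<in> borel_measurable M2" "v \<in> borel_measurable M1" "v \<in> borel_measurable M2"
    using s1 s2 by (simp_all cong: measurable_cong_sets)
  then show ?case using add by (simp add: nn_integral_add ac_simps)
next
  case (seq U)
  have m: "U i \<in> borel_measurable M1" "U i \<in> borel_measurable M2" for i
    using seq(1)[of i] s1 s2 by (simp_all cong: measurable_cong_sets)
  have inc: "incseq (\<lambda>i. \<integral>\<^sup>+x. U i x \<partial>N)" for N
    using seq(3) by (intro incseq_nn_integral)
  have "(\<integral>\<^sup>+x. (SUP i. U i) x \<partial>M) = (SUP i. \<integral>\<^sup>+x. U i x \<partial>M)"
    using seq(1,3) by (simp add: nn_integral_monotone_convergence_SUP image_comp)
  also have "\<dots> = (SUP i. (\<integral>\<^sup>+x. U i x \<partial>M1) + (\<integral>\<^sup>+x. U i x \<partial>M2))"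
    using seq by simp
  also have "\<dots> = (SUP i. \<integral>\<^sup>+x. U i x \<partial>M1) + (SUP i. \<integral>\<^sup>+x. U i x \<partial>M2)"
    by (intro ennreal_SUP_add inc)
  also have "\<dots> = (\<integral>\<^sup>+x. (SUP i. U i) x \<partial>M1) + (\<integral>\<^sup>+x. (SUP i. U i) x \<partial>M2)"
    using m seq(3) by (simp add: nn_integral_monotone_convergence_SUP image_comp)
  finally show ?case .
qed

context riemannian begin

text \<open>The polar vector is unit, so \<open>\<rho>\<close> equals the length of \<open>H\<close>
  wherever it is positive, and hence \<open>\<rho> \<le> h\<close> almost everywhere. Cauchy-Schwarz
  and the decomposition of the total variation finish.\<close>

lemma first_variation_bound:
  assumes mcb: "mean_curvature_and_boundary A g V H \<beta>" and h: "0 \<le> h"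
    and curv: "AE p in weight V. sqrt (g p (H p) (H p)) \<le> h"
    and X: "test_field A X" and N: "(\<lambda>p. sqrt (g p (X p) (X p))) \<in> borel_measurable borel"
  shows "ennreal \<bar>first_variation A g V X\<bar> \<le> ennreal h * (\<integral>\<^sup>+p. ennreal (sqrt (g p (X p) (X p))) \<partial>weight V)
     + (\<integral>\<^sup>+p. ennreal (sqrt (g p (X p) (X p))) \<partial>\<beta>)"
proof -
  obtain \<mu> \<nu> \<rho> where tv: "total_variation_polar A g V \<mu> \<nu>" and rb: "radon_measure \<beta>"
    and \<rho>: "\<rho> \<in> borel_measurable borel" "\<And>p. (0::real) \<le> \<rho> p"
    and \<mu>: "\<And>B. B \<in> sets borel \<Longrightarrow> emeasure \<mu> B = emeasure (density (weight V) (\<lambda>p. ennreal (\<rho> p))) B + emeasure \<beta> B"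
    and H: "AE p in weight V. - H p = \<rho> p *\<^sub>R \<nu> p"
    using mcb unfolding mean_curvature_and_boundary_def by blast
  define W where "W = weight V"
  have sW: "sets W = sets borel" by (simp add: W_def weight_def)
  have s\<mu>: "sets \<mu> = sets borel" using tv by (simp add: total_variation_polar_def radon_measure_def)
  have s\<beta>: "sets \<beta> = sets borel" using rb by (simp add: radon_measure_def)
  have \<rho>W: "(\<lambda>p. ennreal (\<rho> p)) \<in> borel_measurable W"
    using \<rho>(1) sW by (simp cong: measurable_cong_sets)
  have \<nu>: "AE p in \<mu>. g p (\<nu> p) (\<nu> p) = 1" using tv by (simp add: total_variation_polar_def)
  have fv: "first_variation A g V X = (LINT p|\<mu>. g p (X p) (\<nu> p))"
    using tv X by (simp add: total_variation_polar_def)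
  obtain N0 where N0: "N0 \<in> null_sets \<mu>" "{p \<in> space \<mu>. g p (\<nu> p) (\<nu> p) \<noteq> 1} \<subseteq> N0"
    using \<nu> by (auto simp: eventually_ae_filter)
  have sp: "space \<mu> = UNIV" "space W = UNIV" using sets_eq_imp_space_eq[OF s\<mu>] sets_eq_imp_space_eq[OF sW] by auto
  \<comment> \<open>The polar vector has unit length only \<open>\<mu>\<close>-almost everywhere.
    Null sets of \<open>\<mu>\<close> are null for its absolutely continuous part, so unit length
    holds for weight-almost every point with \<open>\<rho> > 0\<close>.\<close>
  have "N0 \<in> null_sets (density W (\<lambda>p. ennreal (\<rho> p)))"
    using N0(1) \<mu>[of N0] s\<mu> sW by (auto simp: null_sets_def W_def)
  then have "AE p in density W (\<lambda>p. ennreal (\<rho> p)). g p (\<nu> p) (\<nu> p) = 1"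
    by (rule AE_I') (use N0(2) sp in auto)
  then have "AE p in W. 0 < ennreal (\<rho> p) \<longrightarrow> g p (\<nu> p) (\<nu> p) = 1"
    by (simp add: AE_density[OF \<rho>W])
  moreover have "AE p in W. sqrt (g p (H p) (H p)) \<le> h" "AE p in W. - H p = \<rho> p *\<^sub>R \<nu> p"
    unfolding W_def by (rule curv, rule H)
  ultimately have \<rho>h: "AE p in W. \<rho> p \<le> h"
  proof eventually_elim
    case (elim p)
    interpret pos_def_form "g p" by (rule g_pos_def)
    show ?case
    proof (cases "\<rho> p = 0")
      case False
      then have "0 < \<rho> p" using \<rho>(2)[of p] by simp
      moreover have "H p = - (\<rho> p *\<^sub>R \<nu> p)" using elim(3) by (metis minus_minus)
      then have "H p = (- \<rho> p) *\<^sub>R \<nu> p" by simp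
      then have "g p (H p) (H p) = (\<rho> p)\<^sup>2 * g p (\<nu> p) (\<nu> p)"
        by (simp only: b_simps power2_eq_square) simp
      ultimately show ?thesis using elim(1,2) by simp
    qed (simp add: h)
  qed
  let ?N = "\<lambda>p. ennreal (sqrt (g p (X p) (X p)))"
  have mN: "?N \<in> borel_measurable borel" using N by simp
  have NW: "?N \<in> borel_measurable W" "?N \<in> borel_measurable \<mu>"
    using mN sW s\<mu> by (simp_all cong: measurable_cong_sets)
  \<comment> \<open>A nonintegrable integrand has Bochner integral \<open>0\<close> and satisfies
    the bound trivially.\<close>
  have "ennreal \<bar>first_variation A g V X\<bar> \<le> (\<integral>\<^sup>+p. ennreal (norm (g p (X p) (\<nu> p))) \<partial>\<mu>)"
  proof (cases "integrable \<mu> (\<lambda>p. g p (X p) (\<nu> p))")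
    case True
    from integral_norm_bound_ennreal[OF this] show ?thesis by (simp add: fv)
  qed (simp add: fv not_integrable_integral_eq)
  also have "\<dots> \<le> (\<integral>\<^sup>+p. ?N p \<partial>\<mu>)"
  proof (rule nn_integral_mono_AE)
    show "AE p in \<mu>. ennreal (norm (g p (X p) (\<nu> p))) \<le> ?N p"
      using \<nu>
    proof eventually_elim
      case (elim p)
      interpret pos_def_form "g p" by (rule g_pos_def)
      show ?case using cauchy_schwarz[of "X p" "\<nu> p"] elim by (intro ennreal_leI) simp
    qed
  qed
  also have "\<dots> = (\<integral>\<^sup>+p. ?N p \<partial>density W (\<lambda>p. ennreal (\<rho> p))) + (\<integral>\<^sup>+p. ?N p \<partial>\<beta>)"
    by (rule nn_integral_sum_measure[OF _ _ _ NW(2)]) (use sW s\<mu> s\<beta> \<mu> in \<open>auto simp: W_def\<close>)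
  also have "(\<integral>\<^sup>+p. ?N p \<partial>density W (\<lambda>p. ennreal (\<rho> p))) = (\<integral>\<^sup>+p. ennreal (\<rho> p) * ?N p \<partial>W)"
    by (rule nn_integral_density[OF \<rho>W NW(1)])
  also have "\<dots> \<le> (\<integral>\<^sup>+p. ennreal h * ?N p \<partial>W)"
  proof (rule nn_integral_mono_AE)
    show "AE p in W. ennreal (\<rho> p) * ?N p \<le> ennreal h * ?N p"
      using \<rho>h by eventually_elim (intro mult_right_mono ennreal_leI, auto)
  qed
  also have "\<dots> = ennreal h * (\<integral>\<^sup>+p. ?N p \<partial>W)" by (rule nn_integral_cmult[OF NW(1)])
  finally show ?thesis by (simp add: W_def add_right_mono)
qed

context
  fixes c and w :: "'e \<Rightarrow> 'e" and K
  assumes c: "c \<in> A" and w: "Ck_on 1 (chart_image c) w"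
    and K: "compact K" "K \<subseteq> chart_image c" and w0: "\<forall>y\<in>chart_image c - K. w y = 0"
begin

lemma chart_field_norm:
  "p \<in> fst c \<Longrightarrow> g p (chart_field c w p) (chart_field c w p) = metric_rep A g c (snd c p) (w (snd c p)) (w (snd c p))"
  using c by (simp add: chart_field_def g_metric_rep)

lemma chart_field_norm_zero: "p \<notin> chart_inv c ` K \<Longrightarrow> g p (chart_field c w p) (chart_field c w p) = 0"
  using chart_field_zero[OF c w K w0] bilinear_lzero[OF g_bilinear] by simp

lemma chart_field_norm_continuous:
  "continuous_on (chart_image c) (\<lambda>y. sqrt (metric_rep A g c y (w y) (w y)))"
proof -
  interpret metric_on "chart_image c" "metric_rep A g c" by (rule metric_on_chart[OF c])
  show ?thesis
    by (intro continuous_on_real_sqrt continuous_on_bilinear_family[OF G_bilinear Ck1_continuous[OF G_Ck1]] Ck1_continuous w)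
qed

lemma chart_field_norm_measurable:
  "(\<lambda>p. sqrt (g p (chart_field c w p) (chart_field c w p))) \<in> borel_measurable borel"
proof -
  have "continuous_on (fst c) (\<lambda>p. sqrt (metric_rep A g c (snd c p) (w (snd c p)) (w (snd c p))))"
    by (rule continuous_on_compose2[OF chart_field_norm_continuous continuous_chart[OF c]]) simp
  from borel_measurable_continuous_on_indicator[OF borel_open[OF open_chart(1)[OF c]] this]
  have "(\<lambda>p. indicator (fst c) p *\<^sub>R sqrt (metric_rep A g c (snd c p) (w (snd c p)) (w (snd c p)))) \<in> borel_measurable borel" .
  moreover have "indicator (fst c) p *\<^sub>R sqrt (metric_rep A g c (snd c p) (w (snd c p)) (w (snd c p)))
     = sqrt (g p (chart_field c w p) (chart_field c w p))" for p
  proof (cases "p \<in> fst c")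
    case False
    then have "chart_field c w p = 0" by (simp add: chart_field_def)
    then show ?thesis using False bilinear_lzero[OF g_bilinear] by simp
  qed (simp add: chart_field_norm)
  ultimately show ?thesis by simp
qed

lemma chart_field_norm_bounded:
  obtains D where "0 \<le> D" "\<And>p. sqrt (g p (chart_field c w p) (chart_field c w p)) \<le> D"
proof -
  from compact_imp_bounded[OF compact_continuous_image[OF continuous_on_subset[OF chart_field_norm_continuous K(2)] K(1)]]
  obtain b where b: "\<forall>x\<in>(\<lambda>y. sqrt (metric_rep A g c y (w y) (w y))) ` K. norm x \<le> b" unfolding bounded_iff by blast
  show thesis
  proof (rule that[of "\<bar>b\<bar>"])
    fix p
    show "sqrt (g p (chart_field c w p) (chart_field c w p)) \<le> \<bar>b\<bar>"
    proof (cases "p \<in> chart_inv c ` K")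
      case True
      then obtain y where y: "y \<in> K" "p = chart_inv c y" by blast
      have "p \<in> fst c" "snd c p = y"
        using y chart_inv_in[OF subsetD[OF K(2) y(1)]] chart_chart_inv[OF subsetD[OF K(2) y(1)]] by auto
      then show ?thesis using b y(1) chart_field_norm[of p] by fastforce
    next
      case False
      then show ?thesis using chart_field_norm_zero by simp
    qed
  qed simp
qed

text \<open>Integrate the pointwise inequality. The term \<open>h * N\<close> subtracted there is
  exactly what the mean curvature can contribute to the first variation, so the two cancel.
  \<open>D\<close> is built from bounds on the field alone, hence uniform in the varifold.\<close>

lemma area_estimate:
  assumes h: "0 \<le> h" and c0: "0 < c0" and Ob: "open Ob" "Ob \<subseteq> chart_image c"
    and Bad: "compact Bad" "Bad \<subseteq> chart_image c"
    and core: "\<And>y I. y \<in> chart_image c \<Longrightarrow> y \<notin> Bad \<Longrightarrow> finite I \<Longrightarrow> card I = m \<Longrightarrow>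
       (\<And>e f. e \<in> I \<Longrightarrow> f \<in> I \<Longrightarrow> metric_rep A g c y e f = (if e = f then 1 else 0)) \<Longrightarrow>
       (if y \<in> Ob then c0 else 0) \<le> (\<Sum>e\<in>I. lie_form (metric_rep A g c) w y e) - h * sqrt (metric_rep A g c y (w y) (w y))"
  obtains D where "0 \<le> D" "\<And>V H \<beta>. varifold A m V \<Longrightarrow> mean_curvature_and_boundary A g V H \<beta> \<Longrightarrow>
      (AE p in weight V. sqrt (g p (H p) (H p)) \<le> h) \<Longrightarrow>
      emeasure (weight V) (chart_inv c ` Ob - chart_inv c ` Bad)
        \<le> ennreal D * emeasure (weight V) (chart_inv c ` Bad) + ennreal D * emeasure \<beta> (chart_inv c ` K)"
proof -
  interpret metric_on "chart_image c" "metric_rep A g c" by (rule metric_on_chart[OF c])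
  define X where "X = chart_field c w"
  define N where "N p = sqrt (g p (X p) (X p))" for p
  define O' where "O' = chart_inv c ` Ob"
  define B' where "B' = chart_inv c ` Bad"
  define K' where "K' = chart_inv c ` K"
  have O'_eq: "O' = fst c \<inter> snd c -` Ob"
    unfolding O'_def using Ob(2) chart_inv_in[of _ c] chart_chart_inv[of _ c] chart_inv_chart[OF c] by force
  have O': "open O'" unfolding O'_eq by (rule open_chart_vimage[OF c Ob(1)])
  have B': "compact B'" unfolding B'_def by (rule compact_chart_inv[OF c Bad])
  have K': "compact K'" unfolding K'_def by (rule compact_chart_inv[OF c K])
  have sB': "B' \<in> sets borel" and sK': "K' \<in> sets borel" and sO': "O' - B' \<in> sets borel"
    using B' K' O' by (auto intro: borel_compact borel_open)
  obtain D1 where D1: "0 \<le> D1" "\<And>(p :: 'a) (S :: 'e set). (p, S) \<in> grassmann_bundle m \<Longrightarrow> \<bar>plane_div A g X p S\<bar> \<le> D1"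
    using plane_div_chart_field_bounded[OF c w K w0, of m] unfolding X_def by blast
  obtain D2 where D2: "0 \<le> D2" "\<And>p. N p \<le> D2" using chart_field_norm_bounded unfolding N_def X_def by blast
  have N0: "0 \<le> N p" for p
    unfolding N_def using pos_def_form.b_nonneg[OF g_pos_def] by simp
  have NK: "N p = 0" if "p \<notin> K'" for p using chart_field_norm_zero that by (simp add: N_def X_def K'_def)
  have Nm: "N \<in> borel_measurable borel" unfolding N_def[abs_def] X_def by (rule chart_field_norm_measurable)
  have point: "(if p \<in> O' then c0 else 0) \<le> plane_div A g X p S - h * N p"
    if pS: "(p, S) \<in> grassmann_bundle m" "p \<notin> B'" for p S
  proof (cases "p \<in> fst c")
    case True
    have y: "snd c p \<in> chart_image c" using True by simp
    have yB: "snd c p \<notin> Bad" using pS(2) chart_inv_chart[OF c True] unfolding B'_def by (metis imageI)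
    have "subspace S" using pS by (simp add: grassmann_bundle_def)
    then obtain I where I: "orthonormal_basis_of (metric_rep A g c (snd c p)) (chart_deriv A c p ` S) I"
      "plane_div A g X p S = (\<Sum>e\<in>I. lie_form (metric_rep A g c) w (snd c p) e)"
      using plane_div_chart_field[OF c w K w0 True] unfolding X_def by blast
    interpret pos_def_form "metric_rep A g c (snd c p)" by (rule pos_def[OF y])
    have cardI: "card I = m" using orthonormal_basis_card[OF I(1)] chart_deriv_plane(3)[OF c True pS(1)] by simp
    have "p \<in> O' \<longleftrightarrow> snd c p \<in> Ob" using True by (simp add: O'_eq)
    moreover have "N p = sqrt (metric_rep A g c (snd c p) (w (snd c p)) (w (snd c p)))"
      using chart_field_norm[OF True] by (simp add: N_def X_def)
    ultimately show ?thesis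
      using core[OF y yB orthonormal_basis_finite[OF I(1)] cardI orthonormal_basis_unit[OF I(1)]] I(2) by simp
  next
    case False
    then have "p \<notin> K'" using chart_inv_in[OF subsetD[OF K(2)]] by (auto simp: K'_def)
    then show ?thesis
      using False NK plane_div_chart_field_zero[OF c w K w0, of p S] by (simp add: O'_eq X_def K'_def)
  qed
  \<comment> \<open>On \<open>Bad\<close> the sign is unknown, so the worst case is paid: divergence
    at least \<open>- D1\<close>, and \<open>h * N\<close> at most \<open>h * D2\<close>.\<close>
  define D3 where "D3 = D1 + h * D2"
  have D3: "0 \<le> D3" using D1 D2 h by (simp add: D3_def)
  have point': "c0 * indicator (O' - B') p \<le> plane_div A g X p S - h * N p + D3 * indicator B' p"
    if pS: "(p, S) \<in> grassmann_bundle m" for p S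
  proof (cases "p \<in> B'")
    case True
    have "h * N p \<le> h * D2" using D2 h by (intro mult_left_mono) auto
    then show ?thesis using True D1(2)[OF pS] by (simp add: D3_def)
  next
    case False
    then show ?thesis using point[OF pS False] by (auto simp: indicator_def split: if_splits)
  qed
  define D where "D = (D2 + D3) / c0"
  show thesis
  proof (rule that[of D])
    show "0 \<le> D" using D2 D3 c0 by (simp add: D_def)
    fix V H \<beta>
    assume V: "varifold A m V" and mcb: "mean_curvature_and_boundary A g V H \<beta>"
      and curv: "AE p in weight V. sqrt (g p (H p) (H p)) \<le> h"
    have \<beta>: "radon_measure \<beta>" using mcb by (auto simp: mean_curvature_and_boundary_def)
    then have s\<beta>: "sets \<beta> = sets borel" by (simp add: radon_measure_def)
    define W where "W = weight V"
    have sW: "sets W = sets borel" by (simp add: W_def weight_def)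
    have spV: "space V = grassmann_bundle m" using V by (simp add: varifold_def)
    have WK: "emeasure W K' < \<infinity>" and WB: "emeasure W B' < \<infinity>"
      unfolding W_def K'_def B'_def by (rule weight_chart_compact_finite[OF V c K] weight_chart_compact_finite[OF V c Bad])+
    note fstm = varifold_fst_measurable[OF V]
    have NW: "integrable W N"
    proof (rule integrableI_bounded_set[of K'])
      show "K' \<in> sets W" "N \<in> borel_measurable W" using sK' Nm sW by (simp_all cong: measurable_cong_sets)
      show "AE x in W. x \<in> K' \<longrightarrow> norm (N x) \<le> D2" using D2 N0 by simp
      show "AE x in W. x \<notin> K' \<longrightarrow> N x = 0" using NK by simp
    qed (use WK in simp)
    have BW: "integrable W (indicator B' :: 'a \<Rightarrow> real)" using WB sB' sW by (simp add: integrable_indicator_iff)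
    have NV: "integrable V (\<lambda>x. N (fst x))" and BV: "integrable V (\<lambda>x. indicator B' (fst x) :: real)"
      using NW BW sB' Nm fstm unfolding W_def weight_def by (simp_all add: integrable_distr_eq)
    have NI: "(\<integral>x. N (fst x) \<partial>V) = (\<integral>p. N p \<partial>W)" and BI: "(\<integral>x. indicator B' (fst x) \<partial>V) = measure W B'"
      using integral_distr[OF fstm Nm] integral_distr[OF fstm, of "indicator B' :: 'a \<Rightarrow> real"] sB' sW
      by (simp_all add: W_def weight_def)
    have dV: "integrable V (\<lambda>(p, S). plane_div A g X p S)"
      unfolding X_def by (rule plane_div_chart_field_integrable[OF c w K w0 V])
    define F where "F x = plane_div A g X (fst x) (snd x) - h * N (fst x) + D3 * indicator B' (fst x)" for x
    have FI: "integrable V F"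
      unfolding F_def[abs_def] using dV NV BV by (auto simp: case_prod_beta')
    have intF: "(\<integral>x. F x \<partial>V) = first_variation A g V X - h * (\<integral>p. N p \<partial>W) + D3 * measure W B'"
      unfolding F_def[abs_def] using dV NV BV NI BI by (simp add: case_prod_beta' first_variation_def)
    have F0: "c0 * indicator (O' - B') (fst x) \<le> F x" if "x \<in> space V" for x
      using point'[of "fst x" "snd x"] that by (simp add: F_def spV)
    define b where "b = (\<integral>\<^sup>+p. ennreal (N p) \<partial>\<beta>)"
    have bK: "b \<le> ennreal D2 * emeasure \<beta> K'"
    proof -
      have "b \<le> (\<integral>\<^sup>+p. ennreal D2 * indicator K' p \<partial>\<beta>)"
        unfolding b_def using D2(2) NK by (intro nn_integral_mono) (auto simp: indicator_def intro: ennreal_leI)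
      also have "\<dots> = ennreal D2 * emeasure \<beta> K'" using sK' s\<beta> by (intro nn_integral_cmult_indicator) simp
      finally show ?thesis .
    qed
    \<comment> \<open>Finiteness permits the passage from \<open>ennreal\<close> to reals, where the
      curvature term can be subtracted.\<close>
    have "emeasure \<beta> K' < \<infinity>" using \<beta> K' by (simp add: radon_measure_def)
    then have "b < \<infinity>" using bK by (simp add: ennreal_mult_less_top le_less_trans)
    then obtain b' where b': "0 \<le> b'" "b = ennreal b'" by (cases b) auto
    have "ennreal \<bar>first_variation A g V X\<bar> \<le> ennreal h * (\<integral>\<^sup>+p. ennreal (N p) \<partial>W) + b"
      unfolding W_def b_def N_def X_def
      by (rule first_variation_bound[OF mcb h curv test_field_chart_field[OF c w K w0] chart_field_norm_measurable])
    also have "(\<integral>\<^sup>+p. ennreal (N p) \<partial>W) = ennreal (\<integral>p. N p \<partial>W)"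
      using NW N0 by (intro nn_integral_eq_integral) auto
    finally have "ennreal \<bar>first_variation A g V X\<bar> \<le> ennreal (h * (\<integral>p. N p \<partial>W) + b')"
      using h b' N0 by (simp add: ennreal_mult integral_nonneg)
    then have "\<bar>first_variation A g V X\<bar> \<le> h * (\<integral>p. N p \<partial>W) + b'"
      using h b' N0 by (subst (asm) ennreal_le_iff) (auto intro!: add_nonneg_nonneg mult_nonneg_nonneg integral_nonneg)
    then have intF_le: "(\<integral>x. F x \<partial>V) \<le> b' + D3 * measure W B'" unfolding intF by linarith
    have "ennreal c0 * emeasure W (O' - B') = (\<integral>\<^sup>+p. ennreal c0 * indicator (O' - B') p \<partial>W)"
      using sO' sW by (intro nn_integral_cmult_indicator[symmetric]) simp
    also have "\<dots> = (\<integral>\<^sup>+x. ennreal c0 * indicator (O' - B') (fst x) \<partial>V)"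
      unfolding W_def weight_def using sO' by (intro nn_integral_distr fstm) simp
    also have "\<dots> \<le> (\<integral>\<^sup>+x. ennreal (F x) \<partial>V)"
    proof (rule nn_integral_mono)
      fix x assume "x \<in> space V"
      from ennreal_leI[OF F0[OF this]] c0
      show "ennreal c0 * indicator (O' - B') (fst x) \<le> ennreal (F x)"
        by (simp add: ennreal_mult ennreal_indicator)
    qed
    also have "\<dots> = ennreal (\<integral>x. F x \<partial>V)"
    proof (rule nn_integral_eq_integral[OF FI])
      show "AE x in V. 0 \<le> F x"
      proof (rule AE_I2)
        show "0 \<le> F x" if "x \<in> space V" for x
          using F0[OF that] c0 by (intro order_trans[OF _ F0[OF that]]) simp
      qed
    qed
    also have "\<dots> \<le> ennreal (b' + D3 * measure W B')" by (rule ennreal_leI[OF intF_le])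
    also have "\<dots> = b + ennreal D3 * emeasure W B'"
      using b' D3 WB by (simp add: ennreal_mult emeasure_eq_ennreal_measure)
    also have "\<dots> \<le> ennreal (D2 + D3) * emeasure \<beta> K' + ennreal (D2 + D3) * emeasure W B'"
      using D2 D3 by (intro add_mono order_trans[OF bK] mult_right_mono ennreal_leI) auto
    finally have "ennreal (1 / c0) * (ennreal c0 * emeasure W (O' - B'))
        \<le> ennreal (1 / c0) * (ennreal (D2 + D3) * emeasure \<beta> K' + ennreal (D2 + D3) * emeasure W B')"
      by (rule mult_left_mono) simp
    moreover have "ennreal (1 / c0) * (ennreal c0 * z) = z" for z
      using c0 by (simp add: ennreal_mult[symmetric] mult.assoc[symmetric])
    moreover have "ennreal (1 / c0) * (ennreal (D2 + D3) * z) = ennreal D * z" for z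
    proof -
      have "ennreal (1 / c0) * ennreal (D2 + D3) = ennreal D"
        by (subst ennreal_mult[symmetric]) (use c0 D2 D3 in \<open>simp_all add: D_def\<close>)
      then show ?thesis by (simp only: mult.assoc[symmetric])
    qed
    ultimately show "emeasure (weight V) (chart_inv c ` Ob - chart_inv c ` Bad)
        \<le> ennreal D * emeasure (weight V) (chart_inv c ` Bad) + ennreal D * emeasure \<beta> (chart_inv c ` K)"
      by (simp add: distrib_left W_def O'_def B'_def K'_def add.commute)
  qed
qed

end

end

section \<open>Area blow-up\<close>

text \<open>The mean value inequality for \<open>f\<close> minus its linearization at
  \<open>x\<close>. The uniformity in both points is what the cone condition between arbitrary
  points of the submanifold rests on.\<close>

lemma Ck1_strict_derivative:
  fixes f :: "'e::euclidean_space \<Rightarrow> 'f::real_normed_vector"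
  assumes f: "Ck_on 1 S f" and S: "open S" "x \<in> S" and \<epsilon>: "0 < \<epsilon>"
  obtains r where "0 < r" "ball x r \<subseteq> S"
    "\<And>a b. a \<in> ball x r \<Longrightarrow> b \<in> ball x r \<Longrightarrow>
       norm (f a - f b - frechet_derivative f (at x) (a - b)) \<le> \<epsilon> * norm (a - b)"
proof -
  define D where "D z = frechet_derivative f (at z)" for z
  have D: "(f has_derivative D z) (at z)" if "z \<in> S" for z
    unfolding D_def by (rule Ck1_has_derivative[OF f that])
  define E where "E z = (\<Sum>b\<in>Basis. norm (D z b - D x b))" for z
  have "continuous_on S E"
    unfolding E_def D_def
    by (intro continuous_on_sum continuous_on_norm continuous_on_diff Ck1_continuous_derivative[OF f] continuous_on_const)
  then have "isCont E x" using S by (simp add: continuous_on_eq_continuous_at)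
  moreover have "E x = 0" by (simp add: E_def)
  ultimately obtain d where d: "d > 0" "\<And>z. dist z x < d \<Longrightarrow> \<bar>E z\<bar> < \<epsilon>"
    unfolding continuous_at_eps_delta using \<epsilon> by (metis diff_zero dist_real_def)
  obtain r0 where r0: "r0 > 0" "ball x r0 \<subseteq> S" using S openE by blast
  define r where "r = min d r0"
  have r: "0 < r" "ball x r \<subseteq> S" using d r0 by (auto simp: r_def)
  show thesis
  proof (rule that[OF r])
    fix a b assume ab: "a \<in> ball x r" "b \<in> ball x r"
    have lin: "linear (D x)" by (rule has_derivative_linear[OF D[OF S(2)]])
    have der: "((\<lambda>z. f z - D x z) has_derivative (\<lambda>v. D z v - D x v)) (at z within ball x r)"
      if "z \<in> ball x r" for z
      using that r(2) lin
      by (intro has_derivative_diff has_derivative_at_withinI[OF D] linear_imp_has_derivative) auto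
    have on: "onorm (\<lambda>v. D z v - D x v) \<le> \<epsilon>" if z: "z \<in> ball x r" for z
    proof (rule onorm_le)
      fix v :: 'e
      have linz: "linear (\<lambda>v. D z v - D x v)"
        using has_derivative_linear[OF D[OF subsetD[OF r(2) z]]] lin by (rule linear_compose_sub)
      have "D z v - D x v = (\<Sum>b\<in>Basis. (v \<bullet> b) *\<^sub>R (D z b - D x b))"
        using linear_sum[OF linz, of "\<lambda>b. (v \<bullet> b) *\<^sub>R b" Basis] linear_cmul[OF linz]
        by (simp add: euclidean_representation)
      then have "norm (D z v - D x v) \<le> (\<Sum>b\<in>Basis. norm ((v \<bullet> b) *\<^sub>R (D z b - D x b)))"
        by (simp only: norm_sum)
      also have "\<dots> \<le> (\<Sum>b\<in>Basis. norm v * norm (D z b - D x b))"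
        unfolding norm_scaleR by (intro sum_mono mult_right_mono Basis_le_norm) auto
      also have "\<dots> = E z * norm v" by (simp add: E_def sum_distrib_left mult.commute)
      also have "\<dots> \<le> \<epsilon> * norm v"
        using d(2)[of z] z by (intro mult_right_mono) (auto simp: r_def dist_commute)
      finally show "norm (D z v - D x v) \<le> \<epsilon> * norm v" .
    qed
    have "norm ((f a - D x a) - (f b - D x b)) \<le> \<epsilon> * norm (a - b)"
      by (rule differentiable_bound[OF convex_ball der on ab])
    then show "norm (f a - f b - frechet_derivative f (at x) (a - b)) \<le> \<epsilon> * norm (a - b)"
      by (simp add: D_def[symmetric] linear_diff[OF lin] algebra_simps)
  qed
qed

text \<open>The regularity of the submanifold is used only through this cone condition.\<close>

lemma straightened_set_cone:
  fixes F F' :: "'e::euclidean_space \<Rightarrow> 'e"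
  assumes W: "open W" "y0 \<in> W" "open (F ` W)" and hom: "homeomorphism W (F ` W) F F'"
    and F: "Ck_on 1 W F" and F': "Ck_on 1 (F ` W) F'" and L: "subspace L"
    and M: "F ` (W \<inter> M) = F ` W \<inter> L"
  obtains T where "subspace T" "dim T = dim L"
    "\<And>\<eta>. 0 < \<eta> \<Longrightarrow> \<exists>r>0. \<forall>y\<in>M \<inter> ball y0 r. \<forall>y'\<in>M \<inter> ball y0 r. \<exists>u\<in>T. norm (y - y' - u) \<le> \<eta> * norm (y - y')"
proof -
  define x0 where "x0 = F y0"
  have x0: "x0 \<in> F ` W" using W by (simp add: x0_def)
  have inv: "F' (F y) = y" if "y \<in> W" for y using hom that by (auto simp: homeomorphism_def)
  have inv': "F (F' x) = x" if "x \<in> F ` W" for x using hom that by (auto simp: homeomorphism_def)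
  define D where "D = frechet_derivative F (at y0)"
  define D' where "D' = frechet_derivative F' (at x0)"
  have D: "(F has_derivative D) (at y0)" unfolding D_def by (rule Ck1_has_derivative[OF F W(2)])
  have D': "(F' has_derivative D') (at x0)" unfolding D'_def by (rule Ck1_has_derivative[OF F' x0])
  have linD: "linear D" and linD': "linear D'" using D D' has_derivative_linear by blast+
  have "(F has_derivative D) (at (F' x0))" using D inv[OF W(2)] by (simp add: x0_def)
  from has_derivative_compose[OF D' this]
  have "((\<lambda>x. x) has_derivative (\<lambda>v. D (D' v))) (at x0)"
    by (rule has_derivative_transform_within_open[OF _ W(3) x0]) (rule inv')
  \<comment> \<open>The chain rule for \<open>F \<circ> F'\<close> shows \<open>D'\<close> to be
    injective, so the tangent plane \<open>T\<close> has the dimension of \<open>L\<close>.\<close>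
  then have DD': "D (D' v) = v" for v using has_derivative_unique[OF has_derivative_ident] by metis
  then have "inj D'" by (metis injI)
  define T where "T = D' ` L"
  have T: "subspace T" "dim T = dim L"
    unfolding T_def using linear_subspace_image[OF linD' L] dim_image_eq[OF linD' inj_on_subset[OF \<open>inj D'\<close> subset_UNIV]] by auto
  obtain b where b: "0 < b" "\<And>v. norm (D v) \<le> b * norm v" using linear_bounded_pos[OF linD] by blast
  obtain r1 where r1: "0 < r1" "ball y0 r1 \<subseteq> W"
    "\<And>y y'. y \<in> ball y0 r1 \<Longrightarrow> y' \<in> ball y0 r1 \<Longrightarrow> norm (F y - F y' - D (y - y')) \<le> 1 * norm (y - y')"
    using Ck1_strict_derivative[OF F W(1,2), of 1] unfolding D_def by (metis zero_less_one)
  have lip: "norm (F y - F y') \<le> (b + 1) * norm (y - y')" if "y \<in> ball y0 r1" "y' \<in> ball y0 r1" for y y'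
    using norm_triangle_ineq[of "F y - F y' - D (y - y')" "D (y - y')"] r1(3)[OF that] b(2)[of "y - y'"]
    by (simp add: algebra_simps)
  show thesis
  proof (rule that[OF T])
    fix \<eta> :: real assume \<eta>: "0 < \<eta>"
    \<comment> \<open>Distances are measured after applying \<open>F\<close>; dividing by its
      Lipschitz constant \<open>b + 1\<close> compensates for that in advance.\<close>
    then have e: "0 < \<eta> / (b + 1)" using b by simp
    obtain r2 where r2: "0 < r2" "ball x0 r2 \<subseteq> F ` W"
      "\<And>x x'. x \<in> ball x0 r2 \<Longrightarrow> x' \<in> ball x0 r2 \<Longrightarrow> norm (F' x - F' x' - D' (x - x')) \<le> \<eta> / (b + 1) * norm (x - x')"
      using Ck1_strict_derivative[OF F' W(3) x0 e] unfolding D'_def by metis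
    define r where "r = min r1 (r2 / (b + 1))"
    have r: "0 < r" using r1(1) r2(1) b(1) by (simp add: r_def)
    have near: "F y \<in> ball x0 r2" if "y \<in> ball y0 r" for y
    proof -
      have y: "y \<in> ball y0 r1" using that by (simp add: r_def)
      have "norm (F y0 - F y) \<le> (b + 1) * norm (y0 - y)" using lip[of y0 y] y r1(1) by simp
      also have "\<dots> < (b + 1) * (r2 / (b + 1))"
        using that b(1) by (intro mult_strict_left_mono) (auto simp: r_def dist_norm)
      finally show ?thesis using b(1) by (simp add: x0_def dist_norm)
    qed
    show "\<exists>r>0. \<forall>y\<in>M \<inter> ball y0 r. \<forall>y'\<in>M \<inter> ball y0 r. \<exists>u\<in>T. norm (y - y' - u) \<le> \<eta> * norm (y - y')"
    proof (intro exI[of _ r] conjI r ballI)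
      fix y y' assume y: "y \<in> M \<inter> ball y0 r" "y' \<in> M \<inter> ball y0 r"
      then have y1: "y \<in> ball y0 r1" "y' \<in> ball y0 r1" by (auto simp: r_def)
      then have yW: "y \<in> W" "y' \<in> W" using r1(2) by auto
      have "F y \<in> L" "F y' \<in> L" using M yW y by blast+
      then have u: "D' (F y - F y') \<in> T" unfolding T_def using L by (intro imageI subspace_diff)
      have "norm (y - y' - D' (F y - F y')) \<le> \<eta> / (b + 1) * norm (F y - F y')"
        using r2(3)[OF near near, of y y'] y inv[OF yW(1)] inv[OF yW(2)] by simp
      also have "\<dots> \<le> \<eta> / (b + 1) * ((b + 1) * norm (y - y'))"
        using e by (intro mult_left_mono lip y1) simp
      also have "\<dots> = \<eta> * norm (y - y')" using b(1) by simp
      finally show "\<exists>u\<in>T. norm (y - y' - u) \<le> \<eta> * norm (y - y')" using u by blast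
    qed
  qed
qed

section \<open>Finite upper limits and the blow-up set\<close>

lemma limsup_finite_iff:
  fixes x :: "nat \<Rightarrow> ennreal"
  shows "limsup x < \<infinity> \<longleftrightarrow> (\<exists>C. C < \<infinity> \<and> (\<forall>\<^sub>F i in sequentially. x i \<le> C))"
proof
  assume "limsup x < \<infinity>"
  then obtain C where C: "limsup x < C" "C < \<infinity>" using dense by blast
  then have "\<forall>\<^sub>F i in sequentially. x i < C" by (intro Limsup_lessD)
  then have "\<forall>\<^sub>F i in sequentially. x i \<le> C" by (rule eventually_mono) simp
  then show "\<exists>C. C < \<infinity> \<and> (\<forall>\<^sub>F i in sequentially. x i \<le> C)" using C by blast
next
  assume "\<exists>C. C < \<infinity> \<and> (\<forall>\<^sub>F i in sequentially. x i \<le> C)"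
  then obtain C where C: "C < \<infinity>" "\<forall>\<^sub>F i in sequentially. x i \<le> C" by blast
  from Limsup_bounded[OF C(2)] C(1) show "limsup x < \<infinity>" by (rule le_less_trans)
qed

lemma limsup_finite_mono:
  fixes x y :: "nat \<Rightarrow> ennreal"
  assumes "limsup y < \<infinity>" "\<And>i. x i \<le> y i" shows "limsup x < \<infinity>"
  using assms(1) Limsup_mono[of x y sequentially] assms(2) by (auto intro: le_less_trans)

lemma limsup_finite_combination:
  fixes x y :: "nat \<Rightarrow> ennreal"
  assumes "limsup x < \<infinity>" "limsup y < \<infinity>"
  shows "limsup (\<lambda>i. ennreal a * x i + ennreal b * y i) < \<infinity>"
proof -
  obtain C D where C: "C < \<infinity>" "\<forall>\<^sub>F i in sequentially. x i \<le> C" and D: "D < \<infinity>" "\<forall>\<^sub>F i in sequentially. y i \<le> D"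
    using assms unfolding limsup_finite_iff by blast
  have "\<forall>\<^sub>F i in sequentially. ennreal a * x i + ennreal b * y i \<le> ennreal a * C + ennreal b * D"
    using C(2) D(2) by eventually_elim (intro add_mono mult_left_mono, auto)
  moreover have "ennreal a * C + ennreal b * D < \<infinity>" using C(1) D(1) by (simp add: ennreal_mult_less_top)
  ultimately show ?thesis unfolding limsup_finite_iff by blast
qed

text \<open>Testing with open sets makes the complement open at once, since one neighbourhood of
  bounded measure serves all its points.\<close>

definition blow_up_set :: "(nat \<Rightarrow> 'a::topological_space measure) \<Rightarrow> 'a set" where
  "blow_up_set \<mu> = {p. \<forall>U. open U \<longrightarrow> p \<in> U \<longrightarrow> \<not> limsup (\<lambda>i. emeasure (\<mu> i) U) < \<infinity>}"

lemma closed_blow_up_set: "closed (blow_up_set \<mu>)"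
  unfolding closed_def
proof (subst open_subopen, rule ballI)
  fix p assume "p \<in> - blow_up_set \<mu>"
  then obtain U where "open U" "p \<in> U" "limsup (\<lambda>i. emeasure (\<mu> i) U) < \<infinity>" by (auto simp: blow_up_set_def)
  then show "\<exists>T. open T \<and> p \<in> T \<and> T \<subseteq> - blow_up_set \<mu>" by (intro exI[of _ U]) (auto simp: blow_up_set_def)
qed

text \<open>Finitely many neighbourhoods of bounded measure cover \<open>K\<close>, and eventual
  bounds add up.\<close>

lemma limsup_finite_off_blow_up_set:
  assumes s: "\<And>i. sets (\<mu> i) = sets borel" and K: "compact K" "K \<inter> blow_up_set \<mu> = {}"
  shows "limsup (\<lambda>i. emeasure (\<mu> i) K) < \<infinity>"
proof -
  have "\<forall>p\<in>K. \<exists>U. open U \<and> p \<in> U \<and> limsup (\<lambda>i. emeasure (\<mu> i) U) < \<infinity>"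
    using K(2) unfolding blow_up_set_def by blast
  then obtain U where U: "\<And>p. p \<in> K \<Longrightarrow> open (U p) \<and> p \<in> U p \<and> limsup (\<lambda>i. emeasure (\<mu> i) (U p)) < \<infinity>"
    by metis
  obtain I where I: "I \<subseteq> K" "finite I" "K \<subseteq> (\<Union>p\<in>I. U p)"
    using compactE_image[OF K(1), of K U] U by blast
  have fin: "limsup (\<lambda>i. emeasure (\<mu> i) (\<Union>p\<in>I. U p)) < \<infinity>"
    using I(2,1)
  proof (induction I rule: finite_induct)
    case (insert p J)
    have o: "open (U p)" "open (\<Union>p\<in>J. U p)" using insert U by auto
    have "limsup (\<lambda>i. ennreal 1 * emeasure (\<mu> i) (U p) + ennreal 1 * emeasure (\<mu> i) (\<Union>p\<in>J. U p)) < \<infinity>"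
      using insert U by (intro limsup_finite_combination) auto
    then show ?case
      by (rule limsup_finite_mono) (use o s in \<open>auto intro!: emeasure_subadditive\<close>)
  qed (simp add: Limsup_const)
  have "open (\<Union>p\<in>I. U p)" using I(1) U by auto
  then have m: "(\<Union>p\<in>I. U p) \<in> sets (\<mu> i)" for i using s by simp
  show ?thesis by (rule limsup_finite_mono[OF fin emeasure_mono[OF I(3) m]])
qed

text \<open>The area hypothesis concerns compact sets, the blow-up set open ones; a closed
  coordinate ball mediates between the two.\<close>

lemma (in smooth_manifold) blow_up_set_subset:
  fixes \<mu> :: "nat \<Rightarrow> 'a measure"
  assumes s: "\<And>i. sets (\<mu> i) = sets borel" and \<Sigma>: "closed \<Sigma>"
    and bd: "\<And>K. compact K \<Longrightarrow> K \<subseteq> - \<Sigma> \<Longrightarrow> limsup (\<lambda>i. emeasure (\<mu> i) K) < \<infinity>"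
  shows "blow_up_set \<mu> \<subseteq> \<Sigma>"
proof (rule ccontr)
  assume "\<not> blow_up_set \<mu> \<subseteq> \<Sigma>"
  then obtain p where p: "p \<in> blow_up_set \<mu>" "p \<notin> \<Sigma>" by blast
  define c where "c = chart_at A p"
  have c: "c \<in> A" "p \<in> fst c" by (simp_all add: c_def chart_at_in)
  have "open (snd c ` (fst c \<inter> - \<Sigma>))" using \<Sigma> by (intro open_chart_image c) auto
  moreover have "snd c p \<in> snd c ` (fst c \<inter> - \<Sigma>)" using c p by blast
  ultimately obtain r where r: "r > 0" "cball (snd c p) r \<subseteq> snd c ` (fst c \<inter> - \<Sigma>)"
    using open_contains_cball by blast
  define K where "K = chart_inv c ` cball (snd c p) r"
  have "compact K" unfolding K_def using r(2) by (intro compact_chart_inv c) auto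
  moreover have "K \<subseteq> - \<Sigma>"
  proof
    fix q assume "q \<in> K"
    then obtain y where "y \<in> cball (snd c p) r" "q = chart_inv c y" by (auto simp: K_def)
    then show "q \<in> - \<Sigma>" using subsetD[OF r(2), of y] chart_inv_chart[OF c(1)] by auto
  qed
  ultimately have "limsup (\<lambda>i. emeasure (\<mu> i) K) < \<infinity>" by (rule bd)
  moreover define U where "U = fst c \<inter> snd c -` ball (snd c p) r"
  have "U \<subseteq> K"
  proof
    fix q assume q: "q \<in> U"
    have "q = chart_inv c (snd c q)" using q chart_inv_chart[OF c(1), of q] by (simp add: U_def)
    moreover have "snd c q \<in> cball (snd c p) r" using q by (simp add: U_def)
    ultimately show "q \<in> K" unfolding K_def by (rule image_eqI)
  qed
  moreover have "K \<in> sets borel" using \<open>compact K\<close> by (rule borel_compact)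
  ultimately have "limsup (\<lambda>i. emeasure (\<mu> i) U) < \<infinity>"
    using limsup_finite_mono[of "\<lambda>i. emeasure (\<mu> i) K" "\<lambda>i. emeasure (\<mu> i) U"] s by (simp add: emeasure_mono)
  moreover have "open U" unfolding U_def by (intro open_chart_vimage c open_ball)
  moreover have "p \<in> U" using c r by (simp add: U_def)
  ultimately show False using p(1) by (auto simp: blow_up_set_def)
qed

theorem corollary1p4:
  fixes A :: "('a::{t2_space, second_countable_topology}, 'e::euclidean_space) chart set"
    and g :: "'a \<Rightarrow> 'e \<Rightarrow> 'e \<Rightarrow> real"
    and m :: nat
    and M \<Sigma> :: "'a set"
    and V :: "nat \<Rightarrow> ('a \<times> 'e set) measure"
    and H :: "nat \<Rightarrow> 'a \<Rightarrow> 'e"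
    and \<beta> :: "nat \<Rightarrow> 'a measure"
  assumes "riemannian_manifold A g"
    and "C1_submanifold A m M" and "connected M"
    and "closed \<Sigma>" and "\<Sigma> \<subset> M"
    and "\<And>i. varifold A m (V i)"
    and "\<And>i. locally_bounded_first_variation A g (V i)"
    and "\<And>i. mean_curvature_and_boundary A g (V i) (H i) (\<beta> i)"
    and boundary_bound: "\<And>K. compact K \<Longrightarrow> limsup (\<lambda>i. emeasure (\<beta> i) K) < \<infinity>"
    and curvature_bound: "\<exists>h. \<forall>i. AE p in weight (V i). sqrt (g p (H i p) (H i p)) \<le> h"
    and area_bound: "\<And>K. compact K \<Longrightarrow> K \<subseteq> - \<Sigma> \<Longrightarrow> limsup (\<lambda>i. emeasure (weight (V i)) K) < \<infinity>"
  shows "\<forall>K. compact K \<longrightarrow> limsup (\<lambda>i. emeasure (weight (V i)) K) < \<infinity>"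
proof -
  interpret riemannian A g
    using assms(1) by unfold_locales (auto simp: riemannian_manifold_def)
  define \<mu> where "\<mu> i = weight (V i)" for i
  have s\<mu>: "sets (\<mu> i) = sets borel" for i by (simp add: \<mu>_def weight_def)
  define Z where "Z = blow_up_set \<mu>"
  have Z: "closed Z" unfolding Z_def by (rule closed_blow_up_set)
  have "Z \<subseteq> \<Sigma>"
    unfolding Z_def using area_bound by (intro blow_up_set_subset s\<mu> assms(4)) (simp add: \<mu>_def)
  then have ZM: "Z \<subset> M" using assms(5) by blast
  have "Z = {}"
  proof (rule ccontr)
    assume Z0: "Z \<noteq> {}"
    have "\<not> openin (top_of_set M) Z"
    proof
      assume "openin (top_of_set M) Z"
      moreover have "closedin (top_of_set M) Z" using Z ZM by (intro closed_subset) auto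
      ultimately show False using assms(3) Z0 ZM unfolding connected_clopen by blast
    qed
    \<comment> \<open>Otherwise each point of \<open>Z\<close> has a neighbourhood meeting
      \<open>M\<close> only in \<open>Z\<close>, and their union shows that \<open>Z\<close> is open
      in \<open>M\<close>.\<close>
    have "\<exists>q\<in>Z. \<forall>U. open U \<longrightarrow> q \<in> U \<longrightarrow> (\<exists>x\<in>M - Z. x \<in> U)"
    proof (rule ccontr)
      assume "\<not> ?thesis"
      then obtain U where U: "\<And>q. q \<in> Z \<Longrightarrow> open (U q) \<and> q \<in> U q \<and> (\<forall>x\<in>M - Z. x \<notin> U q)" by metis
      have "Z = M \<inter> (\<Union>q\<in>Z. U q)" using U ZM by blast
      moreover have "open (\<Union>q\<in>Z. U q)" using U by blast
      ultimately have "openin (top_of_set M) Z" unfolding openin_open by blast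
      with \<open>\<not> openin (top_of_set M) Z\<close> show False ..
    qed
    then obtain q where q: "q \<in> Z" "\<And>U. open U \<Longrightarrow> q \<in> U \<Longrightarrow> \<exists>x\<in>M - Z. x \<in> U" by blast
    \<comment> \<open>The assumed bound carries no sign, while the estimates work with a nonnegative
      constant.\<close>
    obtain h where h: "\<And>i. AE p in weight (V i). sqrt (g p (H i p) (H i p)) \<le> max h 0"
    proof -
      obtain h where h: "AE p in weight (V i). sqrt (g p (H i p) (H i p)) \<le> h" for i using curvature_bound by blast
      have "AE p in weight (V i). sqrt (g p (H i p) (H i p)) \<le> max h 0" for i
        using h[of i] by eventually_elim simp
      then show thesis by (rule that)
    qed
    have qM: "q \<in> M" using q(1) ZM by blast
    from bspec[OF assms(2)[unfolded C1_submanifold_def] qM]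
    obtain c where c: "c \<in> A" "q \<in> fst c"
      and ex: "\<exists>W (F :: 'e \<Rightarrow> 'e) F' L. open W \<and> snd c q \<in> W \<and> W \<subseteq> chart_image c \<and>
           open (F ` W) \<and> homeomorphism W (F ` W) F F' \<and> Ck_on 1 W F \<and> Ck_on 1 (F ` W) F' \<and>
           subspace L \<and> dim L = m \<and> F ` (W \<inter> snd c ` (M \<inter> fst c)) = F ` W \<inter> L"
      by (elim bexE conjE) (rule that)
    from ex obtain W L and F F' :: "'e \<Rightarrow> 'e" where W: "open W" "snd c q \<in> W" "open (F ` W)" "homeomorphism W (F ` W) F F'"
      "Ck_on 1 W F" "Ck_on 1 (F ` W) F'" "subspace L" and dimL: "dim L = m"
      and WL: "F ` (W \<inter> snd c ` (M \<inter> fst c)) = F ` W \<inter> L"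
      by (elim exE conjE) (rule that)
    define y0 where "y0 = snd c q"
    define Zc where "Zc = snd c ` (fst c \<inter> Z)"
    define Mc where "Mc = snd c ` (M \<inter> fst c)"
    note cone = straightened_set_cone[OF W WL, folded Mc_def y0_def, unfolded dimL]
    obtain T where T: "subspace T" "dim T = m"
      "\<And>\<eta>. 0 < \<eta> \<Longrightarrow> \<exists>r>0. \<forall>y\<in>Mc \<inter> ball y0 r. \<forall>y'\<in>Mc \<inter> ball y0 r. \<exists>u\<in>T. norm (y - y' - u) \<le> \<eta> * norm (y - y')"
      by (rule cone) (rule that)
    interpret metric_on "chart_image c" "metric_rep A g c" by (rule metric_on_chart[OF c(1)])
    have y0: "y0 \<in> chart_image c" "y0 \<in> Zc" using c q(1) by (auto simp: y0_def Zc_def)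
    have Zc: "closedin (top_of_set (chart_image c)) Zc"
      unfolding Zc_def chart_image_vimage[OF c(1)]
      by (intro continuous_closedin_preimage continuous_chart_inv c Z)
    have ZcM: "Zc \<subseteq> Mc" using ZM by (auto simp: Zc_def Mc_def)
    have chart_inj: "p = p'" if "p \<in> fst c" "p' \<in> fst c" "snd c p = snd c p'" for p p'
      using that chart_inv_chart[OF c(1)] by metis
    have frontier: "\<exists>a\<in>Mc - Zc. dist a y0 < d" if "0 < d" for d
    proof -
      have "open (fst c \<inter> snd c -` ball y0 d)" by (intro open_chart_vimage c open_ball)
      moreover have "q \<in> fst c \<inter> snd c -` ball y0 d" using c that by (simp add: y0_def)
      ultimately obtain x where x: "x \<in> M - Z" "x \<in> fst c \<inter> snd c -` ball y0 d" using q(2) by blast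
      then have "snd c x \<in> Mc - Zc" using chart_inj by (auto simp: Mc_def Zc_def)
      then show ?thesis using x by (intro bexI[of _ "snd c x"]) (auto simp: dist_commute)
    qed
    obtain w K Ob c0 Bad where b: "Ck_on 1 (chart_image c) w" "compact K" "K \<subseteq> chart_image c"
      "\<And>y. y \<in> chart_image c \<Longrightarrow> y \<notin> K \<Longrightarrow> w y = 0"
      "open Ob" "Ob \<subseteq> chart_image c" "Ob \<inter> Zc \<noteq> {}" "0 < c0" "compact Bad" "Bad \<subseteq> chart_image c" "Bad \<inter> Zc = {}"
      "\<And>y I. y \<in> chart_image c \<Longrightarrow> y \<notin> Bad \<Longrightarrow> finite I \<Longrightarrow> card I = dim T \<Longrightarrow>
         (\<And>e f. e \<in> I \<Longrightarrow> f \<in> I \<Longrightarrow> metric_rep A g c y e f = (if e = f then 1 else 0)) \<Longrightarrow>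
         (if y \<in> Ob then c0 else 0) \<le> (\<Sum>e\<in>I. lie_form (metric_rep A g c) w y e)
            - max h 0 * sqrt (metric_rep A g c y (w y) (w y))"
      by (rule barrier_field_exists[OF y0 Zc ZcM frontier T(1) T(3), of "max h 0"]) (assumption | simp)+
    have w0: "\<forall>y\<in>chart_image c - K. w y = 0" using b(4) by blast
    obtain D where D: "0 \<le> D" "\<And>V H \<beta>. varifold A m V \<Longrightarrow> mean_curvature_and_boundary A g V H \<beta> \<Longrightarrow>
      (AE p in weight V. sqrt (g p (H p) (H p)) \<le> max h 0) \<Longrightarrow>
      emeasure (weight V) (chart_inv c ` Ob - chart_inv c ` Bad)
        \<le> ennreal D * emeasure (weight V) (chart_inv c ` Bad) + ennreal D * emeasure \<beta> (chart_inv c ` K)"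
      by (rule area_estimate[OF c(1) b(1-3) w0 _ b(8,5,6,9,10) b(12)[unfolded T(2)]]) auto
    have in_Z: "chart_inv c y \<in> Z \<longleftrightarrow> y \<in> Zc" if "y \<in> chart_image c" for y
      using chart_image_vimage[OF c(1), of Z] that by (auto simp: Zc_def)
    have Bad: "compact (chart_inv c ` Bad)" by (rule compact_chart_inv[OF c(1) b(9,10)])
    have "chart_inv c ` Bad \<inter> blow_up_set \<mu> = {}"
      using in_Z b(10,11) unfolding Z_def by blast
    then have "limsup (\<lambda>i. emeasure (\<mu> i) (chart_inv c ` Bad)) < \<infinity>"
      by (intro limsup_finite_off_blow_up_set s\<mu> Bad)
    moreover have "limsup (\<lambda>i. emeasure (\<beta> i) (chart_inv c ` K)) < \<infinity>"
      by (intro boundary_bound compact_chart_inv c b)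
    ultimately have "limsup (\<lambda>i. ennreal D * emeasure (\<mu> i) (chart_inv c ` Bad) + ennreal D * emeasure (\<beta> i) (chart_inv c ` K)) < \<infinity>"
      by (rule limsup_finite_combination)
    then have "limsup (\<lambda>i. emeasure (\<mu> i) (chart_inv c ` Ob - chart_inv c ` Bad)) < \<infinity>"
      by (rule limsup_finite_mono) (unfold \<mu>_def, rule D(2)[OF assms(6) assms(8) h])
    \<comment> \<open>An open set of eventually bounded area; it meets \<open>Z\<close> because
      \<open>Ob\<close> does and \<open>Bad\<close> does not, against the definition of the blow-up
      set.\<close>
    moreover have "open (chart_inv c ` Ob - chart_inv c ` Bad)"
    proof (intro open_Diff compact_imp_closed Bad)
      have "chart_inv c ` Ob = fst c \<inter> snd c -` Ob"
        using b(6) chart_inv_in[of _ c] chart_chart_inv[of _ c] chart_inv_chart[OF c(1)] by force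
      then show "open (chart_inv c ` Ob)" using open_chart_vimage[OF c(1) b(5)] by simp
    qed
    moreover obtain y where y: "y \<in> Ob" "y \<in> Zc" using b(7) by blast
    have "chart_inv c y \<in> Z" using in_Z[of y] y b(6) by blast
    moreover have "chart_inv c y \<notin> chart_inv c ` Bad"
      using \<open>chart_inv c ` Bad \<inter> blow_up_set \<mu> = {}\<close> calculation(3) unfolding Z_def by blast
    ultimately show False using y(1) unfolding Z_def blow_up_set_def by blast
  qed
  then have "limsup (\<lambda>i. emeasure (\<mu> i) K) < \<infinity>" if "compact K" for K
    using limsup_finite_off_blow_up_set[OF s\<mu> that] unfolding Z_def by simp
  then show ?thesis by (simp add: \<mu>_def)
qed

end
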